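(* For every $k\ge 1$, the following problem is in $(k+1)$-$\mathrm{EXPSPACE}$: given an attack-defense tree $\theta\in\mathrm{ADT}_k$, decide whether $[\![\theta]\!]\ne\emptyset$.
   Context: $m$-$\mathrm{EXPSPACE}$ is the class of problems solvable in space bounded by an $m$-fold iterated exponential of a polynomial in the input size, with $0$-$\mathrm{EXPSPACE}=\mathrm{PSPACE}$. Let $\mathrm{Prop}$ be a finite set of propositions (with $\top := p\lor\neg p$ for $p\in\mathrm{Prop}$, and $\bot:=\neg\top$) and $\Sigma = 2^{\mathrm{Prop}}$ the alphabet of valuations. A trace is a word in $\Sigma^*$; $\varepsilon$ is the empty trace. The set $\mathrm{ADT}$ of attack-defense trees is defined inductively: the special leaf $\epsilon$ and every propositional formula $\gamma$ over $\mathrm{Prop}$ are in $\mathrm{ADT}$; if $\theta_1,\dots,\theta_n\in\mathrm{ADT}$ then $\mathrm{OR}(\theta_1,\dots,\theta_n)$, $\mathrm{SAND}(\theta_1,\dots,\theta_n)$, $\mathrm{AND}(\theta_1,\dots,\theta_n)\in\mathrm{ADT}$; if $\theta,\theta'\in\mathrm{ADT}$ then $\mathrm{C}(\theta,\theta')\in\mathrm{ADT}$. The size of a tree is the sum of the sizes of its leaves, where the leaf $\epsilon$ has size $1$ and $\gamma$ has its size as a propositional formula. Semantics $[\![\theta]\!]\subseteq\Sigma^*$: $[\![\epsilon]\!]=\{\varepsilon\}$; $[\![\gamma]\!]=\{v_1\cdots v_n\in\Sigma^* : n\ge 1,\ v_n\models\gamma\}$; $\mathrm{OR}$ is interpreted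 as union, $\mathrm{SAND}$ as concatenation (in the given order), $[\![\mathrm{C}(\theta_1,\theta_2)]\!]=[\![\theta_1]\!]\setminus[\![\theta_2]\!]$, and $[\![\mathrm{AND}(\theta_1,\dots,\theta_n)]\!]=\bigcup_{i}\big([\![\theta_i]\!]\cap\bigcap_{j\ne i}[\![\theta_j]\!]\cdot\Sigma^*\big)$. Countermeasure-depth: $\mathrm{cd}(\epsilon)=\mathrm{cd}(\gamma)=0$; $\mathrm{cd}(\mathrm{OP}(\theta_1,\dots,\theta_n))=\max_i\mathrm{cd}(\theta_i)$ for $\mathrm{OP}\in\{\mathrm{OR},\mathrm{SAND},\mathrm{AND}\}$; $\mathrm{cd}(\mathrm{C}(\theta_1,\theta_2))=\max\{\mathrm{cd}(\theta_1),\mathrm{cd}(\theta_2)+1\}$. $\mathrm{ADT}_k=\{\theta\in\mathrm{ADT}:\mathrm{cd}(\theta)\le k\}$. *)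

theory Defs
  imports "HOL-Computational_Algebra.Polynomial"
begin

section \<open>Attack-defense trees\<close>

text \<open>The finite set of propositions is a type of class \<open>finite\<close>, so that a valuation is a value of
  type \<open>'p set\<close> and a trace a value of type \<open>'p set list\<close>. Verum and falsum are derived:
  \<open>Disj (Atom p) (Neg (Atom p))\<close> and its negation.\<close>

datatype 'p form = Atom 'p | Neg "'p form" | Conj "'p form" "'p form" | Disj "'p form" "'p form"

primrec sat :: "'p set \<Rightarrow> 'p form \<Rightarrow> bool" (infix "\<Turnstile>" 55) where
  "v \<Turnstile> Atom p \<longleftrightarrow> p \<in> v"
| "v \<Turnstile> Neg \<gamma> \<longleftrightarrow> \<not> v \<Turnstile> \<gamma>"
| "v \<Turnstile> Conj \<gamma> \<delta> \<longleftrightarrow> v \<Turnstile> \<gamma> \<and> v \<Turnstile> \<delta>"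
| "v \<Turnstile> Disj \<gamma> \<delta> \<longleftrightarrow> v \<Turnstile> \<gamma> \<or> v \<Turnstile> \<delta>"

datatype 'p tree =
    Eps
  | Leaf "'p form"
  | OR "'p tree list"
  | SAND "'p tree list"
  | AND "'p tree list"
  | C "'p tree" "'p tree"

text \<open>The datatype also contains operators without arguments, for which the maximum in the
  countermeasure-depth is meaningless; they are excluded from the set of attack-defense trees.\<close>

inductive_set ADT :: "'p tree set" where
  "Eps \<in> ADT"
| "Leaf \<gamma> \<in> ADT"
| "ts \<noteq> [] \<Longrightarrow> \<forall>t \<in> set ts. t \<in> ADT \<Longrightarrow> OR ts \<in> ADT"
| "ts \<noteq> [] \<Longrightarrow> \<forall>t \<in> set ts. t \<in> ADT \<Longrightarrow> SAND ts \<in> ADT"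
| "ts \<noteq> [] \<Longrightarrow> \<forall>t \<in> set ts. t \<in> ADT \<Longrightarrow> AND ts \<in> ADT"
| "t \<in> ADT \<Longrightarrow> t' \<in> ADT \<Longrightarrow> C t t' \<in> ADT"

definition conc :: "'a list set \<Rightarrow> 'a list set \<Rightarrow> 'a list set" (infixr "\<cdot>" 75) where
  "A \<cdot> B = {u @ v |u v. u \<in> A \<and> v \<in> B}"

primrec sem :: "'p tree \<Rightarrow> 'p set list set" where
  "sem Eps = {[]}"
| "sem (Leaf \<gamma>) = {w. w \<noteq> [] \<and> last w \<Turnstile> \<gamma>}"
| "sem (OR ts) = \<Union> (set (map sem ts))"
| "sem (SAND ts) = foldr (\<cdot>) (map sem ts) {[]}"
| "sem (AND ts) = (let Ls = map sem ts in
     \<Union>i<length Ls. Ls ! i \<inter> (\<Inter>j \<in> {..<length Ls} - {i}. (Ls ! j) \<cdot> UNIV))"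
| "sem (C t t') = sem t - sem t'"

primrec cd :: "'p tree \<Rightarrow> nat" where
  "cd Eps = 0"
| "cd (Leaf \<gamma>) = 0"
| "cd (OR ts) = Max (set (map cd ts))"
| "cd (SAND ts) = Max (set (map cd ts))"
| "cd (AND ts) = Max (set (map cd ts))"
| "cd (C t t') = max (cd t) (cd t' + 1)"

definition ADT_upto :: "nat \<Rightarrow> 'p tree set" where
  "ADT_upto k = {\<theta> \<in> ADT. cd \<theta> \<le> k}"


section \<open>Trees as input words\<close>

text \<open>Polish notation over a finite alphabet, with a closing bracket for the operators of variable
  arity.\<close>

datatype 'p letter =
    LAtom 'p | LNeg | LConj | LDisj | LEps | LOr | LSand | LAnd | LC | LClose

instance letter :: (finite) finite
proof
  have "(UNIV :: 'a letter set) \<subseteq>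
      range LAtom \<union> {LNeg, LConj, LDisj, LEps, LOr, LSand, LAnd, LC, LClose}"
  proof
    fix x :: "'a letter"
    show "x \<in> range LAtom \<union> {LNeg, LConj, LDisj, LEps, LOr, LSand, LAnd, LC, LClose}"
      by (cases x) simp_all
  qed
  then show "finite (UNIV :: 'a letter set)"
    by (rule finite_subset) simp
qed

primrec encode_form :: "'p form \<Rightarrow> 'p letter list" where
  "encode_form (Atom p) = [LAtom p]"
| "encode_form (Neg \<gamma>) = LNeg # encode_form \<gamma>"
| "encode_form (Conj \<gamma> \<delta>) = LConj # encode_form \<gamma> @ encode_form \<delta>"
| "encode_form (Disj \<gamma> \<delta>) = LDisj # encode_form \<gamma> @ encode_form \<delta>"

primrec encode :: "'p tree \<Rightarrow> 'p letter list" where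
  "encode Eps = [LEps]"
| "encode (Leaf \<gamma>) = encode_form \<gamma>"
| "encode (OR ts) = LOr # concat (map encode ts) @ [LClose]"
| "encode (SAND ts) = LSand # concat (map encode ts) @ [LClose]"
| "encode (AND ts) = LAnd # concat (map encode ts) @ [LClose]"
| "encode (C t t') = LC # encode t @ encode t'"

lemma encode_form_prefix_free:
  "encode_form \<gamma> @ u = encode_form \<delta> @ v \<Longrightarrow> \<gamma> = \<delta> \<and> u = v"
proof (induction \<gamma> arbitrary: \<delta> u v)
  case (Atom p)
  then show ?case by (cases \<delta>) auto
next
  case (Neg \<gamma>)
  from Neg.prems obtain \<delta>' where \<delta>: "\<delta> = Neg \<delta>'"
    by (cases \<delta>) auto
  from Neg.prems have "encode_form \<gamma> @ u = encode_form \<delta>' @ v"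
    unfolding \<delta> by simp
  from Neg.IH[OF this] \<delta> show ?case by simp
next
  case (Conj \<gamma>1 \<gamma>2)
  from Conj.prems obtain \<delta>1 \<delta>2 where \<delta>: "\<delta> = Conj \<delta>1 \<delta>2"
    by (cases \<delta>) auto
  from Conj.prems have "encode_form \<gamma>1 @ (encode_form \<gamma>2 @ u) = encode_form \<delta>1 @ (encode_form \<delta>2 @ v)"
    unfolding \<delta> by simp
  then have 1: "\<gamma>1 = \<delta>1" and 2: "encode_form \<gamma>2 @ u = encode_form \<delta>2 @ v"
    using Conj.IH(1) by blast+
  from 1 Conj.IH(2)[OF 2] \<delta> show ?case by simp
next
  case (Disj \<gamma>1 \<gamma>2)
  from Disj.prems obtain \<delta>1 \<delta>2 where \<delta>: "\<delta> = Disj \<delta>1 \<delta>2"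
    by (cases \<delta>) auto
  from Disj.prems have "encode_form \<gamma>1 @ (encode_form \<gamma>2 @ u) = encode_form \<delta>1 @ (encode_form \<delta>2 @ v)"
    unfolding \<delta> by simp
  then have 1: "\<gamma>1 = \<delta>1" and 2: "encode_form \<gamma>2 @ u = encode_form \<delta>2 @ v"
    using Disj.IH(1) by blast+
  from 1 Disj.IH(2)[OF 2] \<delta> show ?case by simp
qed

lemma encode_form_neq:
  "x \<in> {LEps, LOr, LSand, LAnd, LC, LClose} \<Longrightarrow> encode_form \<gamma> @ u \<noteq> x # v"
  "x \<in> {LEps, LOr, LSand, LAnd, LC, LClose} \<Longrightarrow> x # v \<noteq> encode_form \<gamma> @ u"
  by (cases \<gamma>; auto)+

lemma encode_neq_LClose: "encode t @ u \<noteq> LClose # v" "LClose # v \<noteq> encode t @ u"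
  by (cases t; simp add: encode_form_neq)+

lemma encode_list_prefix_free:
  assumes "\<And>t t' u v. t \<in> set ts \<Longrightarrow> encode t @ u = encode t' @ v \<Longrightarrow> t = t' \<and> u = v"
  assumes "concat (map encode ts) @ LClose # u = concat (map encode ts') @ LClose # v"
  shows "ts = ts' \<and> u = v"
  using assms
proof (induction ts arbitrary: ts')
  case Nil
  then show ?case
    by (cases ts') (simp_all add: encode_neq_LClose)
next
  case (Cons t ts)
  show ?case
  proof (cases ts')
    case Nil
    then show ?thesis
      using Cons.prems(2) by (simp add: encode_neq_LClose)
  next
    case ts': (Cons t' ts'')
    have eq: "encode t @ (concat (map encode ts) @ LClose # u)
        = encode t' @ (concat (map encode ts'') @ LClose # v)"
      using Cons.prems(2) ts' by simp
    have hd: "t = t' \<and> concat (map encode ts) @ LClose # u = concat (map encode ts'') @ LClose # v"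
      using Cons.prems(1)[OF _ eq] by simp
    have "ts = ts'' \<and> u = v"
    proof (rule Cons.IH)
      show "s = s' \<and> x = y" if "s \<in> set ts" "encode s @ x = encode s' @ y" for s s' x y
        using Cons.prems(1)[OF _ that(2)] that(1) by simp
    qed (use hd in simp)
    with hd ts' show ?thesis by simp
  qed
qed

lemma encode_prefix_free: "encode t @ u = encode t' @ v \<Longrightarrow> t = t' \<and> u = v"
proof (induction t arbitrary: t' u v)
  case Eps
  then show ?case
    by (cases t') (simp_all add: encode_form_neq)
next
  case (Leaf \<gamma>)
  then show ?case
    using encode_form_prefix_free[of \<gamma> u _ v]
    by (cases t') (simp_all add: encode_form_neq)
next
  case (OR ts)
  from OR.prems obtain ts' where t': "t' = OR ts'"
    by (cases t') (simp_all add: encode_form_neq)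
  from OR.prems have "concat (map encode ts) @ LClose # u = concat (map encode ts') @ LClose # v"
    unfolding t' by simp
  with OR.IH have "ts = ts' \<and> u = v"
    by (rule encode_list_prefix_free)
  with t' show ?case by simp
next
  case (SAND ts)
  from SAND.prems obtain ts' where t': "t' = SAND ts'"
    by (cases t') (simp_all add: encode_form_neq)
  from SAND.prems have "concat (map encode ts) @ LClose # u = concat (map encode ts') @ LClose # v"
    unfolding t' by simp
  with SAND.IH have "ts = ts' \<and> u = v"
    by (rule encode_list_prefix_free)
  with t' show ?case by simp
next
  case (AND ts)
  from AND.prems obtain ts' where t': "t' = AND ts'"
    by (cases t') (simp_all add: encode_form_neq)
  from AND.prems have "concat (map encode ts) @ LClose # u = concat (map encode ts') @ LClose # v"
    unfolding t' by simp
  with AND.IH have "ts = ts' \<and> u = v"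
    by (rule encode_list_prefix_free)
  with t' show ?case by simp
next
  case (C t1 t2)
  from C.prems obtain s1 s2 where t': "t' = C s1 s2"
    by (cases t') (simp_all add: encode_form_neq)
  from C.prems have eq: "encode t1 @ (encode t2 @ u) = encode s1 @ (encode s2 @ v)"
    unfolding t' by simp
  from C.IH(1)[OF eq] have 1: "t1 = s1" and 2: "encode t2 @ u = encode s2 @ v" by simp_all
  from C.IH(2)[OF 2] 1 t' show ?case by simp
qed

lemma inj_encode: "inj encode"
  proof (rule injI)
  show "t = t'" if "encode t = encode t'" for t t' :: "'a tree"
    using encode_prefix_free[of t "[]" t' "[]"] that by simp
qed

text \<open>The size of a tree counts only its leaves. It agrees with the length of the encoding up to a
  constant factor, except on trees with unary nodes: arbitrarily many of these can be stacked on a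
  leaf without changing the size. Space is therefore measured in the length of the input word.\<close>

primrec form_size :: "'p form \<Rightarrow> nat" where
  "form_size (Atom p) = 1"
| "form_size (Neg \<gamma>) = form_size \<gamma> + 1"
| "form_size (Conj \<gamma> \<delta>) = form_size \<gamma> + form_size \<delta> + 1"
| "form_size (Disj \<gamma> \<delta>) = form_size \<gamma> + form_size \<delta> + 1"

primrec tree_size :: "'p tree \<Rightarrow> nat" where
  "tree_size Eps = 1"
| "tree_size (Leaf \<gamma>) = form_size \<gamma>"
| "tree_size (OR ts) = sum_list (map tree_size ts)"
| "tree_size (SAND ts) = sum_list (map tree_size ts)"
| "tree_size (AND ts) = sum_list (map tree_size ts)"
| "tree_size (C t t') = tree_size t + tree_size t'"

primrec branching :: "'p tree \<Rightarrow> bool" where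
  "branching Eps \<longleftrightarrow> True"
| "branching (Leaf \<gamma>) \<longleftrightarrow> True"
| "branching (OR ts) \<longleftrightarrow> 2 \<le> length ts \<and> list_all branching ts"
| "branching (SAND ts) \<longleftrightarrow> 2 \<le> length ts \<and> list_all branching ts"
| "branching (AND ts) \<longleftrightarrow> 2 \<le> length ts \<and> list_all branching ts"
| "branching (C t t') \<longleftrightarrow> branching t \<and> branching t'"

lemma length_encode_form: "length (encode_form \<gamma>) = form_size \<gamma>"
  by (induction \<gamma>) auto

lemma tree_size_le_length_encode: "tree_size \<theta> \<le> length (encode \<theta>)"
proof -
  have list: "sum_list (map tree_size ts) \<le> length (concat (map encode ts))"
    if "\<And>t. t \<in> set ts \<Longrightarrow> tree_size t \<le> length (encode t)" for ts :: "'a tree list"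
    using that by (induction ts) (auto intro: add_mono)
  show ?thesis
  proof (induction \<theta>)
    case (OR ts)
    then show ?case using list[of ts] by simp
  next
    case (SAND ts)
    then show ?case using list[of ts] by simp
  next
    case (AND ts)
    then show ?case using list[of ts] by simp
  qed (simp_all add: length_encode_form)
qed

lemma length_encode_le_tree_size:
  "branching \<theta> \<Longrightarrow> length (encode \<theta>) + 2 \<le> 3 * tree_size \<theta>"
proof -
  have list: "length (concat (map encode ts)) + 4 \<le> 3 * sum_list (map tree_size ts)"
    if "\<And>t. t \<in> set ts \<Longrightarrow> branching t \<Longrightarrow> length (encode t) + 2 \<le> 3 * tree_size t"
      "2 \<le> length ts" "list_all branching ts" for ts :: "'a tree list"
  proof -
    have "length (concat (map encode ts)) + 2 * length ts \<le> 3 * sum_list (map tree_size ts)"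
      using that(1,3)
    proof (induction ts)
      case (Cons t ts)
      then have "length (encode t) + 2 \<le> 3 * tree_size t" by simp
      moreover have "length (concat (map encode ts)) + 2 * length ts \<le> 3 * sum_list (map tree_size ts)"
        using Cons by simp
      ultimately show ?case by simp
    qed simp
    with that(2) show ?thesis by linarith
  qed
  have form: "0 < form_size \<gamma>" for \<gamma> :: "'a form"
    by (cases \<gamma>) auto
  show "branching \<theta> \<Longrightarrow> length (encode \<theta>) + 2 \<le> 3 * tree_size \<theta>"
  proof (induction \<theta>)
    case (Leaf \<gamma>)
    then show ?case using form[of \<gamma>] by (simp add: length_encode_form)
  next
    case (OR ts)
    then show ?case using list[of ts] by simp
  next
    case (SAND ts)
    then show ?case using list[of ts] by simp
  next
    case (AND ts)
    then show ?case using list[of ts] by simp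
  qed auto
qed


section \<open>Turing machines and space complexity\<close>

text \<open>Deterministic Turing machines with finitely many two-way infinite tapes. The input alphabet is
  a type; a machine may use finitely many auxiliary tape symbols in addition.\<close>

datatype 'a symbol = Blank | Input 'a | Aux nat

datatype move = MoveLeft | Stay | MoveRight

record 'a tm =
  tapes :: nat
  states :: "nat set"
  symbols :: "'a symbol set"
  start :: nat
  accept :: nat
  reject :: nat
  trans :: "nat \<Rightarrow> 'a symbol list \<Rightarrow> nat \<times> ('a symbol \<times> move) list"

definition turing_machine :: "'a tm \<Rightarrow> bool" where
  "turing_machine M \<longleftrightarrow>
     1 \<le> tapes M \<and>
     finite (states M) \<and> {start M, accept M, reject M} \<subseteq> states M \<and> accept M \<noteq> reject M \<and>
     finite (symbols M) \<and> insert Blank (range Input) \<subseteq> symbols M \<and>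
     (\<forall>q \<in> states M - {accept M, reject M}. \<forall>ss. length ss = tapes M \<and> set ss \<subseteq> symbols M \<longrightarrow>
        (let (q', as) = trans M q ss in
           q' \<in> states M \<and> length as = tapes M \<and> fst ` set as \<subseteq> symbols M))"

type_synonym 'a tape = "(int \<Rightarrow> 'a symbol) \<times> int"

text \<open>A tape consists of its contents and the position of the head.\<close>

type_synonym 'a config = "nat \<times> 'a tape list"

definition read :: "'a tape \<Rightarrow> 'a symbol" where
  "read tp = fst tp (snd tp)"

primrec offset :: "move \<Rightarrow> int" where
  "offset MoveLeft = - 1"
| "offset Stay = 0"
| "offset MoveRight = 1"

definition act :: "'a tape \<Rightarrow> 'a symbol \<times> move \<Rightarrow> 'a tape" where
  "act tp a = ((fst tp)(snd tp := fst a), snd tp + offset (snd a))"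

definition step :: "'a tm \<Rightarrow> 'a config \<Rightarrow> 'a config" where
  "step M c =
     (if fst c \<in> {accept M, reject M} then c
      else let (q, as) = trans M (fst c) (map read (snd c)) in (q, map2 act (snd c) as))"

definition input_tape :: "'a list \<Rightarrow> 'a tape" where
  "input_tape w =
     ((\<lambda>p. if 0 \<le> p \<and> p < int (length w) then Input (w ! nat p) else Blank), 0)"

definition initial :: "'a tm \<Rightarrow> 'a list \<Rightarrow> 'a config" where
  "initial M w = (start M, input_tape w # replicate (tapes M - 1) (\<lambda>_. Blank, 0))"

definition run :: "'a tm \<Rightarrow> 'a list \<Rightarrow> nat \<Rightarrow> 'a config" where
  "run M w t = (step M ^^ t) (initial M w)"

text \<open>The cells, over all tapes including the input tape, that are ever scanned.\<close>

definition visited :: "'a tm \<Rightarrow> 'a list \<Rightarrow> (nat \<times> int) set" where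
  "visited M w = {(i, snd (snd (run M w t) ! i)) |i t. i < tapes M}"

definition decides_in_space :: "'a tm \<Rightarrow> 'a list set \<Rightarrow> (nat \<Rightarrow> nat) \<Rightarrow> bool" where
  "decides_in_space M L s \<longleftrightarrow>
     (\<forall>w. (\<exists>t. fst (run M w t) = (if w \<in> L then accept M else reject M)) \<and>
          finite (visited M w) \<and> card (visited M w) \<le> s (length w))"

definition iterated_exp :: "nat \<Rightarrow> nat \<Rightarrow> nat" where
  "iterated_exp m x = ((\<lambda>y. 2 ^ y) ^^ m) x"

definition EXPSPACE :: "nat \<Rightarrow> 'a::finite list set set" where
  "EXPSPACE m = {L. \<exists>M (p :: nat poly). turing_machine M \<and>
     decides_in_space M L (\<lambda>n. iterated_exp m (poly p n))}"

end

(* A tree of countermeasure-depth k and encoding length n denotes a language recognised by a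
   nondeterministic automaton with at most N = iterated_exp (k+1) (4n) states: products and sums of
   the operators cost one exponential in n, and every complement one more. Hence a nonempty language
   contains a word shorter than N, and it suffices to search all short words. That a given word w
   works is witnessed by tables indexed by positions of the input and of w: which segments of the
   input encode a tree, and which factors of w belong to its semantics. These tables are the unique
   solution of recursion equations running from right to left over the input. So membership in the
   problem is an existential second-order statement over the indices below some S of the order of N,
   and such a statement is evaluated by a deterministic machine that enumerates all tables of S^3
   cells. The values S = 1, 2, ... are tried in turn; a second statement of the same kind defines
   exponentiation on the indices and recognises S = N + 1, which is when the machine may reject. *)

theory Submission
  imports Defs
begin

section \<open>Short words in languages of attack-defense trees\<close>

text \<open>Space is measured on an explicit machine, so the obstacle is to obtain one without
  programming the problem by hand. The detour through logic serves this purpose: for each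
  \<open>k\<close> the problem is stated by fixed formulas, and only formulas are compiled. A fixed
  formula needs a fixed number of registers, hence of tapes, and the truth values of all its
  relations at a triple of indices fit into one cell, over an alphabet that depends on
  \<open>k\<close> and the propositions alone. The cube S^3 is affordable because, from one
  exponential on, polynomial factors can be moved into the argument. As \<open>N\<close> is
  recognised by a formula and never computed, no constructibility of the space bound enters. The
  countermeasure-depth counts just the exponentials stacked on the first one, since a difference
  complements only its right argument, whose depth is smaller by one. The factor 4 in
  \<open>4n\<close> pays for the states that the operators add to those of their children.\<close>

definition lquot :: "'a \<Rightarrow> 'a list set \<Rightarrow> 'a list set" where
  "lquot a L = {w. a # w \<in> L}"

text \<open>The empty union is allowed, so that a missing transition costs no state.\<close>

definition covered :: "'a list set set \<Rightarrow> 'a list set \<Rightarrow> bool" where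
  "covered F L \<longleftrightarrow> (\<exists>G \<subseteq> F. L = \<Union> G)"

definition quot_closed :: "'a list set set \<Rightarrow> bool" where
  "quot_closed F \<longleftrightarrow> (\<forall>A \<in> F. \<forall>a. covered F (lquot a A))"

text \<open>The members of \<open>F\<close> play the role of the languages accepted from the states of a
  nondeterministic automaton for \<open>L\<close>.\<close>

definition nfa_bound :: "'a list set \<Rightarrow> nat \<Rightarrow> bool" where
  "nfa_bound L n \<longleftrightarrow> (\<exists>F. finite F \<and> card F \<le> n \<and> quot_closed F \<and> covered F L)"

lemma nfa_boundI: "finite F \<Longrightarrow> card F \<le> n \<Longrightarrow> quot_closed F \<Longrightarrow> covered F L \<Longrightarrow> nfa_bound L n"
  unfolding nfa_bound_def by blast

lemma nfa_boundE:
  assumes "nfa_bound L n"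
  obtains F where "finite F" "card F \<le> n" "quot_closed F" "covered F L"
  using assms unfolding nfa_bound_def by blast

lemma nfa_bound_mono: "nfa_bound L m \<Longrightarrow> m \<le> n \<Longrightarrow> nfa_bound L n"
  unfolding nfa_bound_def using le_trans by blast

lemma covered_empty: "covered F {}"
  unfolding covered_def by (rule exI[of _ "{}"]) simp

lemma covered_member: "A \<in> F \<Longrightarrow> covered F A"
  unfolding covered_def by (rule exI[of _ "{A}"]) simp

lemma covered_mono: "covered F A \<Longrightarrow> F \<subseteq> F' \<Longrightarrow> covered F' A"
  unfolding covered_def by blast

lemma covered_Union:
  assumes "\<And>A. A \<in> X \<Longrightarrow> covered F A"
  shows "covered F (\<Union> X)"
proof -
  have "\<exists>B \<in> F. w \<in> B \<and> B \<subseteq> \<Union> X" if "A \<in> X" "w \<in> A" for A w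
    using assms[OF that(1)] that unfolding covered_def by blast
  then have "\<Union> X = \<Union> {B \<in> F. B \<subseteq> \<Union> X}"
    by blast
  moreover have "{B \<in> F. B \<subseteq> \<Union> X} \<subseteq> F"
    by blast
  ultimately show ?thesis
    unfolding covered_def by metis
qed

lemma covered_Un: "covered F A \<Longrightarrow> covered F B \<Longrightarrow> covered F (A \<union> B)"
  using covered_Union[of "{A, B}" F] by auto

text \<open>Coverage passes through every operation that distributes over unions. It is applied to
  left quotients, to concatenation with a fixed right factor and to intersection with a fixed
  language, so that these need to be examined on members of \<open>F\<close> only.\<close>

lemma covered_image_Union:
  assumes "covered F A" "\<And>G. G \<subseteq> F \<Longrightarrow> h (\<Union> G) = \<Union> (h ` G)" "\<And>B. B \<in> F \<Longrightarrow> covered F' (h B)"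
  shows "covered F' (h A)"
proof -
  obtain G where G: "G \<subseteq> F" "A = \<Union> G"
    using assms(1) unfolding covered_def by blast
  have "covered F' (\<Union> (h ` G))"
    by (rule covered_Union) (use assms(3) G(1) in blast)
  then show ?thesis
    using assms(2)[OF G(1)] G(2) by simp
qed

lemma lquot_Union: "lquot a (\<Union> G) = \<Union> (lquot a ` G)"
  unfolding lquot_def by blast

lemma covered_lquot: "quot_closed F \<Longrightarrow> covered F A \<Longrightarrow> covered F (lquot a A)"
  by (rule covered_image_Union[of F A "lquot a"]) (simp_all add: lquot_Union quot_closed_def)

section \<open>Closure of the state bound under the language operations\<close>

lemma nfa_bound_empty: "nfa_bound {} 0"
  by (rule nfa_boundI[of "{}"]) (simp_all add: quot_closed_def covered_empty)

lemma nfa_bound_Nil: "nfa_bound {[]} 1"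
proof (rule nfa_boundI[of "{{[]}}"])
  have "lquot a {[]} = {}" for a :: 'a
    unfolding lquot_def by simp
  then show "quot_closed {{[] :: 'a list}}"
    unfolding quot_closed_def by (simp add: covered_empty)
qed (simp_all add: covered_member)

lemma nfa_bound_UNIV: "nfa_bound UNIV 1"
proof (rule nfa_boundI[of "{UNIV}"])
  have "lquot a UNIV = UNIV" for a :: 'a
    unfolding lquot_def by simp
  then show "quot_closed {UNIV :: 'a list set}"
    unfolding quot_closed_def by (simp add: covered_member)
qed (simp_all add: covered_member)

text \<open>The automaton guesses which letter is the last; the second state is the accepting one,
  with language {[]}.\<close>

lemma nfa_bound_last: "nfa_bound {w. w \<noteq> [] \<and> P (last w)} 2"
proof (rule nfa_boundI)
  let ?L = "{w. w \<noteq> [] \<and> P (last w)}"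
  let ?F = "{?L, {[]}}"
  show "finite ?F" "covered ?F ?L"
    by (simp_all add: covered_member)
  show "card ?F \<le> 2"
    by (simp add: card_insert_if)
  have 1: "lquot a {[]} = {}" for a :: 'a
    unfolding lquot_def by simp
  have 2: "lquot a ?L = ?L \<union> (if P a then {[]} else {})" for a
    unfolding lquot_def by auto
  show "quot_closed ?F"
    unfolding quot_closed_def
    by (simp add: 1 2 covered_empty covered_Un covered_member)
qed

lemma nfa_bound_Un:
  assumes "nfa_bound A m" "nfa_bound B n"
  shows "nfa_bound (A \<union> B) (m + n)"
proof -
  obtain F where F: "finite F" "card F \<le> m" "quot_closed F" "covered F A"
    using assms(1) by (rule nfa_boundE)
  obtain F' where F': "finite F'" "card F' \<le> n" "quot_closed F'" "covered F' B"
    using assms(2) by (rule nfa_boundE)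
  show ?thesis
  proof (rule nfa_boundI[of "F \<union> F'"])
    show "card (F \<union> F') \<le> m + n"
      using card_Un_le[of F F'] F(2) F'(2) by linarith
    show "quot_closed (F \<union> F')"
      using F(3) F'(3) covered_mono[of F _ "F \<union> F'"] covered_mono[of F' _ "F \<union> F'"]
      unfolding quot_closed_def by blast
    show "covered (F \<union> F') (A \<union> B)"
      using F(4) F'(4) by (intro covered_Un) (auto intro: covered_mono)
  qed (use F F' in simp)
qed

text \<open>Brzozowski's product rule; the second summand is the passage from \<open>A\<close> to
  \<open>B\<close> when \<open>A\<close> accepts the empty word.\<close>

lemma lquot_conc:
  "lquot a (A \<cdot> B) = (lquot a A) \<cdot> B \<union> (if [] \<in> A then lquot a B else {})"
proof (rule set_eqI)
  fix w
  have "w \<in> lquot a (A \<cdot> B) \<longleftrightarrow> (\<exists>u v. a # w = u @ v \<and> u \<in> A \<and> v \<in> B)"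
    unfolding lquot_def conc_def by simp
  also have "\<dots> \<longleftrightarrow> [] \<in> A \<and> a # w \<in> B \<or> (\<exists>u v. w = u @ v \<and> a # u \<in> A \<and> v \<in> B)"
    unfolding Cons_eq_append_conv by blast
  also have "\<dots> \<longleftrightarrow> w \<in> (lquot a A) \<cdot> B \<union> (if [] \<in> A then lquot a B else {})"
    unfolding lquot_def conc_def by auto
  finally show "w \<in> lquot a (A \<cdot> B) \<longleftrightarrow> w \<in> (lquot a A) \<cdot> B \<union> (if [] \<in> A then lquot a B else {})" .
qed

text \<open>Every state of the first automaton is read as followed by \<open>B\<close>, and the
  states of the second are kept. The count is additive and involves no product.\<close>

lemma nfa_bound_conc:
  assumes "nfa_bound A m" "nfa_bound B n"
  shows "nfa_bound (A \<cdot> B) (m + n)"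
proof -
  obtain F where F: "finite F" "card F \<le> m" "quot_closed F" "covered F A"
    using assms(1) by (rule nfa_boundE)
  obtain F' where F': "finite F'" "card F' \<le> n" "quot_closed F'" "covered F' B"
    using assms(2) by (rule nfa_boundE)
  let ?E = "(\<lambda>X. X \<cdot> B) ` F \<union> F'"
  have conc: "covered ?E (X \<cdot> B)" if "covered F X" for X
    by (rule covered_image_Union[of F X "\<lambda>X. X \<cdot> B"])
      (use that in \<open>auto simp: conc_def intro: covered_member\<close>)
  have right: "covered ?E X" if "covered F' X" for X
    using that by (rule covered_mono) simp
  show ?thesis
  proof (rule nfa_boundI[of ?E])
    show "card ?E \<le> m + n"
      using card_Un_le[of "(\<lambda>X. X \<cdot> B) ` F" F'] card_image_le[OF F(1), of "\<lambda>X. X \<cdot> B"] F(2) F'(2)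
      by linarith
    show "quot_closed ?E"
      unfolding quot_closed_def
    proof (intro ballI allI)
      fix X a
      assume "X \<in> ?E"
      then consider Y where "Y \<in> F" "X = Y \<cdot> B" | "X \<in> F'"
        by blast
      then show "covered ?E (lquot a X)"
      proof cases
        case 1
        have "covered ?E (lquot a Y \<cdot> B)"
          using 1(1) F(3) by (intro conc) (simp add: quot_closed_def)
        moreover have "covered ?E (lquot a B)"
          using covered_lquot[OF F'(3,4)] by (rule right)
        ultimately show ?thesis
          unfolding 1(2) lquot_conc by (simp add: covered_Un)
      next
        case 2
        then show ?thesis
          using F'(3) by (intro right) (simp add: quot_closed_def)
      qed
    qed
    show "covered ?E (A \<cdot> B)"
      by (rule conc[OF F(4)])
  qed (use F F' in simp)
qed

lemma nfa_bound_Int: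
  assumes "nfa_bound A m" "nfa_bound B n"
  shows "nfa_bound (A \<inter> B) (m * n)"
proof -
  obtain F where F: "finite F" "card F \<le> m" "quot_closed F" "covered F A"
    using assms(1) by (rule nfa_boundE)
  obtain F' where F': "finite F'" "card F' \<le> n" "quot_closed F'" "covered F' B"
    using assms(2) by (rule nfa_boundE)
  let ?E = "(\<lambda>(X, Y). X \<inter> Y) ` (F \<times> F')"
  have inter: "covered ?E (X \<inter> Y)" if "covered F X" "covered F' Y" for X Y
  proof (rule covered_image_Union[of F X "\<lambda>X. X \<inter> Y"])
    show "covered ?E (X \<inter> Y)" if "X \<in> F" for X
      by (rule covered_image_Union[of F' Y "\<lambda>Y. X \<inter> Y"])
        (use \<open>covered F' Y\<close> \<open>X \<in> F\<close> in \<open>auto intro!: covered_member\<close>)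
  qed (use that in auto)
  show ?thesis
  proof (rule nfa_boundI[of ?E])
    have "card ?E \<le> card F * card F'"
      using card_image_le[of "F \<times> F'" "\<lambda>(X, Y). X \<inter> Y"] F(1) F'(1) by (simp add: card_cartesian_product)
    also have "\<dots> \<le> m * n"
      using F(2) F'(2) by (rule mult_le_mono)
    finally show "card ?E \<le> m * n" .
    have "lquot a (X \<inter> Y) = lquot a X \<inter> lquot a Y" for a :: 'a and X Y
      unfolding lquot_def by blast
    then show "quot_closed ?E"
      using F(3) F'(3) unfolding quot_closed_def by (auto intro!: inter simp del: image_eqI)
    show "covered ?E (A \<inter> B)"
      by (rule inter[OF F(4) F'(4)])
  qed (use F F' in simp)
qed

text \<open>Subset construction: the new states are complements of unions of old ones, and left
  quotients commute with complements.\<close>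

lemma nfa_bound_Compl:
  assumes "nfa_bound A n"
  shows "nfa_bound (- A) (2 ^ n)"
proof -
  obtain F where F: "finite F" "card F \<le> n" "quot_closed F" "covered F A"
    using assms(1) by (rule nfa_boundE)
  let ?E = "(\<lambda>G. - \<Union> G) ` Pow F"
  have compl: "covered ?E (- X)" if "covered F X" for X
    using that unfolding covered_def[of F] by (auto intro: covered_member)
  show ?thesis
  proof (rule nfa_boundI[of ?E])
    have "card ?E \<le> 2 ^ card F"
      using card_image_le[of "Pow F" "\<lambda>G. - \<Union> G"] F(1) by (simp add: card_Pow)
    also have "(2 :: nat) ^ card F \<le> 2 ^ n"
      using F(2) by simp
    finally show "card ?E \<le> 2 ^ n" .
    have lquot: "lquot a (- X) = - lquot a X" for a :: 'a and X
      unfolding lquot_def by blast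
    have "covered ?E (lquot a (- \<Union> G))" if "G \<subseteq> F" for a G
      unfolding lquot by (intro compl covered_lquot F(3)) (use that in \<open>auto simp: covered_def\<close>)
    then show "quot_closed ?E"
      unfolding quot_closed_def by blast
    show "covered ?E (- A)"
      by (rule compl[OF F(4)])
  qed (use F in simp)
qed

lemma nfa_bound_Diff: "nfa_bound A m \<Longrightarrow> nfa_bound B n \<Longrightarrow> nfa_bound (A - B) (m * 2 ^ n)"
  unfolding Diff_eq by (intro nfa_bound_Int nfa_bound_Compl)

text \<open>Along a shortest word, the members of the family met after each letter have shortest words of
  pairwise different lengths.\<close>

lemma nfa_bound_short:
  assumes "nfa_bound L n" "L \<noteq> {}"
  shows "\<exists>w \<in> L. length w < n"
proof -
  obtain F where F: "finite F" "card F \<le> n" "quot_closed F" "covered F L"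
    using assms(1) by (rule nfa_boundE)
  define l where "l A = (LEAST i. \<exists>w \<in> A. length w = i)" for A :: "'a list set"
  have attained: "\<exists>w \<in> A. length w = l A" if "A \<noteq> {}" for A
    unfolding l_def by (rule LeastI_ex) (use that in auto)
  have minimal: "l A \<le> length w" if "w \<in> A" for A w
    unfolding l_def by (rule Least_le) (use that in auto)
  have "{..i} \<subseteq> l ` F" if "A \<in> F" "A \<noteq> {}" "l A = i" for A i
    using that
  proof (induction i arbitrary: A)
    case 0
    then show ?case by force
  next
    case (Suc i)
    obtain w where w: "w \<in> A" "length w = Suc i"
      using attained Suc.prems by metis
    then obtain a v where v: "w = a # v" "length v = i"
      by (cases w) auto
    have "covered F (lquot a A)"
      using F(3) Suc.prems(1) by (simp add: quot_closed_def)
    then obtain B where B: "B \<in> F" "v \<in> B" "B \<subseteq> lquot a A"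
      using w(1) v(1) unfolding covered_def lquot_def by blast
    have "l B = i"
    proof (rule antisym)
      show "l B \<le> i"
        using minimal[OF B(2)] v(2) by simp
      obtain v' where v': "v' \<in> B" "length v' = l B"
        using attained[of B] B(2) by blast
      then have "Suc i \<le> length (a # v')"
        using B(3) minimal[of "a # v'" A] Suc.prems(3) by (auto simp: lquot_def)
      then show "i \<le> l B"
        using v'(2) by simp
    qed
    then have "{..i} \<subseteq> l ` F"
      using Suc.IH[of B] B by blast
    moreover have "Suc i \<in> l ` F"
      using Suc.prems by force
    ultimately show ?case
      by (simp add: atMost_Suc)
  qed
  note range = this
  obtain A where A: "A \<in> F" "A \<noteq> {}" "A \<subseteq> L"
    using F(4) assms(2) unfolding covered_def by blast
  have "card {..l A} \<le> card (l ` F)"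
    using range[OF A(1,2) refl] F(1) by (intro card_mono) auto
  also have "\<dots> \<le> n"
    using card_image_le[OF F(1)] F(2) le_trans by blast
  finally have "l A < n" by simp
  then show ?thesis
    using attained[OF A(2)] A(3) by force
qed

section \<open>Growth of iterated exponentials\<close>

lemma iterated_exp_Suc [simp]: "iterated_exp (Suc m) x = 2 ^ iterated_exp m x"
  by (simp add: iterated_exp_def)

lemma iterated_exp_0 [simp]: "iterated_exp 0 x = x"
  by (simp add: iterated_exp_def)

lemma iterated_exp_mono: "x \<le> y \<Longrightarrow> iterated_exp m x \<le> iterated_exp m y"
  by (induction m) simp_all

lemma le_iterated_exp: "x \<le> iterated_exp m x"
proof (induction m)
  case (Suc m)
  then show ?case
    using less_exp[of "iterated_exp m x"] unfolding iterated_exp_Suc by linarith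
qed simp

lemma iterated_exp_Suc_pos: "1 \<le> iterated_exp (Suc m) x"
  by simp

text \<open>The induction rests on 2^a + 2^b \<le> 2^(a + b), which fails when an exponent is 0;
  hence the positive arguments.\<close>

lemma iterated_exp_add:
  "1 \<le> x \<Longrightarrow> 1 \<le> y \<Longrightarrow> iterated_exp m x + iterated_exp m y \<le> iterated_exp m (x + y)"
proof (induction m)
  case (Suc m)
  have "(2 :: nat) ^ a + 2 ^ b \<le> 2 ^ (a + b)" if "1 \<le> a" "1 \<le> b" for a b
  proof -
    have "(2 :: nat) \<le> 2 ^ a" "(2 :: nat) \<le> 2 ^ b"
      using that power_increasing[of 1 a "2 :: nat"] power_increasing[of 1 b "2 :: nat"] by simp_all
    then obtain i j where "(2 :: nat) ^ a = 2 + i" "(2 :: nat) ^ b = 2 + j"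
      using le_Suc_ex by metis
    then show ?thesis
      unfolding power_add by (simp add: algebra_simps)
  qed
  moreover have "1 \<le> iterated_exp m x" "1 \<le> iterated_exp m y"
    using Suc.prems le_iterated_exp le_trans by blast+
  ultimately have "iterated_exp (Suc m) x + iterated_exp (Suc m) y \<le> 2 ^ (iterated_exp m x + iterated_exp m y)"
    by simp
  also have "\<dots> \<le> iterated_exp (Suc m) (x + y)"
    using Suc by simp
  finally show ?case .
qed simp

lemma iterated_exp_mult:
  assumes "1 \<le> x" "1 \<le> y"
  shows "iterated_exp (Suc m) x * iterated_exp (Suc m) y \<le> iterated_exp (Suc m) (x + y)"
  using iterated_exp_add[OF assms, of m] by (simp flip: power_add)

lemma iterated_exp_plus1: "iterated_exp (Suc m) x + 1 \<le> iterated_exp (Suc m) (x + 1)"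
proof -
  have "iterated_exp m x < iterated_exp m (Suc x)" for m
    by (induction m) simp_all
  from this[of "Suc m"] show ?thesis
    unfolding Suc_eq_plus1 by linarith
qed

text \<open>The 1 on the right keeps the argument positive for the empty list, as superadditivity
  demands; the 1 on the left is the final state of a \<open>SAND\<close>.\<close>

lemma iterated_exp_sum_list:
  "\<forall>x \<in> set xs. 1 \<le> x \<Longrightarrow> (\<Sum>x\<leftarrow>xs. iterated_exp (Suc m) x) + 1 \<le> iterated_exp (Suc m) (sum_list xs + 1)"
proof (induction xs)
  case (Cons x xs)
  then have "(\<Sum>x\<leftarrow>x # xs. iterated_exp (Suc m) x) + 1
      \<le> iterated_exp (Suc m) x + iterated_exp (Suc m) (sum_list xs + 1)"
    by simp
  also have "\<dots> \<le> iterated_exp (Suc m) (x + (sum_list xs + 1))"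
    using Cons.prems by (intro iterated_exp_add) simp_all
  finally show ?case by (simp add: add.assoc)
qed simp

lemma iterated_exp_prod_list:
  "(\<Prod>x\<leftarrow>xs. iterated_exp (Suc m) x + 1) \<le> iterated_exp (Suc m) (\<Sum>x\<leftarrow>xs. x + 1)"
proof (induction xs)
  case (Cons x xs)
  show ?case
  \<comment> \<open>For the empty list the sum in the argument is 0, where
    \<open>iterated_exp_mult\<close> does not apply.\<close>
  proof (cases "xs = []")
    case True
    then show ?thesis using iterated_exp_plus1[of m x] by simp
  next
    case False
    have "(\<Prod>x\<leftarrow>x # xs. iterated_exp (Suc m) x + 1)
      \<le> iterated_exp (Suc m) (x + 1) * iterated_exp (Suc m) (\<Sum>x\<leftarrow>xs. x + 1)"
      using mult_le_mono[OF iterated_exp_plus1 Cons] by simp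
    also have "\<dots> \<le> iterated_exp (Suc m) (x + 1 + (\<Sum>x\<leftarrow>xs. x + 1))"
      using False by (intro iterated_exp_mult) (simp, cases xs, simp_all)
    finally show ?thesis by simp
  qed
qed simp

section \<open>State bounds for attack-defense trees\<close>

lemma sem_AND:
  "sem (AND ts) = (\<Union>t \<in> set ts. sem t) \<inter> (\<Inter>t \<in> set ts. sem t \<cdot> UNIV)"
proof -
  \<comment> \<open>By this inclusion the restriction to the indices other than i may be dropped,
    and the intersection no longer depends on i.\<close>
  have "L \<subseteq> L \<cdot> UNIV" for L :: "'a set list set"
    unfolding conc_def by force
  then have *: "(\<Union>i<n. f i \<inter> (\<Inter>j \<in> {..<n} - {i}. f j \<cdot> UNIV)) = (\<Union>i<n. f i) \<inter> (\<Inter>j<n. f j \<cdot> UNIV)"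
    for n :: nat and f :: "nat \<Rightarrow> 'a set list set"
    by blast
  have "(\<Union>i<length ts. sem (ts ! i)) = (\<Union>t \<in> set ts. sem t)"
      "(\<Inter>i<length ts. sem (ts ! i) \<cdot> UNIV) = (\<Inter>t \<in> set ts. sem t \<cdot> UNIV)"
    by (auto simp: set_conv_nth)
  with *[where n = "length ts" and f = "\<lambda>i. sem (ts ! i)"] show ?thesis
    by (simp add: Let_def cong: SUP_cong_simp INF_cong_simp)
qed

text \<open>The two bounds are proved together: a trace of \<open>AND (t # ts)\<close> either lies
  in \<open>sem t\<close> and has a prefix in every other child, or has a prefix in \<open>t\<close>
  and lies in \<open>sem (AND ts)\<close>. The 1 in each factor is the state \<open>UNIV\<close>
  entered after a finished child.\<close>

lemma nfa_bound_sem_AND: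
  assumes "\<And>t. t \<in> set ts \<Longrightarrow> nfa_bound (sem t) (f t)"
  shows "nfa_bound (\<Inter>t \<in> set ts. sem t \<cdot> UNIV) (\<Prod>t\<leftarrow>ts. f t + 1)"
    "nfa_bound (sem (AND ts)) (length ts * (\<Prod>t\<leftarrow>ts. f t + 1))"
proof -
  have "nfa_bound (\<Inter>t \<in> set ts. sem t \<cdot> UNIV) (\<Prod>t\<leftarrow>ts. f t + 1) \<and>
      nfa_bound (sem (AND ts)) (length ts * (\<Prod>t\<leftarrow>ts. f t + 1))"
    using assms
  proof (induction ts)
    case Nil
    have "sem (AND ([] :: 'a tree list)) = {}" by simp
    then show ?case using nfa_bound_empty nfa_bound_UNIV by (simp del: sem.simps)
  next
    case (Cons t ts)
    have t: "nfa_bound (sem t) (f t)"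
      using Cons.prems by simp
    then have tU: "nfa_bound (sem t \<cdot> UNIV) (f t + 1)"
      by (intro nfa_bound_conc nfa_bound_UNIV)
    have IH: "nfa_bound (\<Inter>t \<in> set ts. sem t \<cdot> UNIV) (\<Prod>t\<leftarrow>ts. f t + 1)"
        "nfa_bound (sem (AND ts)) (length ts * (\<Prod>t\<leftarrow>ts. f t + 1))"
      using Cons.IH Cons.prems by (metis list.set_intros(2))+
    have "sem t \<subseteq> sem t \<cdot> UNIV"
      unfolding conc_def by force
    then have "sem (AND (t # ts)) = (sem t \<inter> (\<Inter>t \<in> set ts. sem t \<cdot> UNIV)) \<union> (sem t \<cdot> UNIV \<inter> sem (AND ts))"
      unfolding sem_AND by auto
    moreover have "nfa_bound (sem t \<inter> (\<Inter>t \<in> set ts. sem t \<cdot> UNIV) \<union> (sem t \<cdot> UNIV \<inter> sem (AND ts))) (f t * (\<Prod>t\<leftarrow>ts. f t + 1) + (f t + 1) * (length ts * (\<Prod>t\<leftarrow>ts. f t + 1)))"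
      by (intro nfa_bound_Un nfa_bound_Int t tU IH)
    ultimately have "nfa_bound (sem (AND (t # ts))) (f t * (\<Prod>t\<leftarrow>ts. f t + 1) + (f t + 1) * (length ts * (\<Prod>t\<leftarrow>ts. f t + 1)))"
      by (simp only:)
    then have "nfa_bound (sem (AND (t # ts))) (length (t # ts) * (\<Prod>t\<leftarrow>t # ts. f t + 1))"
      by (rule nfa_bound_mono) (simp add: algebra_simps)
    moreover have "nfa_bound (\<Inter>t \<in> set (t # ts). sem t \<cdot> UNIV) (\<Prod>t\<leftarrow>t # ts. f t + 1)"
      using nfa_bound_Int[OF tU IH(1)] by simp
    ultimately show ?case by blast
  qed
  then show "nfa_bound (\<Inter>t \<in> set ts. sem t \<cdot> UNIV) (\<Prod>t\<leftarrow>ts. f t + 1)"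
    "nfa_bound (sem (AND ts)) (length ts * (\<Prod>t\<leftarrow>ts. f t + 1))"
    by blast+
qed

lemma nfa_bound_sem_OR:
  "(\<And>t. t \<in> set ts \<Longrightarrow> nfa_bound (sem t) (f t)) \<Longrightarrow> nfa_bound (sem (OR ts)) (\<Sum>t\<leftarrow>ts. f t)"
  by (induction ts) (simp_all add: nfa_bound_empty nfa_bound_Un)

lemma nfa_bound_sem_SAND:
  "(\<And>t. t \<in> set ts \<Longrightarrow> nfa_bound (sem t) (f t)) \<Longrightarrow> nfa_bound (sem (SAND ts)) ((\<Sum>t\<leftarrow>ts. f t) + 1)"
proof (induction ts)
  case (Cons t ts)
  then show ?case
    using nfa_bound_conc[of "sem t" "f t" "sem (SAND ts)" "(\<Sum>t\<leftarrow>ts. f t) + 1"] by (simp add: add.assoc)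
qed (simp add: nfa_bound_Nil[simplified])

lemma length_encode_pos: "1 \<le> length (encode t)"
proof -
  have "1 \<le> length (encode_form \<gamma>)" for \<gamma> :: "'a form"
    by (cases \<gamma>) simp_all
  then show ?thesis
    by (cases t) simp_all
qed

text \<open>Trees in \<open>ADT\<close> have nonempty argument lists, so the maximum in
  \<open>cd\<close> can be compared argument by argument.\<close>

lemma cd_le_iff: "t \<in> ADT \<Longrightarrow> cd t \<le> c \<longleftrightarrow> (case t of
    OR ts \<Rightarrow> (\<forall>t \<in> set ts. cd t \<le> c) | SAND ts \<Rightarrow> (\<forall>t \<in> set ts. cd t \<le> c)
  | AND ts \<Rightarrow> (\<forall>t \<in> set ts. cd t \<le> c) | C t1 t2 \<Rightarrow> cd t1 \<le> c \<and> Suc (cd t2) \<le> c | _ \<Rightarrow> True)"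
  by (cases rule: ADT.cases) auto

text \<open>The subtracted 2 reserves two units per child: in \<open>AND\<close> one pays for the
  state added by each prefix closure and one for the factor \<open>length ts\<close>. Products
  become sums of arguments only above an exponential, whence the height \<open>Suc c\<close> already
  at depth 0.\<close>

lemma nfa_bound_sem:
  assumes "t \<in> ADT" "cd t \<le> c"
  shows "nfa_bound (sem t) (iterated_exp (Suc c) (4 * length (encode t) - 2))"
  using assms
proof (induction arbitrary: c)
  case 1
  show ?case
    using nfa_bound_Nil iterated_exp_Suc_pos by (simp only: sem.simps) (rule nfa_bound_mono)
next
  case (2 \<gamma>)
  have "2 \<le> 4 * length (encode (Leaf \<gamma>)) - 2"
    using length_encode_pos[of "Leaf \<gamma>"] by simp
  then have "2 \<le> iterated_exp (Suc c) (4 * length (encode (Leaf \<gamma>)) - 2)"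
    using le_iterated_exp le_trans by blast
  with nfa_bound_last show ?case
    by (simp only: sem.simps) (rule nfa_bound_mono)
next
  case (3 ts)
  let ?x = "\<lambda>t. 4 * length (encode t) - 2" and ?e = "iterated_exp (Suc c)"
  have x1: "1 \<le> ?x t" for t :: "'a tree"
    using length_encode_pos[of t] by linarith
  have ADT: "OR ts \<in> ADT"
    using 3 by (auto intro: ADT.intros)
  have "nfa_bound (sem (OR ts)) (\<Sum>t\<leftarrow>ts. ?e (?x t))"
    using 3 cd_le_iff[OF ADT, of c] by (intro nfa_bound_sem_OR) auto
  moreover have "(\<Sum>t\<leftarrow>ts. ?e (?x t)) + 1 \<le> ?e (sum_list (map ?x ts) + 1)"
    using iterated_exp_sum_list[of "map ?x ts" c] x1 by (simp add: o_def del: iterated_exp_Suc)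
  moreover have "sum_list (map ?x ts) \<le> 4 * length (concat (map encode ts))"
    by (induction ts) auto
  then have "?e (sum_list (map ?x ts) + 1) \<le> ?e (?x (OR ts))"
    by (intro iterated_exp_mono) simp
  ultimately show ?case
    by (elim nfa_bound_mono) linarith
next
  case (4 ts)
  let ?x = "\<lambda>t. 4 * length (encode t) - 2" and ?e = "iterated_exp (Suc c)"
  have x1: "1 \<le> ?x t" for t :: "'a tree"
    using length_encode_pos[of t] by linarith
  have ADT: "SAND ts \<in> ADT"
    using 4 by (auto intro: ADT.intros)
  have "nfa_bound (sem (SAND ts)) ((\<Sum>t\<leftarrow>ts. ?e (?x t)) + 1)"
    using 4 cd_le_iff[OF ADT, of c] by (intro nfa_bound_sem_SAND) auto
  moreover have "(\<Sum>t\<leftarrow>ts. ?e (?x t)) + 1 \<le> ?e (sum_list (map ?x ts) + 1)"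
    using iterated_exp_sum_list[of "map ?x ts" c] x1 by (simp add: o_def del: iterated_exp_Suc)
  moreover have "sum_list (map ?x ts) \<le> 4 * length (concat (map encode ts))"
    by (induction ts) auto
  then have "?e (sum_list (map ?x ts) + 1) \<le> ?e (?x (SAND ts))"
    by (intro iterated_exp_mono) simp
  ultimately show ?case
    by (elim nfa_bound_mono) linarith
next
  case (5 ts)
  let ?x = "\<lambda>t. 4 * length (encode t) - 2" and ?e = "iterated_exp (Suc c)"
  have ADT: "AND ts \<in> ADT"
    using 5 by (auto intro: ADT.intros)
  have "nfa_bound (sem (AND ts)) (length ts * (\<Prod>t\<leftarrow>ts. ?e (?x t) + 1))"
    using 5 cd_le_iff[OF ADT, of c] by (intro nfa_bound_sem_AND) auto
  moreover have "length ts * (\<Prod>t\<leftarrow>ts. ?e (?x t) + 1) \<le> ?e (length ts) * ?e (\<Sum>t\<leftarrow>ts. ?x t + 1)"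
    using iterated_exp_prod_list[of c "map ?x ts"] le_iterated_exp by (intro mult_le_mono) (simp_all only: o_def list.map_comp)
  moreover have "?e (length ts) * ?e (\<Sum>t\<leftarrow>ts. ?x t + 1) \<le> ?e (length ts + (\<Sum>t\<leftarrow>ts. ?x t + 1))"
    using 5(1) by (intro iterated_exp_mult) (cases ts, auto)+
  moreover have "length ts + (\<Sum>t\<leftarrow>ts. ?x t + 1) \<le> 4 * length (concat (map encode ts))"
  proof (induction ts)
    case (Cons t ts)
    then show ?case using length_encode_pos[of t] by simp
  qed simp
  then have "?e (length ts + (\<Sum>t\<leftarrow>ts. ?x t + 1)) \<le> ?e (?x (AND ts))"
    by (intro iterated_exp_mono) simp
  ultimately show ?case
    by (elim nfa_bound_mono) linarith
next
  case (6 t t')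
  let ?x = "\<lambda>t. 4 * length (encode t) - 2" and ?e = "iterated_exp (Suc c)"
  \<comment> \<open>The right argument has depth at most \<open>c - 1\<close>, so its bound has
    height \<open>c\<close> only, and the complement raises it to the height \<open>Suc c\<close> of
    the left argument.\<close>
  have "cd t \<le> c" "cd t' \<le> c - 1" "c = Suc (c - 1)"
    using 6(5) by auto
  then have t: "nfa_bound (sem t) (?e (?x t))" "nfa_bound (sem t') (iterated_exp c (?x t'))"
    using 6 by metis+
  have "nfa_bound (sem (C t t')) (?e (?x t) * ?e (?x t'))"
    using nfa_bound_Diff[OF t] by simp
  moreover have "?e (?x t) * ?e (?x t') \<le> ?e (?x t + ?x t')"
    using length_encode_pos[of t] length_encode_pos[of t'] by (intro iterated_exp_mult) linarith+
  moreover have "?e (?x t + ?x t') \<le> ?e (?x (C t t'))"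
    by (intro iterated_exp_mono) simp
  ultimately show ?case
    by (elim nfa_bound_mono) linarith
qed

lemma short_witness:
  assumes "t \<in> ADT_upto k" "sem t \<noteq> {}"
  shows "\<exists>w \<in> sem t. length w < iterated_exp (Suc k) (4 * length (encode t))"
proof -
  have "nfa_bound (sem t) (iterated_exp (Suc k) (4 * length (encode t)))"
    using nfa_bound_sem[of t k] assms(1) iterated_exp_mono
    by (auto simp: ADT_upto_def simp del: iterated_exp_Suc elim!: nfa_bound_mono)
  from nfa_bound_short[OF this assms(2)] show ?thesis .
qed

section \<open>Counter programs and Turing machines\<close>

text \<open>Tape \<open>0\<close> is the input tape, tape \<open>1\<close> an array of numbers below \<open>B\<close>, and every other tape a
  counter; a register is the head position of a tape. \<open>Tick\<close> increments the scanned array cell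
  modulo \<open>B\<close>, and the bound \<open>m\<close> in \<open>exec\<close> confines the heads to \<open>{0..m}\<close>.\<close>

datatype 'a test = Zero nat | Work "nat \<Rightarrow> bool" | Inp "'a option \<Rightarrow> bool"

datatype 'a com =
    Skip
  | Inc nat
  | Dec nat
  | Tick
  | Seq "'a com" "'a com" (infixr ";;" 60)
  | Cond "'a test" "'a com" "'a com"
  | Until "'a test" "'a com"

type_synonym state = "(nat \<Rightarrow> nat) \<times> (nat \<Rightarrow> nat)"

definition letter_at :: "'a list \<Rightarrow> nat \<Rightarrow> 'a option" where
  "letter_at u p = (if p < length u then Some (u ! p) else None)"

primrec holds :: "'a list \<Rightarrow> state \<Rightarrow> 'a test \<Rightarrow> bool" where
  "holds u s (Zero j) \<longleftrightarrow> fst s j = 0"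
| "holds u s (Work P) \<longleftrightarrow> P (snd s (fst s 1))"
| "holds u s (Inp P) \<longleftrightarrow> P (letter_at u (fst s 0))"

text \<open>A derivation certifies termination and the space bound at once; running time is never
  counted.\<close>

inductive exec :: "'a list \<Rightarrow> nat \<Rightarrow> nat \<Rightarrow> 'a com \<Rightarrow> state \<Rightarrow> state \<Rightarrow> bool" for u B m where
  Skip: "exec u B m Skip s s"
| Inc: "v j < m \<Longrightarrow> exec u B m (Inc j) (v, z) (v(j := Suc (v j)), z)"
| Dec: "0 < v j \<Longrightarrow> exec u B m (Dec j) (v, z) (v(j := v j - 1), z)"
| Tick: "exec u B m Tick (v, z) (v, z(v 1 := Suc (z (v 1)) mod B))"
| Seq: "exec u B m c s t \<Longrightarrow> exec u B m d t r \<Longrightarrow> exec u B m (c ;; d) s r"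
| Cond: "exec u B m (if holds u s b then c else d) s t \<Longrightarrow> exec u B m (Cond b c d) s t"
| Until_stop: "holds u s b \<Longrightarrow> exec u B m (Until b c) s s"
| Until_step: "\<not> holds u s b \<Longrightarrow> exec u B m c s t \<Longrightarrow> exec u B m (Until b c) t r \<Longrightarrow>
    exec u B m (Until b c) s r"

text \<open>Only the tapes from 2 on are marked at cell 0, so only their heads can be tested for
  zero. The heads on the input and on the array are brought back by counting.\<close>

fun test_ok :: "nat \<Rightarrow> 'a test \<Rightarrow> bool" where
  "test_ok K (Zero j) \<longleftrightarrow> 2 \<le> j \<and> j < K"
| "test_ok K _ \<longleftrightarrow> True"

primrec com_ok :: "nat \<Rightarrow> 'a com \<Rightarrow> bool" where
  "com_ok K Skip \<longleftrightarrow> True"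
| "com_ok K (Inc j) \<longleftrightarrow> j < K"
| "com_ok K (Dec j) \<longleftrightarrow> j < K"
| "com_ok K Tick \<longleftrightarrow> True"
| "com_ok K (c ;; d) \<longleftrightarrow> com_ok K c \<and> com_ok K d"
| "com_ok K (Cond b c d) \<longleftrightarrow> test_ok K b \<and> com_ok K c \<and> com_ok K d"
| "com_ok K (Until b c) \<longleftrightarrow> test_ok K b \<and> com_ok K c"

text \<open>A control state is the list of commands that remain to be executed.\<close>

primrec points :: "'a com \<Rightarrow> 'a com list \<Rightarrow> 'a com list set" where
  "points Skip k = {Skip # k}"
| "points (Inc j) k = {Inc j # k}"
| "points (Dec j) k = {Dec j # k}"
| "points Tick k = {Tick # k}"
| "points (c ;; d) k = {(c ;; d) # k} \<union> points c (d # k) \<union> points d k"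
| "points (Cond b c d) k = {Cond b c d # k} \<union> points c k \<union> points d k"
| "points (Until b c) k = {Until b c # k} \<union> points c (Until b c # k)"

lemma finite_points: "finite (points c k)"
  by (induction c arbitrary: k) simp_all

lemma points_start: "c # k \<in> points c k"
  by (cases c) simp_all

fun next_point :: "('a test \<Rightarrow> bool) \<Rightarrow> 'a com list \<Rightarrow> 'a com list" where
  "next_point h ((c ;; d) # k) = c # d # k"
| "next_point h (Cond b c d # k) = (if h b then c else d) # k"
| "next_point h (Until b c # k) = (if h b then k else c # Until b c # k)"
| "next_point h (c # k) = k"
| "next_point h [] = []"

text \<open>Although commands nest and loop, no step leaves a finite set of continuations: the body
  of a loop is always followed by that same loop. This makes the control of the machine
  finite.\<close>

lemma next_point: "l \<in> points c k \<Longrightarrow> next_point h l \<in> insert k (points c k)"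
proof (induction c arbitrary: k)
  case (Seq c d)
  then consider "l = (c ;; d) # k" | "l \<in> points c (d # k)" | "l \<in> points d k"
    by auto
  then show ?case
  proof cases
    case 2
    then show ?thesis
      using Seq.IH(1)[of "d # k"] points_start[of d k] by auto
  qed (use Seq.IH(2)[of k] points_start[of c "d # k"] in auto)
next
  case (Cond b c d)
  then show ?case
    using points_start[of c k] points_start[of d k] by auto
next
  case (Until b c)
  from Until.prems show ?case
    using Until.IH[of "Until b c # k"] points_start[of c "Until b c # k"] by (auto split: if_splits)
qed auto

text \<open>Zero is the blank, so the untouched array tape already represents the zero
  table.\<close>

definition cell :: "nat \<Rightarrow> 'a symbol" where
  "cell a = (if a = 0 then Blank else Aux a)"

fun num :: "'a symbol \<Rightarrow> nat" where
  "num (Aux a) = a"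
| "num _ = 0"

lemma num_cell [simp]: "num (cell a) = a"
  by (simp add: cell_def)

fun inp :: "'a symbol \<Rightarrow> 'a option" where
  "inp (Input a) = Some a"
| "inp _ = None"

fun sees :: "'a symbol list \<Rightarrow> 'a test \<Rightarrow> bool" where
  "sees ss (Zero j) \<longleftrightarrow> ss ! j = Aux 0"
| "sees ss (Work P) \<longleftrightarrow> P (num (ss ! 1))"
| "sees ss (Inp P) \<longleftrightarrow> P (inp (ss ! 0))"

fun action :: "nat \<Rightarrow> 'a symbol list \<Rightarrow> 'a com list \<Rightarrow> nat \<Rightarrow> 'a symbol \<times> move" where
  "action B ss (Inc j # k) i = (ss ! i, if i = j then MoveRight else Stay)"
| "action B ss (Dec j # k) i = (ss ! i, if i = j then MoveLeft else Stay)"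
| "action B ss (Tick # k) i = (if i = 1 then cell (Suc (num (ss ! i)) mod B) else ss ! i, Stay)"
| "action B ss _ i = (ss ! i, Stay)"

text \<open>Cell \<open>0\<close> of a counter carries the mark \<open>Aux 0\<close>, written in the first step, by which the test
  for zero recognises it.\<close>

definition content :: "'a list \<Rightarrow> (nat \<Rightarrow> nat) \<Rightarrow> nat \<Rightarrow> int \<Rightarrow> 'a symbol" where
  "content u z j = (if j = 0 then fst (input_tape u)
     else if j = 1 then (\<lambda>p. if p < 0 then Blank else cell (z (nat p)))
     else (\<lambda>p. if p = 0 then Aux 0 else Blank))"

section \<open>The machine of a program\<close>

locale compiled =
  fixes K B :: nat and c :: "'a::finite com"
  assumes ok: "com_ok K c" and K: "3 \<le> K" and B: "0 < B"
begin

definition pts :: "'a com list set" where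
  "pts = insert [] (points c [])"

lemma finite_pts: "finite pts"
  by (simp add: pts_def finite_points)

definition code :: "'a com list \<Rightarrow> nat" where
  "code = (SOME f. inj_on f pts)"

lemma inj_code: "inj_on code pts"
proof -
  have "\<exists>f :: 'a com list \<Rightarrow> nat. inj_on f pts"
    using finite_imp_inj_to_nat_seg[OF finite_pts] by blast
  then show ?thesis
    unfolding code_def by (rule someI_ex)
qed

definition point :: "nat \<Rightarrow> 'a com list" where
  "point q = inv_into pts code (q - 3)"

text \<open>States 0, 1 and 2 are the accepting, the rejecting and the initial one; hence the shift
  of the coded continuations by 3. At the empty continuation the program has ended and the answer is
  read from counter 2.\<close>

definition machine :: "'a tm" where
  "machine = \<lparr>tapes = K, states = {0, 1, 2} \<union> (\<lambda>l. code l + 3) ` pts,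
     symbols = insert Blank (range Input) \<union> Aux ` {..<B},
     start = 2, accept = 0, reject = 1,
     trans = (\<lambda>q ss. if q = 2 then (code [c] + 3, map (\<lambda>i. (if 2 \<le> i then Aux 0 else ss ! i, Stay)) [0..<K])
       else (if point q = [] then (if sees ss (Zero 2) then 1 else 0)
         else code (next_point (sees ss) (point q)) + 3, map (action B ss (point q)) [0..<K]))\<rparr>"

lemma start_pts: "[c] \<in> pts"
  by (simp add: pts_def points_start)

lemma next_pts: "l \<in> pts \<Longrightarrow> next_point h l \<in> pts"
  using next_point[of l c "[]" h] by (auto simp: pts_def)

lemma point_code: "l \<in> pts \<Longrightarrow> point (code l + 3) = l"
  by (simp add: point_def inj_code)

lemma turing_machine: "turing_machine machine"
proof -
  have act: "fst (action B ss l i) \<in> symbols machine"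
    if "set ss \<subseteq> symbols machine" "length ss = K" "i < K" for ss :: "'a symbol list" and l i
  proof -
    have "ss ! i \<in> symbols machine"
      using that nth_mem by blast
    moreover have "cell a \<in> symbols machine" if "a < B" for a
      using that by (auto simp: machine_def cell_def)
    ultimately show ?thesis
      using B by (cases "(B, ss, l, i)" rule: action.cases) (auto simp del: nth_mem)
  qed
  show ?thesis
    unfolding turing_machine_def
  proof (intro conjI ballI allI impI)
    fix q ss
    assume q: "q \<in> states machine - {accept machine, reject machine}"
      and ss: "length ss = tapes machine \<and> set ss \<subseteq> symbols machine"
    show "let (q', as) = trans machine q ss in
       q' \<in> states machine \<and> length as = tapes machine \<and> fst ` set as \<subseteq> symbols machine"
    proof (cases "q = 2")
      case True
      have "(if 2 \<le> i then Aux 0 else ss ! i) \<in> symbols machine" if "i < K" for i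
      proof (cases "2 \<le> i")
        case True
        then show ?thesis using B by (simp add: machine_def)
      next
        case False
        have "i < length ss" using ss that by (simp add: machine_def)
        then show ?thesis using False ss nth_mem by auto
      qed
      then have "fst ` set (map (\<lambda>i. (if 2 \<le> i then Aux 0 else ss ! i, Stay)) [0..<K]) \<subseteq> symbols machine"
        by (simp add: image_subset_iff split del: if_split)
      moreover have "snd (trans machine q ss) = map (\<lambda>i. (if 2 \<le> i then Aux 0 else ss ! i, Stay)) [0..<K]"
        using True by (simp add: machine_def)
      ultimately have "fst ` set (snd (trans machine q ss)) \<subseteq> symbols machine"
        by (simp only:)
      then show ?thesis
        using True start_pts by (simp add: machine_def)
    next
      case False
      then obtain l where l: "l \<in> pts" "q = code l + 3"
        using q by (auto simp: machine_def)
      then have "fst (trans machine q ss) \<in> states machine"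
        using next_pts[OF l(1), of "sees ss"] by (auto simp: machine_def point_code)
      moreover have "snd (trans machine q ss) = map (action B ss l) [0..<K]"
        using l by (simp add: machine_def point_code)
      moreover have "fst ` set (map (action B ss l) [0..<K]) \<subseteq> symbols machine"
        using ss act[of ss _ l] by (simp add: image_subset_iff machine_def)
      ultimately show ?thesis
        by (simp add: case_prod_beta machine_def)
    qed
  qed (use K finite_pts B in \<open>auto simp: machine_def\<close>)
qed

definition conf :: "'a list \<Rightarrow> 'a com list \<Rightarrow> state \<Rightarrow> 'a config" where
  "conf u l s = (code l + 3, map (\<lambda>j. (content u (snd s) j, int (fst s j))) [0..<K])"

definition good :: "nat \<Rightarrow> 'a config \<Rightarrow> bool" where
  "good m x \<longleftrightarrow> length (snd x) = K \<and> (\<forall>i < K. snd (snd x ! i) \<in> {0..int m})"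

definition bounded :: "nat \<Rightarrow> state \<Rightarrow> bool" where
  "bounded m s \<longleftrightarrow> (\<forall>j. fst s j \<le> m)"

lemma good_conf: "bounded m s \<Longrightarrow> good m (conf u l s)"
  by (simp add: good_def conf_def bounded_def)

abbreviation path :: "nat \<Rightarrow> 'a config \<Rightarrow> 'a config \<Rightarrow> bool" where
  "path m \<equiv> (\<lambda>x y. y = step machine x \<and> good m y)\<^sup>*\<^sup>*"

lemma sees_conf:
  assumes "test_ok K b"
  shows "sees (map read (snd (conf u l s))) b = holds u s b"
  using assms K
  by (cases b) (auto simp: conf_def read_def content_def input_tape_def letter_at_def)

lemma step_conf:
  assumes "l \<in> pts"
  shows "step machine (conf u l s) =
    (if l = [] then (if sees (map read (snd (conf u l s))) (Zero 2) then 1 else 0)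
      else code (next_point (sees (map read (snd (conf u l s)))) l) + 3,
     map (\<lambda>i. act (content u (snd s) i, int (fst s i)) (action B (map read (snd (conf u l s))) l i)) [0..<K])"
proof -
  have "map2 act (map f [0..<K]) (map g [0..<K]) = map (\<lambda>i. act (f i) (g i)) [0..<K]" for f :: "nat \<Rightarrow> 'a tape" and g
    by (rule nth_equalityI) simp_all
  then show ?thesis
    using assms by (simp add: step_def machine_def conf_def point_code)
qed

lemma act_stay: "act (f, p) (f p, Stay) = (f, p)"
  by (simp add: act_def)

lemma act_move: "act (f, p) (f p, d) = (f, p + offset d)"
  by (simp add: act_def)

lemma step_idle:
  assumes "l \<in> pts" "l \<noteq> []" "\<And>ss i. action B ss l i = (ss ! i, Stay)"
  shows "step machine (conf u l s) = conf u (next_point (sees (map read (snd (conf u l s)))) l) s"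
  unfolding step_conf[OF assms(1)] assms(3)
  using assms(2) by (simp add: conf_def read_def act_stay)

lemma path_step: "step machine (conf u l s) = conf u l' s' \<Longrightarrow> bounded m s' \<Longrightarrow> path m (conf u l s) (conf u l' s')"
  by (rule r_into_rtranclp) (simp add: good_conf)

text \<open>The continuation \<open>k\<close> is arbitrary, so that the parts of a compound command
  can be chained. Keeping the points within \<open>pts\<close> ensures that every state met decodes
  to the continuation it encodes.\<close>

lemma exec_path:
  assumes "exec u B m d s t" "points d k \<subseteq> pts" "com_ok K d" "bounded m s"
  shows "path m (conf u (d # k) s) (conf u k t) \<and> bounded m t"
  using assms
proof (induction arbitrary: k)
  case (Skip s)
  then show ?case
    by (intro conjI path_step) (simp_all add: step_idle)
next
  case (Inc v j z)
  have pts: "Inc j # k \<in> pts"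
    using Inc.prems by simp
  have "step machine (conf u (Inc j # k) (v, z)) = conf u k (v(j := Suc (v j)), z)"
    unfolding step_conf[OF pts]
    by (simp add: conf_def read_def act_move)
  moreover have "bounded m (v(j := Suc (v j)), z)"
    using Inc by (simp add: bounded_def)
  ultimately show ?case
    by (simp add: path_step)
next
  case (Dec v j z)
  have pts: "Dec j # k \<in> pts"
    using Dec.prems by simp
  have "step machine (conf u (Dec j # k) (v, z)) = conf u k (v(j := v j - 1), z)"
    unfolding step_conf[OF pts]
    using Dec.hyps by (simp add: conf_def read_def act_move of_nat_diff)
  moreover have "bounded m (v(j := v j - 1), z)"
    using Dec by (auto simp: bounded_def intro: le_trans[OF diff_le_self])
  ultimately show ?case
    by (simp add: path_step)
next
  case (Tick v z)
  have pts: "Tick # k \<in> pts"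
    using Tick.prems by simp
  have "step machine (conf u (Tick # k) (v, z)) = conf u k (v, z(v 1 := Suc (z (v 1)) mod B))"
    unfolding step_conf[OF pts]
    by (auto simp: conf_def read_def act_def content_def fun_eq_iff)
  moreover have "bounded m (v, z(v 1 := Suc (z (v 1)) mod B))"
    using Tick by (simp add: bounded_def)
  ultimately show ?case
    by (simp add: path_step)
next
  case (Seq d1 s t d2 r)
  have 1: "step machine (conf u ((d1 ;; d2) # k) s) = conf u (d1 # d2 # k) s"
    using Seq.prems by (subst step_idle) simp_all
  have pts: "points d1 (d2 # k) \<subseteq> pts" "points d2 k \<subseteq> pts"
    using Seq.prems by simp_all
  have "path m (conf u ((d1 ;; d2) # k) s) (conf u (d1 # d2 # k) s)"
    by (rule path_step[OF 1 Seq.prems(3)])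
  then show ?case
    using Seq.IH(1)[OF pts(1)] Seq.IH(2)[OF pts(2)] Seq.prems by (auto intro: rtranclp_trans)
next
  case (Cond s b d1 d2 t)
  have 1: "step machine (conf u (Cond b d1 d2 # k) s) = conf u ((if holds u s b then d1 else d2) # k) s"
    using Cond.prems by (subst step_idle) (simp_all add: sees_conf)
  then show ?case
    using Cond.IH path_step[OF 1 Cond.prems(3)] Cond.prems by (auto intro: rtranclp_trans split: if_splits)
next
  case (Until_stop s b d)
  have 1: "step machine (conf u (Until b d # k) s) = conf u k s"
    using Until_stop by (subst step_idle) (simp_all add: sees_conf)
  then show ?case
    using Until_stop by (simp add: path_step)
next
  case (Until_step s b d t r)
  have pts: "points d (Until b d # k) \<subseteq> pts"
    using Until_step.prems by simp
  have "step machine (conf u (Until b d # k) s) = conf u (d # Until b d # k) s"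
    using Until_step by (subst step_idle) (simp_all add: sees_conf)
  then have 1: "path m (conf u (Until b d # k) s) (conf u (d # Until b d # k) s)"
    using Until_step.prems(3) by (rule path_step)
  have 2: "path m (conf u (d # Until b d # k) s) (conf u (Until b d # k) t) \<and> bounded m t"
    using Until_step.IH(1)[OF pts] Until_step.prems by simp
  then have 3: "path m (conf u (Until b d # k) t) (conf u k r) \<and> bounded m r"
    using Until_step.IH(2)[of k] Until_step.prems by simp
  from 1 2 3 show ?case
    by (meson rtranclp_trans)
qed

lemma path_steps:
  "path m x y \<Longrightarrow> good m x \<Longrightarrow> \<exists>n. (step machine ^^ n) x = y \<and> (\<forall>i \<le> n. good m ((step machine ^^ i) x))"
proof (induction rule: rtranclp_induct)
  case base
  then show ?case
    by (intro exI[of _ 0]) simp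
next
  case (step y z)
  then obtain n where "(step machine ^^ n) x = y" "\<forall>i \<le> n. good m ((step machine ^^ i) x)"
    by blast
  with step(2) show ?case
    by (intro exI[of _ "Suc n"]) (auto simp: le_Suc_eq)
qed

lemma initial_step:
  "step machine (initial machine u) = conf u [c] (\<lambda>_. 0, \<lambda>_. 0)"
proof -
  define T where "T = input_tape u # replicate (K - 1) (\<lambda>_ :: int. Blank :: 'a symbol, 0 :: int)"
  have init: "initial machine u = (2, T)"
    by (simp add: initial_def machine_def T_def)
  have len: "length T = K"
    using K by (simp add: T_def)
  have T: "T ! i = (if i = 0 then input_tape u else (\<lambda>_. Blank, 0))" if "i < K" for i
    using that by (auto simp: T_def nth_Cons split: nat.split)
  have "step machine (initial machine u) = (code [c] + 3,
      map2 act T (map (\<lambda>i. (if 2 \<le> i then Aux 0 else map read T ! i, Stay)) [0..<K]))"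
    unfolding init by (simp add: step_def machine_def)
  also have "map2 act T (map (\<lambda>i. (if 2 \<le> i then Aux 0 else map read T ! i, Stay)) [0..<K]) =
      map (\<lambda>j. (content u (\<lambda>_. 0) j, 0)) [0..<K]"
  proof (rule nth_equalityI)
    fix i
    assume "i < length (map2 act T (map (\<lambda>i. (if 2 \<le> i then Aux 0 else map read T ! i, Stay)) [0..<K]))"
    then have i: "i < K" by (simp add: len)
    have "act (T ! i) (if 2 \<le> i then Aux 0 else read (T ! i), Stay) = (content u (\<lambda>_. 0) i, 0)"
      unfolding T[OF i] by (auto simp: act_def read_def content_def cell_def input_tape_def fun_eq_iff)
    then show "map2 act T (map (\<lambda>i. (if 2 \<le> i then Aux 0 else map read T ! i, Stay)) [0..<K]) ! i =
        map (\<lambda>j. (content u (\<lambda>_. 0) j, 0)) [0..<K] ! i"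
      using i by (auto simp: len split: if_splits)
  qed (simp add: len)
  finally show ?thesis
    by (simp add: conf_def)
qed

lemma run_exec:
  assumes "exec u B m c (\<lambda>_. 0, \<lambda>_. 0) (v, z)"
  shows "\<exists>t. fst (run machine u t) = (if v 2 \<noteq> 0 then accept machine else reject machine)"
    "finite (visited machine u)" "card (visited machine u) \<le> K * (m + 1)"
proof -
  let ?x = "initial machine u" and ?y = "conf u [] (v, z)" and ?f = "step machine (conf u [] (v, z))"
  have good0: "good m ?x"
    using K by (auto simp: good_def initial_def machine_def input_tape_def nth_Cons split: nat.split)
  have good1: "good m (conf u [c] (\<lambda>_. 0, \<lambda>_. 0))"
    by (simp add: good_conf bounded_def)
  have ex: "path m (conf u [c] (\<lambda>_. 0, \<lambda>_. 0)) ?y \<and> bounded m (v, z)"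
    by (rule exec_path[OF assms]) (auto simp: pts_def ok bounded_def)
  have "sees (map read (snd ?y)) (Zero 2) = holds u (v, z) (Zero 2)"
    by (rule sees_conf) (use K in simp)
  then have f: "?f = (if v 2 \<noteq> 0 then accept machine else reject machine, snd ?y)"
  proof -
    have "[] \<in> pts"
      by (simp add: pts_def)
    have "snd ?f = snd ?y"
      unfolding step_conf[OF \<open>[] \<in> pts\<close>] by (simp add: conf_def read_def act_stay)
    moreover have "fst ?f = (if v 2 \<noteq> 0 then accept machine else reject machine)"
      using \<open>sees (map read (snd ?y)) (Zero 2) = holds u (v, z) (Zero 2)\<close>
      unfolding step_conf[OF \<open>[] \<in> pts\<close>] by (simp add: machine_def del: sees.simps)
    ultimately show ?thesis
      by (simp add: prod_eq_iff)
  qed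
  then have goodf: "good m ?f"
    using good_conf[of m "(v, z)" u "[]"] ex by (simp add: good_def)
  have "path m ?x (conf u [c] (\<lambda>_. 0, \<lambda>_. 0))"
    by (rule r_into_rtranclp) (simp add: initial_step good1)
  also have "path m (conf u [c] (\<lambda>_. 0, \<lambda>_. 0)) ?y"
    using ex by simp
  also have "path m ?y ?f"
    by (rule r_into_rtranclp) (simp add: goodf)
  finally obtain n where n: "(step machine ^^ n) ?x = ?f" "\<forall>i \<le> n. good m ((step machine ^^ i) ?x)"
    using path_steps good0 by blast
  \<comment> \<open>A halting configuration is a fixed point, so the bound on the first
    \<open>n\<close> steps extends to all times, as \<open>visited\<close> requires.\<close>
  have halt: "step machine ?f = ?f"
    unfolding f by (simp add: step_def)
  have "good m (run machine u t)" for t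
  proof (cases "t \<le> n")
    case True
    then show ?thesis using n(2) by (simp add: run_def)
  next
    case False
    have "(step machine ^^ (i + n)) ?x = ?f" for i
      by (induction i) (simp_all add: n(1) halt)
    from this[of "t - n"] False show ?thesis
      using goodf by (simp add: run_def)
  qed
  then have sub: "visited machine u \<subseteq> {..<K} \<times> {0..int m}"
    by (auto simp: visited_def machine_def good_def)
  then show "finite (visited machine u)"
    by (rule finite_subset) simp
  have "card (visited machine u) \<le> card ({..<K} \<times> {0..int m})"
    using sub by (intro card_mono) simp_all
  then show "card (visited machine u) \<le> K * (m + 1)"
    by (simp add: card_cartesian_product nat_add_distrib)
  show "\<exists>t. fst (run machine u t) = (if v 2 \<noteq> 0 then accept machine else reject machine)"
    using n(1) f by (intro exI[of _ n]) (simp add: run_def)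
qed

end

theorem decides_in_space_program:
  fixes c :: "'a::finite com"
  assumes "com_ok K c" "3 \<le> K" "0 < B"
    and "\<And>u. \<exists>m v z. exec u B m c (\<lambda>_. 0, \<lambda>_. 0) (v, z) \<and> (v 2 \<noteq> 0 \<longleftrightarrow> u \<in> L) \<and> K * (m + 1) \<le> s (length u)"
  shows "\<exists>M. turing_machine M \<and> decides_in_space M L s"
proof -
  interpret compiled K B c
    by standard (use assms in simp_all)
  have "decides_in_space machine L s"
    unfolding decides_in_space_def
  proof
    fix u
    obtain m v z where 1: "exec u B m c (\<lambda>_. 0, \<lambda>_. 0) (v, z)" and 2: "v 2 \<noteq> 0 \<longleftrightarrow> u \<in> L"
      and 3: "K * (m + 1) \<le> s (length u)"
      using assms(4) by blast
    from run_exec[OF 1] 2 3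
    show "(\<exists>t. fst (run machine u t) = (if u \<in> L then accept machine else reject machine)) \<and>
      finite (visited machine u) \<and> card (visited machine u) \<le> s (length u)"
      by (auto intro: le_trans)
  qed
  with turing_machine show ?thesis
    by blast
qed

section \<open>Evaluating second-order formulas\<close>

lemma exec_IncI: "v j < m \<Longrightarrow> t = (v(j := Suc (v j)), z) \<Longrightarrow> exec u B m (Inc j) (v, z) t"
  by (simp add: exec.Inc)

lemma exec_DecI: "0 < v j \<Longrightarrow> t = (v(j := v j - 1), z) \<Longrightarrow> exec u B m (Dec j) (v, z) t"
  using exec.Dec[of v j u B m z] by simp

lemma exec_SkipI: "s = t \<Longrightarrow> exec u B m Skip s t"
  by (simp add: exec.Skip)

lemma exec_Cond_True: "holds u s b \<Longrightarrow> exec u B m c s t \<Longrightarrow> exec u B m (Cond b c d) s t"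
  by (rule exec.Cond) simp

lemma exec_Cond_False: "\<not> holds u s b \<Longrightarrow> exec u B m d s t \<Longrightarrow> exec u B m (Cond b c d) s t"
  by (rule exec.Cond) simp

text \<open>A loop is described by the sequence \<open>g\<close> of its states instead of an
  invariant; this yields termination and the exact final state together.\<close>

lemma exec_Until_iterate:
  assumes "\<And>i. i < n \<Longrightarrow> \<not> holds u (g i) b"
    and "\<And>i. i < n \<Longrightarrow> exec u B m c (g i) (g (Suc i))"
    and "holds u (g n) b"
  shows "exec u B m (Until b c) (g 0) (g n)"
proof -
  have "exec u B m (Until b c) (g i) (g n)" if "i \<le> n" for i
    using that
  proof (induction rule: inc_induct)
    case base
    show ?case by (rule exec.Until_stop) (rule assms(3))
  next
    case (step i)
    then show ?case using assms(1,2) by (blast intro: exec.Until_step)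
  qed
  then show ?thesis by simp
qed

definition clear :: "nat \<Rightarrow> 'a com" where
  "clear j = Until (Zero j) (Dec j)"

lemma exec_clear: "exec u B m (clear j) (v, z) (v(j := 0), z)"
proof -
  have "exec u B m (Until (Zero j) (Dec j)) (v(j := v j - 0), z) (v(j := v j - v j), z)"
    by (rule exec_Until_iterate[where g = "\<lambda>i. (v(j := v j - i), z)"]) (auto intro!: exec_DecI)
  then show ?thesis by (simp add: clear_def)
qed

text \<open>Register \<open>3\<close> is scratch space for copying.\<close>

definition copy :: "nat \<Rightarrow> nat \<Rightarrow> 'a com" where
  "copy y t = Until (Zero y) (Dec y ;; Inc 3 ;; Inc t) ;; Until (Zero 3) (Dec 3 ;; Inc y)"

lemma exec_copy:
  assumes "y \<noteq> t" "y \<noteq> 3" "t \<noteq> 3" "v t = 0" "v 3 = 0" "v y \<le> m"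
  shows "exec u B m (copy y t) (v, z) (v(t := v y), z)"
proof -
  let ?g = "\<lambda>i. (v(y := v y - i, 3 := i, t := i), z)" and ?h = "\<lambda>i. (v(y := i, 3 := v y - i, t := v y), z)"
  have "exec u B m (Until (Zero y) (Dec y ;; Inc 3 ;; Inc t)) (?g 0) (?g (v y))"
  proof (rule exec_Until_iterate)
    show "exec u B m (Dec y ;; Inc 3 ;; Inc t) (?g i) (?g (Suc i))" if "i < v y" for i
      by (rule exec.Seq, rule exec.Dec, use assms that in simp, rule exec.Seq, rule exec.Inc,
          use assms that in simp, rule exec_IncI) (use assms that in \<open>auto simp: fun_eq_iff\<close>)
  qed (use assms in auto)
  moreover have "exec u B m (Until (Zero 3) (Dec 3 ;; Inc y)) (?h 0) (?h (v y))"
  proof (rule exec_Until_iterate)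
    show "exec u B m (Dec 3 ;; Inc y) (?h i) (?h (Suc i))" if "i < v y" for i
      by (rule exec.Seq, rule exec.Dec, use assms that in simp, rule exec_IncI)
        (use assms that in \<open>auto simp: fun_eq_iff\<close>)
  qed (use assms in auto)
  moreover have "?g 0 = (v, z)" "?g (v y) = ?h 0" "?h (v y) = (v(t := v y), z)"
    using assms by (auto simp: fun_eq_iff)
  ultimately show ?thesis
    unfolding copy_def by (metis exec.Seq)
qed

definition repeat :: "nat \<Rightarrow> nat \<Rightarrow> 'a com \<Rightarrow> 'a com" where
  "repeat y t c = copy y t ;; Until (Zero t) (Dec t ;; c)"

definition upd :: "nat \<Rightarrow> nat \<Rightarrow> state \<Rightarrow> state" where
  "upd t a s = ((fst s)(t := a), snd s)"

text \<open>The body must act alike for every value \<open>a\<close> of the loop counter;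
  \<open>g\<close> can then ignore the counter, which shrinks while \<open>g\<close>
  advances.\<close>

lemma exec_repeat:
  assumes "y \<noteq> t" "y \<noteq> 3" "t \<noteq> 3" "fst (g 0) t = 0" "fst (g 0) 3 = 0" "fst (g 0) y = n" "n \<le> m"
    and "fst (g n) t = 0"
    and step: "\<And>i a. i < n \<Longrightarrow> exec u B m c (upd t a (g i)) (upd t a (g (Suc i)))"
  shows "exec u B m (repeat y t c) (g 0) (g n)"
proof -
  have "exec u B m (copy y t) (fst (g 0), snd (g 0)) ((fst (g 0))(t := fst (g 0) y), snd (g 0))"
    by (rule exec_copy) (use assms in auto)
  then have 1: "exec u B m (copy y t) (g 0) (upd t (n - 0) (g 0))"
    using assms(6) by (simp add: upd_def)
  have 2: "exec u B m (Until (Zero t) (Dec t ;; c)) (upd t (n - 0) (g 0)) (upd t (n - n) (g n))"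
  proof (rule exec_Until_iterate[where g = "\<lambda>i. upd t (n - i) (g i)"])
    show "exec u B m (Dec t ;; c) (upd t (n - i) (g i)) (upd t (n - Suc i) (g (Suc i)))" if "i < n" for i
    proof (rule exec.Seq)
      show "exec u B m (Dec t) (upd t (n - i) (g i)) (upd t (n - Suc i) (g i))"
        unfolding upd_def by (rule exec_DecI) (use that in auto)
    qed (rule step[OF that])
  qed (simp_all add: upd_def)
  have "upd t (n - n) (g n) = g n"
    using assms(8) by (auto simp: upd_def prod_eq_iff)
  with 1 2 show ?thesis
    unfolding repeat_def by (auto intro: exec.Seq)
qed

text \<open>The loop counters \<open>t\<close>, \<open>t + 1\<close> and so on are among the registers \<open>5\<close>, \<open>6\<close>, \<open>7\<close>, whose
  contents \<open>overlay\<close> abstracts from.\<close>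

primrec nest :: "nat list \<Rightarrow> nat \<Rightarrow> 'a com \<Rightarrow> 'a com" where
  "nest [] t c = c"
| "nest (y # ys) t c = repeat y t (nest ys (Suc t) c)"

definition overlay :: "(nat \<Rightarrow> nat) \<Rightarrow> state \<Rightarrow> state" where
  "overlay w s = (\<lambda>r. if r \<in> {5, 6, 7} then w r else fst s r, snd s)"

lemma upd_overlay: "t \<in> {5, 6, 7} \<Longrightarrow> upd t a (overlay w s) = overlay (w(t := a)) s"
  by (auto simp: upd_def overlay_def)

text \<open>Nested loops are flattened: one pass of the outer loop advances a single index by the
  product of the inner counts, so one sequence \<open>g\<close> describes all levels.\<close>

lemma exec_nest_overlay:
  assumes step: "\<And>w i. i < n \<Longrightarrow> exec u B m c (overlay w (g i)) (overlay w (g (Suc i)))"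
    and scratch: "\<And>i. i \<le> n \<Longrightarrow> fst (g i) 3 = 0"
    and const: "\<And>i y. i \<le> n \<Longrightarrow> y \<in> set ys \<Longrightarrow> fst (g i) y = val y"
    and bound: "\<And>y. y \<in> set ys \<Longrightarrow> val y \<le> m" "set ys \<inter> {3, 5, 6, 7} = {}"
  shows "5 \<le> t \<Longrightarrow> t + length ys \<le> 8 \<Longrightarrow> \<forall>r \<in> {t..<t + length ys}. w r = 0 \<Longrightarrow>
    i + prod_list (map val ys) \<le> n \<Longrightarrow>
    exec u B m (nest ys t c) (overlay w (g i)) (overlay w (g (i + prod_list (map val ys))))"
  using const bound
proof (induction ys arbitrary: t w i)
  case Nil
  then show ?case using step by simp
next
  case (Cons y ys)
  let ?p = "prod_list (map val ys)"
  let ?g = "\<lambda>j. overlay w (g (i + j * ?p))"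
  have t: "t \<in> {5, 6, 7}"
    using Cons.prems(1,2) by auto
  have y: "y \<notin> {3, 5, 6, 7}"
    using Cons.prems(7) by auto
  have le: "i + Suc j * ?p \<le> n" if "j < val y" for j
  proof -
    have "Suc j * ?p \<le> val y * ?p"
      using that by (intro mult_le_mono1) simp
    then show ?thesis using Cons.prems(4) by simp
  qed
  have "exec u B m (repeat y t (nest ys (Suc t) c)) (?g 0) (?g (val y))"
  proof (rule exec_repeat[where g = ?g])
    show "exec u B m (nest ys (Suc t) c) (upd t a (?g j)) (upd t a (?g (Suc j)))" if "j < val y" for j a
    proof -
      have "exec u B m (nest ys (Suc t) c) (overlay (w(t := a)) (g (i + j * ?p)))
          (overlay (w(t := a)) (g (i + j * ?p + ?p)))"
        by (rule Cons.IH) (use Cons.prems le[OF that] in auto)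
      moreover have "i + Suc j * ?p = i + j * ?p + ?p"
        by simp
      ultimately show ?thesis
        unfolding upd_overlay[OF t] by (simp only:)
    qed
  qed (use t y Cons.prems scratch[of i] in \<open>auto simp: overlay_def\<close>)
  then show ?case by simp
qed

lemma exec_nest:
  assumes step: "\<And>w i. i < n \<Longrightarrow> exec u B m c (overlay w (g i)) (overlay w (g (Suc i)))"
    and scratch: "\<And>i r. i \<le> n \<Longrightarrow> r \<in> {3, 5, 6, 7} \<Longrightarrow> fst (g i) r = 0"
    and const: "\<And>i y. i \<le> n \<Longrightarrow> y \<in> set ys \<Longrightarrow> fst (g i) y = val y"
    and bound: "\<And>y. y \<in> set ys \<Longrightarrow> val y \<le> m" "set ys \<inter> {3, 5, 6, 7} = {}"
    and "length ys \<le> 3" "i + prod_list (map val ys) \<le> n"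
  shows "exec u B m (nest ys 5 c) (g i) (g (i + prod_list (map val ys)))"
proof -
  have "exec u B m (nest ys 5 c) (overlay (\<lambda>_. 0) (g i)) (overlay (\<lambda>_. 0) (g (i + prod_list (map val ys))))"
    by (rule exec_nest_overlay[where n = n]) (use assms in auto)
  moreover have "overlay (\<lambda>_. 0) (g j) = g j" if "j \<le> n" for j
    using scratch[OF that] by (intro prod_eqI ext) (auto simp: overlay_def)
  ultimately show ?thesis
    using assms(7) by (metis add_leD1)
qed

text \<open>With S in register 4 this runs \<open>c\<close> as often as the cell number of a triple
  says, x * S^2 + y * S + z for the contents of the three registers. Addresses are walked and never
  computed.\<close>

definition walk :: "'a com \<Rightarrow> nat \<Rightarrow> nat \<Rightarrow> nat \<Rightarrow> 'a com" where
  "walk c x y z = nest [x, 4, 4] 5 c ;; nest [y, 4] 5 c ;; nest [z] 5 c"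

lemma exec_walk:
  assumes step: "\<And>w i. i < n \<Longrightarrow> exec u B m c (overlay w (g i)) (overlay w (g (Suc i)))"
    and scratch: "\<And>i r. i \<le> n \<Longrightarrow> r \<in> {3, 5, 6, 7} \<Longrightarrow> fst (g i) r = 0"
    and const: "\<And>i y. i \<le> n \<Longrightarrow> y \<in> {a, b, c', 4} \<Longrightarrow> fst (g i) y = val y"
    and bound: "\<And>y. y \<in> {a, b, c', 4} \<Longrightarrow> val y \<le> m" "{a, b, c'} \<inter> {3, 5, 6, 7} = {}"
    and n: "n = val a * val 4 * val 4 + val b * val 4 + val c'"
  shows "exec u B m (walk c a b c') (g 0) (g n)"
proof -
  have "exec u B m (nest [a, 4, 4] 5 c) (g 0) (g (0 + prod_list (map val [a, 4, 4])))"
    by (rule exec_nest[where n = n]) (use assms in auto)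
  moreover have "exec u B m (nest [b, 4] 5 c) (g (val a * val 4 * val 4))
      (g (val a * val 4 * val 4 + prod_list (map val [b, 4])))"
    by (rule exec_nest[where n = n]) (use assms in auto)
  moreover have "exec u B m (nest [c'] 5 c) (g (val a * val 4 * val 4 + val b * val 4))
      (g (val a * val 4 * val 4 + val b * val 4 + prod_list (map val [c'])))"
    by (rule exec_nest[where n = n]) (use assms in auto)
  ultimately show ?thesis
    unfolding walk_def n by (auto intro!: exec.Seq simp: mult.assoc)
qed

section \<open>First-order formulas over the indices\<close>

datatype 'a fm =
    FLe nat nat
  | FInp "'a option \<Rightarrow> bool" nat
  | FCell "nat \<Rightarrow> bool" nat nat nat
  | FNot "'a fm"
  | FAnd "'a fm" "'a fm"
  | FEx "'a fm"

text \<open>Variables are de Bruijn levels: a quantifier below \<open>d\<close> others binds the variable \<open>d\<close>. They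
  range over the indices below \<open>S\<close>, and \<open>z\<close> is a ternary table over these indices, laid out in
  one dimension.\<close>

primrec fsat :: "nat \<Rightarrow> 'a list \<Rightarrow> (nat \<Rightarrow> nat) \<Rightarrow> nat \<Rightarrow> (nat \<Rightarrow> nat) \<Rightarrow> 'a fm \<Rightarrow> bool" where
  "fsat S u z d e (FLe i j) \<longleftrightarrow> e i \<le> e j"
| "fsat S u z d e (FInp P i) \<longleftrightarrow> P (letter_at u (e i))"
| "fsat S u z d e (FCell P i j k) \<longleftrightarrow> P (z (e i * S * S + e j * S + e k))"
| "fsat S u z d e (FNot \<phi>) \<longleftrightarrow> \<not> fsat S u z d e \<phi>"
| "fsat S u z d e (FAnd \<phi> \<psi>) \<longleftrightarrow> fsat S u z d e \<phi> \<and> fsat S u z d e \<psi>"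
| "fsat S u z d e (FEx \<phi>) \<longleftrightarrow> (\<exists>i<S. fsat S u z (Suc d) (e(d := i)) \<phi>)"

primrec fm_ok :: "nat \<Rightarrow> 'a fm \<Rightarrow> bool" where
  "fm_ok d (FLe i j) \<longleftrightarrow> i < d \<and> j < d"
| "fm_ok d (FInp P i) \<longleftrightarrow> i < d"
| "fm_ok d (FCell P i j k) \<longleftrightarrow> i < d \<and> j < d \<and> k < d"
| "fm_ok d (FNot \<phi>) \<longleftrightarrow> fm_ok d \<phi>"
| "fm_ok d (FAnd \<phi> \<psi>) \<longleftrightarrow> fm_ok d \<phi> \<and> fm_ok d \<psi>"
| "fm_ok d (FEx \<phi>) \<longleftrightarrow> fm_ok (Suc d) \<phi>"

lemma index_less:
  fixes x y z S :: nat
  assumes "x < S" "y < S" "z < S"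
  shows "x * S * S + y * S + z < S * S * S"
proof -
  have "x * S + y < S * S"
    using mult_le_mono1[of "Suc x" S S] assms by simp
  then show ?thesis
    using mult_le_mono1[of "Suc (x * S + y)" "S * S" S] assms by (simp add: algebra_simps)
qed

text \<open>Only the cells of triples of indices are consulted, which leaves finitely many tables to
  try.\<close>

lemma fsat_cong:
  "fm_ok d \<phi> \<Longrightarrow> \<forall>i<d. e i < S \<Longrightarrow> \<forall>p<S * S * S. z p = z' p \<Longrightarrow> fsat S u z d e \<phi> = fsat S u z' d e \<phi>"
proof (induction \<phi> arbitrary: d e)
  case (FCell P i j k)
  then show ?case
    using index_less[of "e i" S "e j" "e k"] by simp
next
  case (FEx \<phi>)
  have "fsat S u z (Suc d) (e(d := i)) \<phi> = fsat S u z' (Suc d) (e(d := i)) \<phi>" if "i < S" for i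
    by (rule FEx.IH) (use FEx.prems that in auto)
  then show ?case by auto
qed auto

text \<open>Registers up to 10 have fixed roles; above them each quantifier level owns an odd
  register for its variable and an even one for its loop. Their number depends on the formula
  only.\<close>

definition var :: "nat \<Rightarrow> nat" where "var i = 11 + 2 * i"

definition loop :: "nat \<Rightarrow> nat" where "loop i = 12 + 2 * i"

text \<open>The truth value is left in register \<open>2\<close>. Register \<open>4\<close> holds \<open>S\<close>.\<close>

primrec compile :: "nat \<Rightarrow> 'a fm \<Rightarrow> 'a com" where
  "compile d (FLe i j) = repeat (var i) 5 (Inc 6) ;; repeat (var j) 5 (Cond (Zero 6) Skip (Dec 6)) ;;
     Cond (Zero 6) (Inc 2) Skip ;; clear 6"
| "compile d (FInp P i) = repeat (var i) 5 (Inc 0) ;; Cond (Inp P) (Inc 2) Skip ;; repeat (var i) 5 (Dec 0)"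
| "compile d (FCell P i j k) = walk (Inc 1) (var i) (var j) (var k) ;; Cond (Work P) (Inc 2) Skip ;;
     walk (Dec 1) (var i) (var j) (var k)"
| "compile d (FNot \<phi>) = compile d \<phi> ;; Cond (Zero 2) (Inc 2) (Dec 2)"
| "compile d (FAnd \<phi> \<psi>) = compile d \<phi> ;; Cond (Zero 2) Skip (Dec 2 ;; compile d \<psi>)"
| "compile d (FEx \<phi>) = repeat 4 (loop d) (Cond (Zero 2) (compile (Suc d) \<phi>) Skip ;; Inc (var d)) ;; clear (var d)"

text \<open>The loop registers of the enclosing quantifiers are left open because they are in use,
  and so are 8, 9 and 10, which belong to the surrounding search.\<close>

definition clean :: "nat \<Rightarrow> nat \<Rightarrow> (nat \<Rightarrow> nat) \<Rightarrow> (nat \<Rightarrow> nat) \<Rightarrow> bool" where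
  "clean S d e v \<longleftrightarrow> v 4 = S \<and> (\<forall>r \<in> {0, 1, 2, 3, 5, 6, 7}. v r = 0) \<and>
     (\<forall>i<d. v (var i) = e i \<and> e i < S) \<and> (\<forall>i\<ge>d. v (var i) = 0 \<and> v (loop i) = 0)"

lemma var_loop_simps [simp]:
  "var i = var j \<longleftrightarrow> i = j" "loop i = loop j \<longleftrightarrow> i = j" "var i \<noteq> loop j" "loop j \<noteq> var i"
  by (simp_all add: var_def loop_def) presburger+

lemma var_loop_neq [simp]:
  "r < 11 \<Longrightarrow> var i \<noteq> r" "r < 11 \<Longrightarrow> loop i \<noteq> r" "r < 11 \<Longrightarrow> r \<noteq> var i" "r < 11 \<Longrightarrow> r \<noteq> loop i"
  by (simp_all add: var_def loop_def)

lemma exec_flag: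
  assumes "v 2 = 0" "1 \<le> m"
  shows "exec u B m (Cond b (Inc 2) Skip) (v, z) (v(2 := of_bool (holds u (v, z) b)), z)"
  by (rule exec.Cond) (use assms in \<open>auto intro!: exec_IncI exec_SkipI\<close>)

text \<open>The array and all registers except 2 are restored, so subformulas can be run in
  succession under the same hypotheses.\<close>

lemma exec_compile:
  assumes "S \<le> m" "S * S * S \<le> m" "1 \<le> m"
  shows "fm_ok d \<phi> \<Longrightarrow> clean S d e v \<Longrightarrow>
    exec u B m (compile d \<phi>) (v, z) (v(2 := of_bool (fsat S u z d e \<phi>)), z)"
proof (induction \<phi> arbitrary: d e v)
  case (FLe i j)
  have c: "v (var i) = e i" "v (var j) = e j" "e i < S" "e j < S" "v 2 = 0" "v 3 = 0" "v 5 = 0" "v 6 = 0"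
    using FLe by (auto simp: clean_def)
  have 1: "exec u B m (repeat (var i) 5 (Inc 6)) (v(6 := 0), z) (v(6 := e i), z)"
    by (rule exec_repeat[where g = "\<lambda>l. (v(6 := l), z)"])
      (use c assms in \<open>auto simp: upd_def fun_upd_twist intro!: exec_IncI\<close>)
  \<comment> \<open>Truncated subtraction: register 6 ends at 0 exactly if
    \<open>e i \<le> e j\<close>.\<close>
  have 2: "exec u B m (repeat (var j) 5 (Cond (Zero 6) Skip (Dec 6))) (v(6 := e i - 0), z) (v(6 := e i - e j), z)"
    by (rule exec_repeat[where g = "\<lambda>l. (v(6 := e i - l), z)"])
      (use c assms in \<open>auto simp: upd_def fun_eq_iff intro!: exec_DecI exec_SkipI exec.Cond\<close>)
  have 3: "exec u B m (Cond (Zero 6) (Inc 2) Skip) (v(6 := e i - e j), z) (v(6 := e i - e j, 2 := of_bool (e i \<le> e j)), z)"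
    using exec_flag[of "v(6 := e i - e j)" m u B "Zero 6" z] c assms by simp
  have 4: "exec u B m (clear 6) (v(6 := e i - e j, 2 := of_bool (e i \<le> e j)), z)
      (v(6 := e i - e j, 2 := of_bool (e i \<le> e j), 6 := 0), z)"
    by (rule exec_clear)
  have e: "v(6 := e i - e j, 2 := of_bool (e i \<le> e j), 6 := 0) = v(2 := of_bool (e i \<le> e j))" "v(6 := 0) = v"
    using c by (auto simp: fun_eq_iff)
  show ?case
    unfolding compile.simps fsat.simps
    using exec.Seq[OF 1[unfolded e] exec.Seq[OF 2[unfolded diff_zero] exec.Seq[OF 3 4[unfolded e]]]] .
next
  case (FInp P i)
  have c: "v (var i) = e i" "e i < S" "v 0 = 0" "v 2 = 0" "v 3 = 0" "v 5 = 0"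
    using FInp by (auto simp: clean_def)
  let ?b = "of_bool (P (letter_at u (e i)))"
  have 1: "exec u B m (repeat (var i) 5 (Inc 0)) (v(0 := 0), z) (v(0 := e i), z)"
    by (rule exec_repeat[where g = "\<lambda>l. (v(0 := l), z)"])
      (use c assms in \<open>auto simp: upd_def fun_upd_twist intro!: exec_IncI\<close>)
  have 2: "exec u B m (Cond (Inp P) (Inc 2) Skip) (v(0 := e i), z) (v(0 := e i - 0, 2 := ?b), z)"
    using exec_flag[of "v(0 := e i)" m u B "Inp P" z] c assms by simp
  have 3: "exec u B m (repeat (var i) 5 (Dec 0)) (v(0 := e i - 0, 2 := ?b), z) (v(0 := e i - e i, 2 := ?b), z)"
    by (rule exec_repeat[where g = "\<lambda>l. (v(0 := e i - l, 2 := ?b), z)"])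
      (use c assms in \<open>auto simp: upd_def fun_eq_iff intro!: exec_DecI\<close>)
  have e: "v(0 := e i - e i, 2 := ?b) = v(2 := ?b)" "v(0 := 0) = v"
    using c by (auto simp: fun_eq_iff)
  show ?case
    unfolding compile.simps fsat.simps
    using exec.Seq[OF 1[unfolded e] exec.Seq[OF 2[unfolded diff_zero] 3[unfolded diff_zero e]]] .
next
  case (FCell P i j k)
  have c: "v (var i) = e i" "v (var j) = e j" "v (var k) = e k" "e i < S" "e j < S" "e k < S"
      "v 1 = 0" "v 2 = 0" "v 3 = 0" "v 4 = S" "v 5 = 0" "v 6 = 0" "v 7 = 0"
    using FCell by (auto simp: clean_def)
  let ?n = "e i * S * S + e j * S + e k"
  let ?b = "of_bool (P (z ?n))"
  have n: "?n < m"
    using index_less[of "e i" S "e j" "e k"] c assms by linarith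
  have 1: "exec u B m (walk (Inc 1) (var i) (var j) (var k)) (v(1 := 0), z) (v(1 := ?n), z)"
    by (rule exec_walk[where g = "\<lambda>l. (v(1 := l), z)" and val = v])
      (use c n assms in \<open>auto simp: overlay_def fun_eq_iff intro!: exec_IncI\<close>)
  have 2: "exec u B m (Cond (Work P) (Inc 2) Skip) (v(1 := ?n), z) (v(1 := ?n - 0, 2 := ?b), z)"
    using exec_flag[of "v(1 := ?n)" m u B "Work P" z] c assms by simp
  have 3: "exec u B m (walk (Dec 1) (var i) (var j) (var k)) (v(1 := ?n - 0, 2 := ?b), z) (v(1 := ?n - ?n, 2 := ?b), z)"
    by (rule exec_walk[where g = "\<lambda>l. (v(1 := ?n - l, 2 := ?b), z)" and val = v])
      (use c n assms in \<open>auto simp: overlay_def fun_eq_iff intro!: exec_DecI\<close>)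
  have e: "v(1 := ?n - ?n, 2 := ?b) = v(2 := ?b)" "v(1 := 0) = v"
    using c by (auto simp: fun_eq_iff)
  show ?case
    unfolding compile.simps fsat.simps
    using exec.Seq[OF 1[unfolded e] exec.Seq[OF 2[unfolded diff_zero] 3[unfolded diff_zero e]]] .
next
  case (FNot \<phi>)
  have "exec u B m (compile d \<phi>) (v, z) (v(2 := of_bool (fsat S u z d e \<phi>)), z)"
    by (rule FNot.IH) (use FNot.prems in simp_all)
  moreover have "exec u B m (Cond (Zero 2) (Inc 2) (Dec 2)) (v(2 := of_bool (fsat S u z d e \<phi>)), z)
      (v(2 := of_bool (\<not> fsat S u z d e \<phi>)), z)"
    by (rule exec.Cond) (use assms in \<open>auto intro!: exec_IncI exec_DecI\<close>)
  ultimately show ?case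
    unfolding compile.simps fsat.simps by (rule exec.Seq)
next
  case (FAnd \<phi> \<psi>)
  let ?a = "fsat S u z d e \<phi>" and ?b = "fsat S u z d e \<psi>"
  have 1: "exec u B m (compile d \<phi>) (v, z) (v(2 := of_bool ?a), z)"
    and 2: "exec u B m (compile d \<psi>) (v, z) (v(2 := of_bool ?b), z)"
    by (rule FAnd.IH; use FAnd.prems in simp)+
  have v: "v(2 := 0) = v"
    using FAnd.prems by (auto simp: clean_def fun_eq_iff)
  have "exec u B m (Cond (Zero 2) Skip (Dec 2 ;; compile d \<psi>)) (v(2 := of_bool ?a), z) (v(2 := of_bool (?a \<and> ?b)), z)"
  proof (cases ?a)
    case True
    have "exec u B m (Dec 2) (v(2 := of_bool ?a), z) (v, z)"
      by (rule exec_DecI) (use True v in \<open>simp_all add: v\<close>)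
    with 2 have "exec u B m (Dec 2 ;; compile d \<psi>) (v(2 := of_bool ?a), z) (v(2 := of_bool ?b), z)"
      by (blast intro: exec.Seq)
    then show ?thesis
      using True by (intro exec_Cond_False) simp_all
  qed (auto intro!: exec_Cond_True exec_SkipI)
  with 1 show ?case
    unfolding compile.simps fsat.simps by (rule exec.Seq)
next
  case (FEx \<phi>)
  let ?P = "\<lambda>i. fsat S u z (Suc d) (e(d := i)) \<phi>"
  \<comment> \<open>Register 2 accumulates the disjunction over the indices tried so far. Once it is
    1 the subformula is skipped, since compiled code expects register 2 to be 0.\<close>
  let ?g = "\<lambda>i. (v(var d := i, 2 := of_bool (\<exists>j<i. ?P j)), z)"
  have c: "v 2 = 0" "v 3 = 0" "v 4 = S" "v (var d) = 0" "v (loop d) = 0"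
    using FEx.prems by (auto simp: clean_def)
  have 1: "exec u B m (repeat 4 (loop d) (Cond (Zero 2) (compile (Suc d) \<phi>) Skip ;; Inc (var d))) (?g 0) (?g S)"
  proof (rule exec_repeat[where g = ?g])
    fix i a
    assume i: "i < S"
    let ?v = "v(loop d := a, var d := i)"
    have "clean S (Suc d) (e(d := i)) (?v(2 := 0))"
      using FEx.prems(2) i by (auto simp: clean_def less_Suc_eq)
    then have "exec u B m (compile (Suc d) \<phi>) (?v(2 := 0), z) (?v(2 := 0, 2 := of_bool (?P i)), z)"
      by (rule FEx.IH[OF FEx.prems(1)[unfolded fm_ok.simps]])
    then have 1: "exec u B m (Cond (Zero 2) (compile (Suc d) \<phi>) Skip) (?v(2 := of_bool (\<exists>j<i. ?P j)), z)
        (?v(2 := of_bool (\<exists>j<Suc i. ?P j)), z)"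
      by (cases "\<exists>j<i. ?P j") (auto simp: less_Suc_eq intro!: exec.Cond exec_SkipI)
    have 2: "exec u B m (Inc (var d)) (?v(2 := of_bool (\<exists>j<Suc i. ?P j)), z)
        (?v(2 := of_bool (\<exists>j<Suc i. ?P j), var d := Suc i), z)"
      by (rule exec_IncI) (use i assms in auto)
    have "upd (loop d) a (?g i) = (?v(2 := of_bool (\<exists>j<i. ?P j)), z)"
        "upd (loop d) a (?g (Suc i)) = (?v(2 := of_bool (\<exists>j<Suc i. ?P j), var d := Suc i), z)"
      by (auto simp: upd_def fun_eq_iff)
    with exec.Seq[OF 1 2] show "exec u B m (Cond (Zero 2) (compile (Suc d) \<phi>) Skip ;; Inc (var d))
        (upd (loop d) a (?g i)) (upd (loop d) a (?g (Suc i)))"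
      by (simp only:)
  qed (use c assms in auto)
  have 2: "exec u B m (clear (var d)) (?g S) ((fst (?g S))(var d := 0), z)"
    unfolding fst_conv by (rule exec_clear)
  have e: "?g 0 = (v, z)" "(fst (?g S))(var d := 0) = v(2 := of_bool (fsat S u z d e (FEx \<phi>)))"
    using c by (auto simp: fun_eq_iff)
  show ?case
    unfolding compile.simps using exec.Seq[OF 1[unfolded e] 2[unfolded e]] .
qed

section \<open>Enumeration of tables and sizes\<close>

text \<open>The tables are enumerated as the base-\<open>B\<close> expansions of \<open>0, 1, ..., B ^ n - 1\<close>; a carry out
  of the last digit signals the end and leaves the zero table.\<close>

definition digits :: "nat \<Rightarrow> nat \<Rightarrow> nat \<Rightarrow> nat \<Rightarrow> nat" where
  "digits B n t p = (if p < n then t div B ^ p mod B else 0)"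

text \<open>The leading digit is added as a multiple of \<open>B ^ n\<close>, which leaves the lower
  digits unchanged.\<close>

lemma digits_surj:
  assumes "\<forall>p<n. z p < B"
  shows "\<exists>t < B ^ n. \<forall>p<n. digits B n t p = z p"
proof -
  have "\<exists>t < B ^ n. \<forall>p<n. t div B ^ p mod B = z p"
    using assms
  proof (induction n)
    case (Suc n)
    then obtain t where t: "t < B ^ n" "\<forall>p<n. t div B ^ p mod B = z p"
      by auto
    let ?t = "t + z n * B ^ n"
    have "?t < B ^ Suc n"
      using t(1) Suc.prems mult_le_mono1[of "Suc (z n)" B "B ^ n"] by (simp add: Suc_le_eq)
    moreover have "?t div B ^ p mod B = z p" if "p < n" for p
    proof -
      have "B ^ n = B ^ p * (B * B ^ (n - Suc p))"
        using that by (simp flip: power_add power_Suc)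
      then have "?t = t + B ^ p * (B * (B ^ (n - Suc p) * z n))"
        by (simp add: mult_ac)
      moreover have "B ^ p \<noteq> 0"
        using t(1) that by (cases "B = 0") (simp_all add: power_0_left)
      moreover have "(t + B ^ p * x) div B ^ p = x + t div B ^ p" if "B ^ p \<noteq> 0" for x
        using that by simp
      ultimately have "?t div B ^ p = B * (B ^ (n - Suc p) * z n) + t div B ^ p"
        by metis
      then show ?thesis
        using t(2) that by simp
    qed
    moreover have "?t div B ^ n = z n"
      by (rule div_nat_eqI) (use t(1) in \<open>simp_all add: algebra_simps\<close>)
    then have "?t div B ^ n mod B = z n"
      using Suc.prems by simp
    ultimately show ?case
      by (intro exI[of _ ?t]) (auto simp: less_Suc_eq)
  qed simp
  then show ?thesis
    by (auto simp: digits_def)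
qed

text \<open>Register 2 is the carry: set at the outset to add 1, cleared at the first cell that does
  not wrap around to 0. If it survives the last cell, the counter has overflowed.\<close>

definition tick_all :: "'a com" where
  "tick_all = Inc 2 ;;
     nest [4, 4, 4] 5 (Cond (Zero 2) Skip (Tick ;; Cond (Work (\<lambda>a. a = 0)) Skip (Dec 2)) ;; Inc 1) ;;
     nest [4, 4, 4] 5 (Dec 1)"

text \<open>\<open>B ^ i dvd Suc t\<close> means that the \<open>i\<close> lowest digits of
  \<open>t\<close> all equal \<open>B - 1\<close>, that is, a carry enters digit
  \<open>i\<close>.\<close>

lemma digit_Suc:
  assumes "0 < B" "B ^ i dvd Suc t"
  shows "Suc (t div B ^ i mod B) mod B = Suc t div B ^ i mod B"
    "B ^ Suc i dvd Suc t \<longleftrightarrow> Suc t div B ^ i mod B = 0"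
proof -
  obtain q where q: "Suc t = B ^ i * q"
    using assms(2) by blast
  then obtain q' where q': "q = Suc q'"
    by (cases q) simp_all
  have "0 < B ^ i"
    using assms(1) by simp
  then have "B ^ i * q' \<le> t" "t < B ^ i * Suc q'"
    using q unfolding q' mult_Suc_right by linarith+
  then have "t div B ^ i = q'"
    by (rule div_nat_eqI)
  moreover have "Suc t div B ^ i = q"
    using q assms(1) by simp
  ultimately show "Suc (t div B ^ i mod B) mod B = Suc t div B ^ i mod B"
    by (simp add: q' mod_Suc_eq)
  show "B ^ Suc i dvd Suc t \<longleftrightarrow> Suc t div B ^ i mod B = 0"
    using assms(1) \<open>Suc t div B ^ i = q\<close> by (simp add: q dvd_eq_mod_eq_0 mult.commute[of B])
qed

lemma exec_tick_all:
  assumes S: "S \<le> m" "S * S * S \<le> m" "1 \<le> m" "0 < B"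
    and v: "v 1 = 0" "v 2 = 0" "v 3 = 0" "v 4 = S" "v 5 = 0" "v 6 = 0" "v 7 = 0"
  defines "n \<equiv> S * S * S"
  shows "exec u B m tick_all (v, digits B n t) (v(2 := of_bool (B ^ n dvd Suc t)), digits B n (Suc t))"
proof -
  \<comment> \<open>After \<open>i\<close> cells the digits below \<open>i\<close> are those of
    \<open>Suc t\<close>, the remaining ones still those of \<open>t\<close>, and register 2 is the
    carry into digit \<open>i\<close>.\<close>
  let ?g = "\<lambda>i. (v(1 := i, 2 := of_bool (B ^ i dvd Suc t)), \<lambda>p. digits B n (if p < i then Suc t else t) p)"
  let ?h = "\<lambda>i. (v(1 := n - i, 2 := of_bool (B ^ n dvd Suc t)), digits B n (Suc t))"
  let ?c = "Cond (Zero 2) Skip (Tick ;; Cond (Work (\<lambda>a. a = 0)) Skip (Dec 2)) ;; Inc 1"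
  have 2: "exec u B m (nest [4, 4, 4] 5 ?c) (?g 0) (?g (0 + prod_list (map v [4, 4, 4])))"
  proof (rule exec_nest[where g = ?g and n = n])
    fix w i
    assume i: "i < n"
    define V where "V b = fst (overlay w (v(1 := i, 2 := of_bool b), \<lambda>_. 0))" for b
    define Z where "Z j = (\<lambda>p. digits B n (if p < j then Suc t else t) p)" for j
    have V: "(V b)(2 := 0) = V False" "V b 2 = of_bool b" "V b 1 = i" "V b (Suc 0) = i" for b
      by (auto simp: V_def overlay_def fun_eq_iff)
    have "exec u B m (Cond (Zero 2) Skip (Tick ;; Cond (Work (\<lambda>a. a = 0)) Skip (Dec 2)))
        (V (B ^ i dvd Suc t), Z i) (V (B ^ Suc i dvd Suc t), Z (Suc i))"
    proof (cases "B ^ i dvd Suc t")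
      case True
      have z: "(Z i)(i := Suc (Z i i) mod B) = Z (Suc i)"
        using digit_Suc(1)[OF S(4) True] i by (auto simp: Z_def digits_def fun_eq_iff less_Suc_eq)
      have carry: "Z (Suc i) i = 0 \<longleftrightarrow> B ^ Suc i dvd Suc t"
        using digit_Suc(2)[OF S(4) True] i by (simp add: Z_def digits_def)
      have 1: "exec u B m (Cond (Work (\<lambda>a. a = 0)) Skip (Dec 2)) (V True, Z (Suc i)) (V (B ^ Suc i dvd Suc t), Z (Suc i))"
      proof (cases "B ^ Suc i dvd Suc t")
        case True
        then show ?thesis
          using carry by (intro exec_Cond_True exec_SkipI) (simp_all add: V)
      next
        case False
        then show ?thesis
          using carry by (intro exec_Cond_False exec_DecI) (simp_all add: V)
      qed
      have "exec u B m Tick (V True, Z i) (V True, Z (Suc i))"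
        using exec.Tick[of u B m "V True" "Z i"] unfolding V(3) z .
      then have "exec u B m (Tick ;; Cond (Work (\<lambda>a. a = 0)) Skip (Dec 2)) (V True, Z i) (V (B ^ Suc i dvd Suc t), Z (Suc i))"
        using 1 by (rule exec.Seq)
      then show ?thesis
        using True by (intro exec_Cond_False) (simp_all add: V)
    next
      case False
      then have "Suc t div B ^ i = t div B ^ i"
        by (auto simp: div_Suc dvd_eq_mod_eq_0)
      then have "Z i = Z (Suc i)"
        by (auto simp: Z_def digits_def fun_eq_iff less_Suc_eq)
      moreover have "\<not> B ^ Suc i dvd Suc t"
        using False power_le_dvd[of B "Suc i" "Suc t" i] by auto
      ultimately show ?thesis
        using False by (intro exec_Cond_True exec_SkipI) (simp_all add: V)
    qed
    moreover have "exec u B m (Inc 1) (V b, Z (Suc i)) ((V b)(1 := Suc i), Z (Suc i))" for b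
      by (rule exec_IncI) (use i S V in \<open>auto simp: n_def\<close>)
    ultimately have "exec u B m ?c (V (B ^ i dvd Suc t), Z i) ((V (B ^ Suc i dvd Suc t))(1 := Suc i), Z (Suc i))"
      by (rule exec.Seq)
    moreover have "overlay w (?g i) = (V (B ^ i dvd Suc t), Z i)"
        "overlay w (?g (Suc i)) = ((V (B ^ Suc i dvd Suc t))(1 := Suc i), Z (Suc i))"
      by (auto simp: overlay_def V_def Z_def fun_eq_iff)
    ultimately show "exec u B m ?c (overlay w (?g i)) (overlay w (?g (Suc i)))"
      by (simp only:)
  qed (use S v in \<open>auto simp: n_def\<close>)
  have 3: "exec u B m (nest [4, 4, 4] 5 (Dec 1)) (?h 0) (?h (0 + prod_list (map v [4, 4, 4])))"
    by (rule exec_nest[where g = ?h and n = n])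
      (use S v in \<open>auto simp: n_def overlay_def fun_eq_iff intro!: exec_DecI\<close>)
  have 1: "exec u B m (Inc 2) (v, digits B n t) (?g 0)"
    by (rule exec_IncI) (use S v in \<open>auto simp: fun_eq_iff\<close>)
  have e: "?g (0 + prod_list (map v [4, 4, 4])) = ?h 0"
      "?h (0 + prod_list (map v [4, 4, 4])) = (v(2 := of_bool (B ^ n dvd Suc t)), digits B n (Suc t))"
    using v by (auto simp: n_def digits_def fun_eq_iff mult.assoc)
  show ?thesis
    unfolding tick_all_def using exec.Seq[OF 1 exec.Seq[OF 2[unfolded e] 3[unfolded e]]] .
qed

text \<open>Register 9 is 1 as long as tables remain, register 8 records success. The enumeration
  continues after a success, because only the overflow leaves the array at zero for the next
  search.\<close>

definition search :: "'a fm \<Rightarrow> 'a com" where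
  "search \<phi> = Inc 9 ;;
     Until (Zero 9) (compile 0 \<phi> ;; Cond (Zero 2) Skip (Dec 2 ;; Cond (Zero 8) (Inc 8) Skip) ;;
       tick_all ;; Cond (Zero 2) Skip (Dec 2 ;; Dec 9)) ;;
     Cond (Zero 8) Skip (Dec 8 ;; Inc 2)"

definition witness :: "nat \<Rightarrow> nat \<Rightarrow> 'a list \<Rightarrow> 'a fm \<Rightarrow> bool" where
  "witness B S u \<phi> \<longleftrightarrow> (\<exists>z. (\<forall>p. z p < B) \<and> fsat S u z 0 (\<lambda>_. 0) \<phi>)"

lemma witness_digits:
  assumes "fm_ok 0 \<phi>" "0 < B"
  shows "witness B S u \<phi> \<longleftrightarrow> (\<exists>t < B ^ (S * S * S). fsat S u (digits B (S * S * S) t) 0 (\<lambda>_. 0) \<phi>)"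
proof
  assume "witness B S u \<phi>"
  then obtain z where z: "\<forall>p. z p < B" "fsat S u z 0 (\<lambda>_. 0) \<phi>"
    unfolding witness_def by blast
  then obtain t where t: "t < B ^ (S * S * S)" "\<forall>p<S * S * S. digits B (S * S * S) t p = z p"
    using digits_surj by blast
  then have "fsat S u (digits B (S * S * S) t) 0 (\<lambda>_. 0) \<phi>"
    using fsat_cong[OF assms(1), of "\<lambda>_. 0" S z "digits B (S * S * S) t" u] z(2) by simp
  with t(1) show "\<exists>t < B ^ (S * S * S). fsat S u (digits B (S * S * S) t) 0 (\<lambda>_. 0) \<phi>"
    by blast
next
  have "digits B (S * S * S) t p < B" for t p
    using assms(2) by (simp add: digits_def)
  then show "\<exists>t < B ^ (S * S * S). fsat S u (digits B (S * S * S) t) 0 (\<lambda>_. 0) \<phi> \<Longrightarrow> witness B S u \<phi>"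
    unfolding witness_def by blast
qed

lemma exec_search:
  assumes S: "S \<le> m" "S * S * S \<le> m" "1 \<le> m" "0 < B" and \<phi>: "fm_ok 0 \<phi>"
    and v: "v 4 = S" "\<And>r. r \<noteq> 4 \<Longrightarrow> r \<noteq> 10 \<Longrightarrow> v r = 0"
  shows "exec u B m (search \<phi>) (v, \<lambda>_. 0) (v(2 := of_bool (witness B S u \<phi>)), \<lambda>_. 0)"
proof -
  define n where "n = S * S * S"
  define H where "H t = fsat S u (digits B n t) 0 (\<lambda>_. 0) \<phi>" for t
  let ?N = "B ^ n"
  let ?v = "\<lambda>i j. v(8 := of_bool (\<exists>t<i. H t), 9 := of_bool (j < ?N))"
  let ?g = "\<lambda>i. (?v i i, digits B n i)"
  let ?c = "compile 0 \<phi> ;; Cond (Zero 2) Skip (Dec 2 ;; Cond (Zero 8) (Inc 8) Skip) ;;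
       tick_all ;; Cond (Zero 2) Skip (Dec 2 ;; Dec 9)"
  have "exec u B m (Until (Zero 9) ?c) (?g 0) (?g ?N)"
  proof (rule exec_Until_iterate)
    fix i
    assume i: "i < ?N"
    have "exec u B m (compile 0 \<phi>) (?v i i, digits B n i) ((?v i i)(2 := of_bool (H i)), digits B n i)"
      unfolding H_def by (rule exec_compile[OF S(1-3) \<phi>]) (use v in \<open>auto simp: clean_def\<close>)
    moreover have "exec u B m (Cond (Zero 2) Skip (Dec 2 ;; Cond (Zero 8) (Inc 8) Skip))
        ((?v i i)(2 := of_bool (H i)), digits B n i) (?v (Suc i) i, digits B n i)"
    proof (cases "H i")
      case True
      have 1: "exec u B m (Dec 2) ((?v i i)(2 := of_bool (H i)), digits B n i) (?v i i, digits B n i)"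
        by (rule exec_DecI) (use v True in \<open>auto simp: fun_eq_iff\<close>)
      have 2: "exec u B m (Cond (Zero 8) (Inc 8) Skip) (?v i i, digits B n i) (?v (Suc i) i, digits B n i)"
        by (rule exec.Cond) (use v True S in \<open>auto simp: fun_eq_iff less_Suc_eq intro!: exec_SkipI exec_IncI\<close>)
      show ?thesis
        by (rule exec_Cond_False[OF _ exec.Seq[OF 1 2]]) (simp add: True)
    next
      case False
      then show ?thesis
        using v by (intro exec_Cond_True exec_SkipI) (auto simp: fun_eq_iff less_Suc_eq)
    qed
    moreover have "exec u B m tick_all (?v (Suc i) i, digits B n i)
        ((?v (Suc i) i)(2 := of_bool (?N dvd Suc i)), digits B n (Suc i))"
      unfolding n_def by (rule exec_tick_all) (use S v in auto)
    moreover have "exec u B m (Cond (Zero 2) Skip (Dec 2 ;; Dec 9))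
        ((?v (Suc i) i)(2 := of_bool (?N dvd Suc i)), digits B n (Suc i)) (?g (Suc i))"
    proof (cases "?N dvd Suc i")
      case True
      then have last: "Suc i = ?N"
        using i by (auto dest: dvd_imp_le)
      have 1: "exec u B m (Dec 2) ((?v (Suc i) i)(2 := of_bool (?N dvd Suc i)), digits B n (Suc i))
          (?v (Suc i) i, digits B n (Suc i))"
        by (rule exec_DecI) (use v True in \<open>auto simp: fun_eq_iff\<close>)
      have 2: "exec u B m (Dec 9) (?v (Suc i) i, digits B n (Suc i)) (?v (Suc i) (Suc i), digits B n (Suc i))"
        by (rule exec_DecI) (use i last in \<open>auto simp: fun_eq_iff\<close>)
      show ?thesis
        by (rule exec_Cond_False[OF _ exec.Seq[OF 1 2]]) (simp add: True)
    next
      case False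
      then have "Suc i < ?N"
        using i by (cases "Suc i = ?N") auto
      then show ?thesis
        using v False i by (intro exec_Cond_True exec_SkipI) (auto simp: fun_eq_iff)
    qed
    ultimately show "exec u B m ?c (?g i) (?g (Suc i))"
      by (meson exec.Seq)
  qed auto
  moreover have "exec u B m (Inc 9) (v, \<lambda>_. 0) (?g 0)"
    by (rule exec_IncI) (use S v in \<open>auto simp: fun_eq_iff digits_def\<close>)
  moreover have "exec u B m (Cond (Zero 8) Skip (Dec 8 ;; Inc 2)) (?g ?N) (v(2 := of_bool (witness B S u \<phi>)), \<lambda>_. 0)"
  proof -
    have 1: "witness B S u \<phi> \<longleftrightarrow> (\<exists>t<?N. H t)"
      unfolding witness_digits[OF \<phi> S(4)] n_def H_def by simp
    \<comment> \<open>At the count \<open>B ^ n\<close> all digits vanish: the zero table is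
      back.\<close>
    have "?N div B ^ p mod B = 0" if "p < n" for p
    proof -
      have "?N = B ^ p * (B * B ^ (n - Suc p))"
        using that by (simp flip: power_add power_Suc)
      then show ?thesis using S(4) by simp
    qed
    then have 2: "?g ?N = (v(8 := of_bool (witness B S u \<phi>), 9 := 0), \<lambda>_. 0)"
      unfolding 1 by (auto simp: digits_def fun_eq_iff)
    have 3: "exec u B m (Dec 8) (v(8 := 1, 9 := 0), \<lambda>_. 0) (v, \<lambda>_. 0)"
      by (rule exec_DecI) (use v in \<open>auto simp: fun_eq_iff\<close>)
    have 4: "exec u B m (Inc 2) (v, \<lambda>_. 0) (v(2 := 1), \<lambda>_. 0)"
      by (rule exec_IncI) (use v S in \<open>auto simp: fun_eq_iff\<close>)
    show ?thesis
    proof (cases "witness B S u \<phi>")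
      case True
      then show ?thesis
        unfolding 2 using exec.Seq[OF 3 4] by (intro exec_Cond_False) simp_all
    next
      case False
      then show ?thesis
        unfolding 2 using v by (intro exec_Cond_True exec_SkipI) (auto simp: fun_eq_iff)
    qed
  qed
  ultimately show ?thesis
    unfolding search_def by (meson exec.Seq)
qed

text \<open>Register 10 keeps the loop going. \<open>\<psi>\<close> is consulted only where
  \<open>\<phi>\<close> fails, and its success resets register 2, so the final content of 2 answers
  for \<open>\<phi>\<close>.\<close>

definition decide :: "'a fm \<Rightarrow> 'a fm \<Rightarrow> 'a com" where
  "decide \<phi> \<psi> = Inc 10 ;; Until (Zero 10) (Inc 4 ;; search \<phi> ;;
     Cond (Zero 2) (search \<psi> ;; Cond (Zero 2) Skip (Dec 2 ;; Dec 10)) (Dec 10))"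

text \<open>Sizes are tried in increasing order, so the heads never leave the region of the size at
  which the loop ends; no bound has to be known in advance.\<close>

lemma exec_decide:
  assumes \<phi>: "fm_ok 0 \<phi>" and \<psi>: "fm_ok 0 \<psi>" and B: "0 < B" and S: "1 \<le> S"
    and before: "\<And>i. 1 \<le> i \<Longrightarrow> i < S \<Longrightarrow> \<not> witness B i u \<phi> \<and> \<not> witness B i u \<psi>"
    and last: "witness B S u \<phi> \<or> witness B S u \<psi>"
  shows "\<exists>v z. exec u B (S * S * S) (decide \<phi> \<psi>) (\<lambda>_. 0, \<lambda>_. 0) (v, z) \<and> (v 2 \<noteq> 0 \<longleftrightarrow> witness B S u \<phi>)"
proof -
  let ?m = "S * S * S"
  let ?z = "\<lambda>_ :: nat. 0 :: nat"
  let ?v = "\<lambda>i j b. (\<lambda>_. 0)(4 := i, 10 := of_bool (j < S), 2 := of_bool b)"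
  let ?g = "\<lambda>i. (?v i i (i = S \<and> witness B S u \<phi>), ?z)"
  let ?c = "Inc 4 ;; search \<phi> ;; Cond (Zero 2) (search \<psi> ;; Cond (Zero 2) Skip (Dec 2 ;; Dec 10)) (Dec 10)"
  have m: "S \<le> ?m" "1 \<le> ?m"
    using S mult_le_mono2[of 1 "S * S" S] mult_le_mono[of 1 S 1 S] by (simp_all add: mult.assoc)
  have "exec u B ?m (Until (Zero 10) ?c) (?g 0) (?g S)"
  proof (rule exec_Until_iterate)
    fix i
    assume i: "i < S"
    let ?a = "witness B (Suc i) u \<phi>" and ?b = "witness B (Suc i) u \<psi>"
    have le: "Suc i \<le> ?m" "Suc i * Suc i * Suc i \<le> ?m"
      using i m mult_le_mono[OF mult_le_mono[of "Suc i" S "Suc i" S] , of "Suc i" S] by linarith+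
    have 1: "exec u B ?m (Inc 4) (?g i) (?v (Suc i) i False, ?z)"
      by (rule exec_IncI) (use i less_le_trans[OF i m(1)] in \<open>auto simp: fun_eq_iff\<close>)
    have "exec u B ?m (search \<phi>) (?v (Suc i) i False, ?z) ((?v (Suc i) i False)(2 := of_bool ?a), ?z)"
      by (rule exec_search[OF le m(2) B \<phi>]) auto
    then have 2: "exec u B ?m (search \<phi>) (?v (Suc i) i False, ?z) (?v (Suc i) i ?a, ?z)"
      by simp
    have "exec u B ?m (search \<psi>) (?v (Suc i) i False, ?z) ((?v (Suc i) i False)(2 := of_bool ?b), ?z)"
      by (rule exec_search[OF le m(2) B \<psi>]) auto
    then have 3: "exec u B ?m (search \<psi>) (?v (Suc i) i False, ?z) (?v (Suc i) i ?b, ?z)"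
      by simp
    have 4: "exec u B ?m (Dec 2) (?v (Suc i) i True, ?z) (?v (Suc i) i False, ?z)"
      by (rule exec_DecI) (auto simp: fun_eq_iff)
    have 5: "exec u B ?m (Dec 10) (?v (Suc i) i b, ?z) (?v (Suc i) S b, ?z)" for b
      by (rule exec_DecI) (use i in \<open>auto simp: fun_eq_iff\<close>)
    have "exec u B ?m (Cond (Zero 2) (search \<psi> ;; Cond (Zero 2) Skip (Dec 2 ;; Dec 10)) (Dec 10))
        (?v (Suc i) i ?a, ?z) (?g (Suc i))"
    proof (cases "Suc i < S")
      case True
      then have ab: "\<not> ?a" "\<not> ?b"
        using before[of "Suc i"] by auto
      have "exec u B ?m (Cond (Zero 2) Skip (Dec 2 ;; Dec 10)) (?v (Suc i) i ?b, ?z) (?g (Suc i))"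
        by (rule exec.Cond) (use ab True i in \<open>auto simp: fun_eq_iff intro!: exec_SkipI\<close>)
      then show ?thesis
        using exec.Seq[OF 3] ab by (intro exec.Cond) simp
    next
      case False
      then have iS: "Suc i = S"
        using i by simp
      show ?thesis
      proof (cases ?a)
        case True
        have "exec u B ?m (Dec 10) (?v (Suc i) i True, ?z) (?g (Suc i))"
          using 5[of True] True iS by simp
        then show ?thesis
          using True by (intro exec.Cond) simp
      next
        case nota: False
        then have ?b
          using last iS by simp
        have "exec u B ?m (Dec 2 ;; Dec 10) (?v (Suc i) i True, ?z) (?g (Suc i))"
          using exec.Seq[OF 4 5[of False]] nota iS by simp
        then have "exec u B ?m (Cond (Zero 2) Skip (Dec 2 ;; Dec 10)) (?v (Suc i) i ?b, ?z) (?g (Suc i))"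
          using \<open>?b\<close> by (intro exec.Cond) simp
        then show ?thesis
          using exec.Seq[OF 3] nota by (intro exec.Cond) simp
      qed
    qed
    with 1 2 show "exec u B ?m ?c (?g i) (?g (Suc i))"
      by (meson exec.Seq)
  qed auto
  moreover have "exec u B ?m (Inc 10) (\<lambda>_. 0, ?z) (?g 0)"
    by (rule exec_IncI) (use S m in \<open>auto simp: fun_eq_iff\<close>)
  ultimately have "exec u B ?m (decide \<phi> \<psi>) (\<lambda>_. 0, ?z) (?g S)"
    unfolding decide_def by (meson exec.Seq)
  then show ?thesis
    by (intro exI[of _ "fst (?g S)"] exI[of _ ?z]) simp
qed

section \<open>Finiteness of the number of registers\<close>

lemma test_ok_mono: "test_ok K b \<Longrightarrow> K \<le> K' \<Longrightarrow> test_ok K' b"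
  by (cases b) auto

lemma com_ok_mono: "com_ok K c \<Longrightarrow> K \<le> K' \<Longrightarrow> com_ok K' c"
  by (induction c) (auto intro: test_ok_mono)

definition bounded_com :: "'a com \<Rightarrow> bool" where
  "bounded_com c \<longleftrightarrow> (\<exists>K. com_ok K c)"

definition bounded_test :: "'a test \<Rightarrow> bool" where
  "bounded_test b \<longleftrightarrow> (\<exists>K. test_ok K b)"

lemma bounded_test_simps [simp]: "bounded_test (Zero j) \<longleftrightarrow> 2 \<le> j" "bounded_test (Work P)" "bounded_test (Inp Q)"
  by (auto simp: bounded_test_def)

lemma bounded_com_simps [simp]:
  "bounded_com Skip" "bounded_com (Inc j)" "bounded_com (Dec j)" "bounded_com Tick"
  "bounded_com c \<Longrightarrow> bounded_com d \<Longrightarrow> bounded_com (c ;; d)"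
  "bounded_test b \<Longrightarrow> bounded_com c \<Longrightarrow> bounded_com d \<Longrightarrow> bounded_com (Cond b c d)"
  "bounded_test b \<Longrightarrow> bounded_com c \<Longrightarrow> bounded_com (Until b c)"
proof -
  show "bounded_com Skip" "bounded_com (Inc j)" "bounded_com (Dec j)" "bounded_com Tick"
    by (auto simp: bounded_com_def)
  show "bounded_com c \<Longrightarrow> bounded_com d \<Longrightarrow> bounded_com (c ;; d)"
  proof -
    assume "bounded_com c" "bounded_com d"
    then obtain K1 K2 where "com_ok K1 c" "com_ok K2 d"
      unfolding bounded_com_def by blast
    then have "com_ok (K1 + K2) (c ;; d)"
      using com_ok_mono[of K1 c "K1 + K2"] com_ok_mono[of K2 d "K1 + K2"] by simp
    then show ?thesis
      unfolding bounded_com_def by blast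
  qed
  show "bounded_test b \<Longrightarrow> bounded_com c \<Longrightarrow> bounded_com d \<Longrightarrow> bounded_com (Cond b c d)"
  proof -
    assume "bounded_test b" "bounded_com c" "bounded_com d"
    then obtain K1 K2 K3 where "test_ok K1 b" "com_ok K2 c" "com_ok K3 d"
      unfolding bounded_com_def bounded_test_def by blast
    then have "com_ok (K1 + K2 + K3) (Cond b c d)"
      using test_ok_mono[of K1 b "K1 + K2 + K3"] com_ok_mono[of K2 c "K1 + K2 + K3"]
        com_ok_mono[of K3 d "K1 + K2 + K3"] by simp
    then show ?thesis
      unfolding bounded_com_def by blast
  qed
  show "bounded_test b \<Longrightarrow> bounded_com c \<Longrightarrow> bounded_com (Until b c)"
  proof -
    assume "bounded_test b" "bounded_com c"
    then obtain K1 K2 where "test_ok K1 b" "com_ok K2 c"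
      unfolding bounded_com_def bounded_test_def by blast
    then have "com_ok (K1 + K2) (Until b c)"
      using test_ok_mono[of K1 b "K1 + K2"] com_ok_mono[of K2 c "K1 + K2"] by simp
    then show ?thesis
      unfolding bounded_com_def by blast
  qed
qed

lemma bounded_repeat: "2 \<le> y \<Longrightarrow> 2 \<le> t \<Longrightarrow> bounded_com c \<Longrightarrow> bounded_com (repeat y t c)"
  by (simp add: repeat_def copy_def)

lemma bounded_nest: "\<forall>y \<in> set ys. 2 \<le> y \<Longrightarrow> 2 \<le> t \<Longrightarrow> bounded_com c \<Longrightarrow> bounded_com (nest ys t c)"
  by (induction ys arbitrary: t) (simp_all add: bounded_repeat)

lemma two_le_var_loop: "2 \<le> var i" "2 \<le> loop i"
  by (simp_all add: var_def loop_def)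

lemma bounded_compile: "bounded_com (compile d \<phi>)"
  by (induction \<phi> arbitrary: d)
    (simp_all add: bounded_repeat bounded_nest two_le_var_loop clear_def walk_def del: nest.simps)

lemma bounded_decide: "bounded_com (decide \<phi> \<psi>)"
  by (simp add: decide_def search_def tick_all_def bounded_compile bounded_nest del: nest.simps)

text \<open>\<open>K\<close> is obtained before the language and the space bound are chosen: it
  depends on the formulas only, and the bound may be defined from it.\<close>

theorem decides_in_space_formula:
  fixes \<phi> \<psi> :: "'a::finite fm"
  assumes "fm_ok 0 \<phi>" "fm_ok 0 \<psi>" "0 < B"
  obtains K :: nat where "\<And>L s. (\<And>u. \<exists>S. 1 \<le> S \<and>
      (\<forall>i. 1 \<le> i \<longrightarrow> i < S \<longrightarrow> \<not> witness B i u \<phi> \<and> \<not> witness B i u \<psi>) \<and>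
      (witness B S u \<phi> \<or> witness B S u \<psi>) \<and> (u \<in> L \<longleftrightarrow> witness B S u \<phi>) \<and>
      K * (S * S * S + 1) \<le> s (length u)) \<Longrightarrow> \<exists>M. turing_machine M \<and> decides_in_space M L s"
proof -
  obtain K where K: "com_ok K (decide \<phi> \<psi>)"
    using bounded_decide unfolding bounded_com_def by blast
  let ?K = "K + 3"
  have K': "com_ok ?K (decide \<phi> \<psi>)" "3 \<le> ?K"
    using com_ok_mono[OF K] by simp_all
  show ?thesis
  proof (rule that[of ?K])
    fix L and s :: "nat \<Rightarrow> nat"
    assume *: "\<exists>S. 1 \<le> S \<and>
      (\<forall>i. 1 \<le> i \<longrightarrow> i < S \<longrightarrow> \<not> witness B i u \<phi> \<and> \<not> witness B i u \<psi>) \<and>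
      (witness B S u \<phi> \<or> witness B S u \<psi>) \<and> (u \<in> L \<longleftrightarrow> witness B S u \<phi>) \<and>
      ?K * (S * S * S + 1) \<le> s (length u)" for u
    show "\<exists>M. turing_machine M \<and> decides_in_space M L s"
    proof (rule decides_in_space_program[OF K' assms(3)])
      fix u
      obtain S where S: "1 \<le> S"
        "\<And>i. 1 \<le> i \<Longrightarrow> i < S \<Longrightarrow> \<not> witness B i u \<phi> \<and> \<not> witness B i u \<psi>"
        "witness B S u \<phi> \<or> witness B S u \<psi>" "u \<in> L \<longleftrightarrow> witness B S u \<phi>"
        "?K * (S * S * S + 1) \<le> s (length u)"
        using *[of u] by metis
      obtain v z where "exec u B (S * S * S) (decide \<phi> \<psi>) (\<lambda>_. 0, \<lambda>_. 0) (v, z)"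
        "v 2 \<noteq> 0 \<longleftrightarrow> witness B S u \<phi>"
        using exec_decide[OF assms S(1-3)] by blast
      with S(4,5) show "\<exists>m v z. exec u B m (decide \<phi> \<psi>) (\<lambda>_. 0, \<lambda>_. 0) (v, z) \<and>
          (v 2 \<noteq> 0 \<longleftrightarrow> u \<in> L) \<and> ?K * (m + 1) \<le> s (length u)"
        by blast
    qed
  qed
qed

section \<open>Definable properties of tables\<close>

type_synonym 'l table = "'l \<Rightarrow> nat \<Rightarrow> nat \<Rightarrow> nat \<Rightarrow> bool"

text \<open>A cell stores the whole set of labels that hold at its triple, coded by a number below
  \<open>B\<close>; all relations thereby share one array.\<close>

locale labelling =
  fixes \<Lambda> :: "'l set" and dec :: "nat \<Rightarrow> 'l set" and B :: nat
  assumes dec_surj: "X \<subseteq> \<Lambda> \<Longrightarrow> \<exists>a<B. dec a = X"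
begin

definition agree :: "nat \<Rightarrow> (nat \<Rightarrow> nat) \<Rightarrow> 'l table \<Rightarrow> bool" where
  "agree S z R \<longleftrightarrow> (\<forall>l \<in> \<Lambda>. \<forall>x<S. \<forall>y<S. \<forall>w<S. R l x y w \<longleftrightarrow> l \<in> dec (z (x * S * S + y * S + w)))"

definition expresses :: "nat \<Rightarrow> 'a fm \<Rightarrow> (nat \<Rightarrow> 'a list \<Rightarrow> 'l table \<Rightarrow> (nat \<Rightarrow> nat) \<Rightarrow> bool) \<Rightarrow> bool" where
  "expresses d \<phi> P \<longleftrightarrow> fm_ok d \<phi> \<and>
     (\<forall>S u z R e. agree S z R \<longrightarrow> (\<forall>i<d. e i < S) \<longrightarrow> fsat S u z d e \<phi> = P S u R e)"

text \<open>A shallow embedding: properties stay ordinary predicates and closure rules provide the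
  formula, so no formula with de Bruijn levels is ever written out.\<close>

definition definable :: "nat \<Rightarrow> (nat \<Rightarrow> 'a list \<Rightarrow> 'l table \<Rightarrow> (nat \<Rightarrow> nat) \<Rightarrow> bool) \<Rightarrow> bool" where
  "definable d P \<longleftrightarrow> (\<exists>\<phi>. expresses d \<phi> P)"

lemma definable_cong:
  assumes "definable d P" "\<And>S u R e. \<forall>i<d. e i < S \<Longrightarrow> P S u R e = Q S u R e"
  shows "definable d Q"
proof -
  obtain \<phi> where "expresses d \<phi> P"
    using assms(1) unfolding definable_def by blast
  then have "expresses d \<phi> Q"
    unfolding expresses_def using assms(2) by simp
  then show ?thesis
    unfolding definable_def by blast
qed

lemma definable_le: "i < d \<Longrightarrow> j < d \<Longrightarrow> definable d (\<lambda>S u R e. e i \<le> e j)"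
  unfolding definable_def expresses_def by (rule exI[of _ "FLe i j"]) simp

lemma definable_letter: "i < d \<Longrightarrow> definable d (\<lambda>S u R e. letter_at u (e i) \<in> X)"
  unfolding definable_def expresses_def by (rule exI[of _ "FInp (\<lambda>a. a \<in> X) i"]) simp

lemma definable_table:
  "l \<in> \<Lambda> \<Longrightarrow> i < d \<Longrightarrow> j < d \<Longrightarrow> k < d \<Longrightarrow> definable d (\<lambda>S u R e. R l (e i) (e j) (e k))"
  unfolding definable_def expresses_def
  by (rule exI[of _ "FCell (\<lambda>a. l \<in> dec a) i j k"]) (simp add: agree_def)

lemma definable_not: "definable d P \<Longrightarrow> definable d (\<lambda>S u R e. \<not> P S u R e)"
  unfolding definable_def expresses_def by (metis fm_ok.simps(4) fsat.simps(4))

lemma definable_conj: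
  assumes "definable d P" "definable d Q"
  shows "definable d (\<lambda>S u R e. P S u R e \<and> Q S u R e)"
proof -
  obtain \<phi> \<psi> where "expresses d \<phi> P" "expresses d \<psi> Q"
    using assms unfolding definable_def by blast
  then show ?thesis
    unfolding definable_def expresses_def by (intro exI[of _ "FAnd \<phi> \<psi>"]) simp
qed

text \<open>The second premise says that \<open>P\<close> does not read the slot of the bound variable.\<close>

lemma definable_ex:
  assumes "definable (Suc d) (\<lambda>S u R e. P S u R e (e d))"
    and "\<And>S u R e x y. P S u R (e(d := y)) x = P S u R e x"
  shows "definable d (\<lambda>S u R e. \<exists>x<S. P S u R e x)"
proof -
  obtain \<phi> where \<phi>: "expresses (Suc d) \<phi> (\<lambda>S u R e. P S u R e (e d))"
    using assms(1) unfolding definable_def by blast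
  have "expresses d (FEx \<phi>) (\<lambda>S u R e. \<exists>x<S. P S u R e x)"
    unfolding expresses_def
  proof (intro conjI allI impI)
    show "fm_ok d (FEx \<phi>)"
      using \<phi> by (simp add: expresses_def)
    fix S u z R e
    assume "agree S z R" "\<forall>i<d. e i < S"
    then have "fsat S u z (Suc d) (e(d := x)) \<phi> = P S u R (e(d := x)) x" if "x < S" for x
      using \<phi> that unfolding expresses_def by (auto simp: less_Suc_eq)
    then show "fsat S u z d e (FEx \<phi>) = (\<exists>x<S. P S u R e x)"
      by (auto simp: assms(2))
  qed
  then show ?thesis
    unfolding definable_def by blast
qed

lemma definable_disj:
  "definable d P \<Longrightarrow> definable d Q \<Longrightarrow> definable d (\<lambda>S u R e. P S u R e \<or> Q S u R e)"
  by (rule definable_cong[OF definable_not[OF definable_conj[OF definable_not definable_not]]]) simp_all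

lemma definable_iff:
  assumes "definable d P" "definable d Q"
  shows "definable d (\<lambda>S u R e. P S u R e \<longleftrightarrow> Q S u R e)"
  by (rule definable_cong[OF definable_disj[OF definable_conj[OF assms] definable_conj[OF assms[THEN definable_not]]]])
    blast

lemma definable_all:
  assumes "definable (Suc d) (\<lambda>S u R e. P S u R e (e d))"
    and "\<And>S u R e x y. P S u R (e(d := y)) x = P S u R e x"
  shows "definable d (\<lambda>S u R e. \<forall>x<S. P S u R e x)"
proof (rule definable_cong)
  show "definable d (\<lambda>S u R e. \<not> (\<exists>x<S. \<not> P S u R e x))"
    by (intro definable_not definable_ex assms(1)) (simp only: assms(2))
qed simp

lemma definable_less: "i < d \<Longrightarrow> j < d \<Longrightarrow> definable d (\<lambda>S u R e. e i < e j)"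
  by (rule definable_cong[OF definable_not[OF definable_le[of j d i]]]) auto

lemma definable_eq: "i < d \<Longrightarrow> j < d \<Longrightarrow> definable d (\<lambda>S u R e. e i = e j)"
  by (rule definable_cong[OF definable_conj[OF definable_le[of i d j] definable_le[of j d i]]]) auto

lemma definable_zero: "i < d \<Longrightarrow> definable d (\<lambda>S u R e. e i = 0)"
proof (rule definable_cong)
  show "i < d \<Longrightarrow> definable d (\<lambda>S u R e. \<forall>x<S. e i \<le> x)"
    by (intro definable_all definable_le) auto
qed auto

text \<open>The order is the only primitive relation between indices, so successor becomes immediate
  successor. \<open>Suc (e j)\<close> is an index itself, being at most \<open>e i\<close>.\<close>

lemma definable_Suc: "i < d \<Longrightarrow> j < d \<Longrightarrow> definable d (\<lambda>S u R e. e i = Suc (e j))"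
proof (rule definable_cong)
  show "i < d \<Longrightarrow> j < d \<Longrightarrow> definable d (\<lambda>S u R e. e j < e i \<and> (\<forall>x<S. x \<le> e j \<or> e i \<le> x))"
    by (intro definable_all definable_conj definable_disj definable_le definable_less) auto
  show "(e j < e i \<and> (\<forall>x<S. x \<le> e j \<or> e i \<le> x)) = (e i = Suc (e j))"
    if "i < d" "j < d" "\<forall>i<d. e i < S" for S and e :: "nat \<Rightarrow> nat"
  proof
    assume *: "e j < e i \<and> (\<forall>x<S. x \<le> e j \<or> e i \<le> x)"
    then have "Suc (e j) < S"
      using that by (meson Suc_leI le_less_trans)
    then show "e i = Suc (e j)"
      using * by (metis Suc_leI le_antisym not_less_eq_eq order_refl)
  qed auto
qed

lemma definable_const: "definable d (\<lambda>S u R e. b)"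
proof -
  have "definable d (\<lambda>S u R e. \<forall>x<S. x \<le> x)"
    by (intro definable_all definable_le) auto
  then have True: "definable d (\<lambda>S u R e. True)"
    by (rule definable_cong) simp
  show ?thesis
    by (cases b) (use True definable_not[OF True] in simp_all)
qed

lemma definable_ball:
  "finite F \<Longrightarrow> (\<And>c. c \<in> F \<Longrightarrow> definable d (P c)) \<Longrightarrow> definable d (\<lambda>S u R e. \<forall>c \<in> F. P c S u R e)"
proof (induction F rule: finite_induct)
  case empty
  then show ?case using definable_const[of d True] by simp
next
  case (insert c F)
  then show ?case
    using definable_conj[of d "P c" "\<lambda>S u R e. \<forall>c \<in> F. P c S u R e"] by simp
qed

lemma definable_ex_finite:
  fixes P :: "'p::finite \<Rightarrow> nat \<Rightarrow> 'a list \<Rightarrow> 'l table \<Rightarrow> (nat \<Rightarrow> nat) \<Rightarrow> bool"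
  assumes "\<And>c. definable d (P c)"
  shows "definable d (\<lambda>S u R e. \<exists>c. P c S u R e)"
  by (rule definable_cong[OF definable_not[OF definable_ball[of UNIV d "\<lambda>c S u R e. \<not> P c S u R e"]]])
    (simp_all add: definable_not assms)

lemmas definable_intros = definable_le definable_letter definable_table definable_not definable_conj
  definable_disj definable_iff definable_ex definable_all definable_less definable_eq definable_zero
  definable_Suc definable_const

lemma table_agrees:
  obtains z where "\<And>p. z p < B" "agree S z R"
proof -
  \<comment> \<open>The cell number is split into its three digits in base S.\<close>
  let ?X = "\<lambda>p. {l \<in> \<Lambda>. R l (p div (S * S)) (p div S mod S) (p mod S)}"
  have "\<forall>p. \<exists>a. a < B \<and> dec a = ?X p"
    by (intro allI dec_surj) auto
  from choice[OF this] obtain z where z: "z p < B" "dec (z p) = ?X p" for p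
    by blast
  have "agree S z R"
    unfolding agree_def
  proof (intro ballI allI impI)
    fix l x y w
    assume l: "l \<in> \<Lambda>" and xyw: "x < S" "y < S" "w < S"
    let ?p = "x * S * S + y * S + w"
    have "?p = (x * S + y) * S + w"
      by (simp add: algebra_simps)
    then have 1: "?p mod S = w" "?p div S = x * S + y"
      using xyw by simp_all
    then have "?p div (S * S) = x" "?p div S mod S = y"
      using xyw by (simp_all add: div_mult2_eq)
    then show "R l x y w = (l \<in> dec (z ?p))"
      using 1 l by (simp add: z)
  qed
  with z show ?thesis
    using that by blast
qed

text \<open>Arrays and tables match on the indices, so a search through arrays amounts to a
  second-order existential quantifier.\<close>

lemma witness_definable:
  assumes "expresses 0 \<phi> P"
  shows "witness B S u \<phi> \<longleftrightarrow> (\<exists>R. P S u R (\<lambda>_. 0))"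
proof
  assume "witness B S u \<phi>"
  then obtain z where "fsat S u z 0 (\<lambda>_. 0) \<phi>"
    unfolding witness_def by blast
  moreover have "agree S z (\<lambda>l x y w. l \<in> dec (z (x * S * S + y * S + w)))"
    by (simp add: agree_def)
  ultimately show "\<exists>R. P S u R (\<lambda>_. 0)"
    using assms unfolding expresses_def by blast
next
  assume "\<exists>R. P S u R (\<lambda>_. 0)"
  then obtain R where R: "P S u R (\<lambda>_. 0)"
    by blast
  obtain z where "\<And>p. z p < B" "agree S z R"
    using table_agrees by blast
  with R show "witness B S u \<phi>"
    using assms unfolding expresses_def witness_def by blast
qed

theorem decides_in_space_definable:
  fixes P Q :: "nat \<Rightarrow> 'a::finite list \<Rightarrow> 'l table \<Rightarrow> (nat \<Rightarrow> nat) \<Rightarrow> bool"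
  assumes "definable 0 P" "definable 0 Q"
  obtains K :: nat where "\<And>L s. (\<And>u. \<exists>S. 1 \<le> S \<and>
      (\<forall>i. 1 \<le> i \<longrightarrow> i < S \<longrightarrow> (\<nexists>R. P i u R (\<lambda>_. 0)) \<and> (\<nexists>R. Q i u R (\<lambda>_. 0))) \<and>
      ((\<exists>R. P S u R (\<lambda>_. 0)) \<or> (\<exists>R. Q S u R (\<lambda>_. 0))) \<and> (u \<in> L \<longleftrightarrow> (\<exists>R. P S u R (\<lambda>_. 0))) \<and>
      K * (S * S * S + 1) \<le> s (length u)) \<Longrightarrow> \<exists>M. turing_machine M \<and> decides_in_space M L s"
proof -
  obtain \<phi> \<psi> where \<phi>: "expresses 0 \<phi> P" and \<psi>: "expresses 0 \<psi> Q"
    using assms unfolding definable_def by blast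
  have B: "0 < B"
    using dec_surj[of "{}"] by auto
  obtain K :: nat where K: "\<And>L s. (\<And>u. \<exists>S. 1 \<le> S \<and>
      (\<forall>i. 1 \<le> i \<longrightarrow> i < S \<longrightarrow> \<not> witness B i u \<phi> \<and> \<not> witness B i u \<psi>) \<and>
      (witness B S u \<phi> \<or> witness B S u \<psi>) \<and> (u \<in> L \<longleftrightarrow> witness B S u \<phi>) \<and>
      K * (S * S * S + 1) \<le> s (length u)) \<Longrightarrow> \<exists>M. turing_machine M \<and> decides_in_space M L s"
    using decides_in_space_formula[of \<phi> \<psi> B] \<phi> \<psi> B unfolding expresses_def by blast
  show ?thesis
    by (rule that[of K], rule K) (simp only: witness_definable[OF \<phi>] witness_definable[OF \<psi>])
qed

end

section \<open>The problem as a second-order formula\<close>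

datatype 'p label =
    Prop 'p | Form | Tree nat | Trees nat | FVal | Val | ValOr | ValSand | ValAnd | Plus | Exp2

definition labels :: "nat \<Rightarrow> 'p label set" where
  "labels k = range Prop \<union> {Form, FVal, Val, ValOr, ValSand, ValAnd, Plus, Exp2} \<union> Tree ` {..k} \<union> Trees ` {..k}"

text \<open>All relations share one ternary table; a binary one repeats its first argument in the third
  place. The function \<open>intended\<close> below gives the meaning of the labels. The equations refer to later
  positions, or to the same position and a label treated before, so that they have only one
  solution once the letters \<open>Prop\<close> are fixed.\<close>

definition form_eq :: "nat \<Rightarrow> 'p letter list \<Rightarrow> 'p label table \<Rightarrow> nat \<Rightarrow> nat \<Rightarrow> bool" where
  "form_eq S u R p q \<longleftrightarrow> (R Form p q p \<longleftrightarrow>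
     letter_at u p \<in> range (\<lambda>a. Some (LAtom a)) \<and> q = Suc p \<or>
     (\<exists>p'<S. p' = Suc p \<and>
       (letter_at u p \<in> {Some LNeg} \<and> R Form p' q p' \<or>
        letter_at u p \<in> {Some LConj, Some LDisj} \<and> (\<exists>r<S. p' < r \<and> R Form p' r p' \<and> R Form r q r))))"

text \<open>\<open>Trees\<close> includes the empty list; the test for \<open>LClose\<close>
  enforces the nonempty argument lists of \<open>ADT\<close>.\<close>

definition tree_eq :: "nat \<Rightarrow> nat \<Rightarrow> 'p letter list \<Rightarrow> 'p label table \<Rightarrow> nat \<Rightarrow> nat \<Rightarrow> bool" where
  "tree_eq c S u R p q \<longleftrightarrow> (R (Tree c) p q p \<longleftrightarrow>
     R Form p q p \<or> letter_at u p \<in> {Some LEps} \<and> q = Suc p \<or>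
     (\<exists>p'<S. p' = Suc p \<and>
       (letter_at u p \<in> {Some LOr, Some LSand, Some LAnd} \<and> \<not> letter_at u p' \<in> {Some LClose} \<and>
          R (Trees c) p' q p' \<or>
        letter_at u p \<in> {Some LC} \<and> 0 < c \<and>
          (\<exists>r<S. p' < r \<and> R (Tree c) p' r p' \<and> R (Tree (c - 1)) r q r))))"

definition trees_eq :: "nat \<Rightarrow> nat \<Rightarrow> 'p letter list \<Rightarrow> 'p label table \<Rightarrow> nat \<Rightarrow> nat \<Rightarrow> bool" where
  "trees_eq c S u R p q \<longleftrightarrow> (R (Trees c) p q p \<longleftrightarrow>
     letter_at u p \<in> {Some LClose} \<and> q = Suc p \<or>
     (\<exists>r<S. p < r \<and> R (Tree c) p r p \<and> R (Trees c) r q r))"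

text \<open>The demands on \<open>Form\<close> guard the negation: where no formula starts,
  \<open>FVal\<close> is false, and its negation must not count as truth.\<close>

definition fval_eq :: "nat \<Rightarrow> 'p letter list \<Rightarrow> 'p label table \<Rightarrow> nat \<Rightarrow> nat \<Rightarrow> bool" where
  "fval_eq S u R p j \<longleftrightarrow> (R FVal p j p \<longleftrightarrow>
     (\<exists>a. letter_at u p \<in> {Some (LAtom a)} \<and> R (Prop a) j j j) \<or>
     (\<exists>p'<S. p' = Suc p \<and>
       (letter_at u p \<in> {Some LNeg} \<and> (\<exists>q<S. R Form p' q p') \<and> \<not> R FVal p' j p' \<or>
        (\<exists>r<S. p' < r \<and> R Form p' r p' \<and> (\<exists>q<S. R Form r q r) \<and>
          (letter_at u p \<in> {Some LConj} \<and> R FVal p' j p' \<and> R FVal r j r \<or>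
           letter_at u p \<in> {Some LDisj} \<and> (R FVal p' j p' \<or> R FVal r j r))))))"

text \<open>Depths are not tracked here, as \<open>Tree k\<close> at the root has checked them for
  all subtrees. \<open>AND\<close> follows its symmetric form: membership in some child, and a
  prefix in each.\<close>

definition val_eq :: "nat \<Rightarrow> nat \<Rightarrow> 'p letter list \<Rightarrow> 'p label table \<Rightarrow> nat \<Rightarrow> nat \<Rightarrow> nat \<Rightarrow> bool" where
  "val_eq k S u R p i j \<longleftrightarrow> (R Val p i j \<longleftrightarrow> i \<le> j \<and>
     (\<exists>q<S. R (Tree k) p q p \<and>
       (R Form p q p \<and> (\<exists>j'<S. j = Suc j' \<and> i \<le> j' \<and> R FVal p j' p) \<or>
        letter_at u p \<in> {Some LEps} \<and> i = j \<or>
        (\<exists>p'<S. p' = Suc p \<and>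
          (letter_at u p \<in> {Some LOr} \<and> R ValOr p' i j \<or>
           letter_at u p \<in> {Some LSand} \<and> R ValSand p' i j \<or>
           letter_at u p \<in> {Some LAnd} \<and> R ValOr p' i j \<and> R ValAnd p' i j \<or>
           letter_at u p \<in> {Some LC} \<and> R Val p' i j \<and>
             (\<exists>r<S. p' < r \<and> R (Tree k) p' r p' \<and> \<not> R Val r i j))))))"

text \<open>The rest of the list has to be demanded explicitly, because a successful first child
  says nothing about what follows it.\<close>

definition or_eq :: "nat \<Rightarrow> nat \<Rightarrow> 'p label table \<Rightarrow> nat \<Rightarrow> nat \<Rightarrow> nat \<Rightarrow> bool" where
  "or_eq k S R p i j \<longleftrightarrow> (R ValOr p i j \<longleftrightarrow> i \<le> j \<and>
     (\<exists>r<S. p < r \<and> R (Tree k) p r p \<and> (\<exists>q<S. R (Trees k) r q r) \<and> (R Val p i j \<or> R ValOr r i j)))"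

definition sand_eq :: "nat \<Rightarrow> nat \<Rightarrow> 'p letter list \<Rightarrow> 'p label table \<Rightarrow> nat \<Rightarrow> nat \<Rightarrow> nat \<Rightarrow> bool" where
  "sand_eq k S u R p i j \<longleftrightarrow> (R ValSand p i j \<longleftrightarrow> i \<le> j \<and>
     (letter_at u p \<in> {Some LClose} \<and> i = j \<or>
      (\<exists>r<S. p < r \<and> R (Tree k) p r p \<and> (\<exists>m<S. R Val p i m \<and> R ValSand r m j))))"

definition and_eq :: "nat \<Rightarrow> nat \<Rightarrow> 'p letter list \<Rightarrow> 'p label table \<Rightarrow> nat \<Rightarrow> nat \<Rightarrow> nat \<Rightarrow> bool" where
  "and_eq k S u R p i j \<longleftrightarrow> (R ValAnd p i j \<longleftrightarrow> i \<le> j \<and>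
     (letter_at u p \<in> {Some LClose} \<or>
      (\<exists>r<S. p < r \<and> R (Tree k) p r p \<and> R ValAnd r i j \<and> (\<exists>m<S. m \<le> j \<and> R Val p i m))))"

definition equations :: "nat \<Rightarrow> nat \<Rightarrow> 'p letter list \<Rightarrow> 'p label table \<Rightarrow> bool" where
  "equations k S u R \<longleftrightarrow> (\<forall>p<S. \<forall>i<S. form_eq S u R p i \<and>
     (\<forall>c \<in> {..k}. tree_eq c S u R p i \<and> trees_eq c S u R p i) \<and> fval_eq S u R p i \<and>
     (\<forall>j<S. val_eq k S u R p i j \<and> or_eq k S R p i j \<and> sand_eq k S u R p i j \<and> and_eq k S u R p i j))"

text \<open>A tree that ends at a position \<open>n\<close> without a letter fills the entire input,
  and \<open>n < S\<close> makes the input fit into the indices. The variable \<open>x\<close>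
  stands in for the constant 0.\<close>

definition accepting :: "nat \<Rightarrow> nat \<Rightarrow> 'p letter list \<Rightarrow> 'p label table \<Rightarrow> bool" where
  "accepting k S u R \<longleftrightarrow> equations k S u R \<and>
     (\<exists>n<S. \<exists>x<S. \<exists>j<S. x = 0 \<and> letter_at u n \<in> {None} \<and> R (Tree k) x n x \<and> R Val x x j)"

text \<open>\<open>stopping\<close> says that the largest index is the \<open>m\<close>-fold exponential of four times the input
  length.\<close>

primrec chain :: "nat \<Rightarrow> nat \<Rightarrow> 'p label table \<Rightarrow> nat \<Rightarrow> bool" where
  "chain 0 S R b \<longleftrightarrow> (\<forall>x<S. x \<le> b)"
| "chain (Suc m) S R b \<longleftrightarrow> (\<exists>y<S. R Exp2 b y b \<and> chain m S R y)"

text \<open>The operations are given by their graphs, so results outside the indices are simply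
  absent and cannot wrap around.\<close>

definition arithmetic :: "nat \<Rightarrow> 'p label table \<Rightarrow> bool" where
  "arithmetic S R \<longleftrightarrow> (\<forall>x<S. \<forall>y<S.
     (\<forall>w<S. R Plus x y w \<longleftrightarrow> y = 0 \<and> w = x \<or> (\<exists>y'<S. \<exists>w'<S. y = Suc y' \<and> w = Suc w' \<and> R Plus x y' w')) \<and>
     (R Exp2 x y x \<longleftrightarrow> x = 0 \<and> (\<exists>w<S. w = 0 \<and> y = Suc w) \<or>
       (\<exists>x'<S. \<exists>y'<S. x = Suc x' \<and> R Exp2 x' y' x' \<and> R Plus y' y' y)))"

definition stopping :: "nat \<Rightarrow> nat \<Rightarrow> 'p letter list \<Rightarrow> 'p label table \<Rightarrow> bool" where
  "stopping m S u R \<longleftrightarrow> arithmetic S R \<and>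
     (\<exists>n<S. letter_at u n \<in> {None} \<and> (n = 0 \<or> (\<exists>n'<S. n = Suc n' \<and> \<not> letter_at u n' \<in> {None})) \<and>
       (\<exists>a<S. R Plus n n a \<and> (\<exists>b<S. R Plus a a b \<and> chain m S R b)))"

section \<open>Definability of the two statements\<close>

locale tree_labelling = labelling "labels k" dec B
  for k :: nat and dec :: "nat \<Rightarrow> 'p::finite label set" and B :: nat
begin

lemma definable_form_eq: "definable 2 (\<lambda>S (u :: 'p letter list) R e. form_eq S u R (e 0) (e 1))"
  unfolding form_eq_def
  by (intro definable_intros definable_ex_finite; (simp add: labels_def)?)

lemma definable_tree_eq:
  assumes "c \<le> k"
  shows "definable 2 (\<lambda>S (u :: 'p letter list) R e. tree_eq c S u R (e 0) (e 1))"
  unfolding tree_eq_def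
  by (intro definable_intros definable_ex_finite; (use assms in \<open>simp add: labels_def\<close>)?)

lemma definable_trees_eq:
  assumes "c \<le> k"
  shows "definable 2 (\<lambda>S (u :: 'p letter list) R e. trees_eq c S u R (e 0) (e 1))"
  unfolding trees_eq_def
  by (intro definable_intros definable_ex_finite; (use assms in \<open>simp add: labels_def\<close>)?)

lemma definable_fval_eq: "definable 2 (\<lambda>S (u :: 'p letter list) R e. fval_eq S u R (e 0) (e 1))"
  unfolding fval_eq_def
  by (intro definable_intros definable_ex_finite; (simp add: labels_def)?)

lemma definable_val_eq: "definable 3 (\<lambda>S (u :: 'p letter list) R e. val_eq k S u R (e 0) (e 1) (e 2))"
  unfolding val_eq_def
  by (intro definable_intros definable_ex_finite; (simp add: labels_def)?)

lemma definable_or_eq: "definable 3 (\<lambda>S (u :: 'p letter list) R e. or_eq k S R (e 0) (e 1) (e 2))"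
  unfolding or_eq_def
  by (intro definable_intros definable_ex_finite; (simp add: labels_def)?)

lemma definable_sand_eq: "definable 3 (\<lambda>S (u :: 'p letter list) R e. sand_eq k S u R (e 0) (e 1) (e 2))"
  unfolding sand_eq_def
  by (intro definable_intros definable_ex_finite; (simp add: labels_def)?)

lemma definable_and_eq: "definable 3 (\<lambda>S (u :: 'p letter list) R e. and_eq k S u R (e 0) (e 1) (e 2))"
  unfolding and_eq_def
  by (intro definable_intros definable_ex_finite; (simp add: labels_def)?)

lemmas definable_eqs = definable_form_eq definable_tree_eq definable_trees_eq definable_fval_eq
  definable_val_eq definable_or_eq definable_sand_eq definable_and_eq

lemma definable_accepting: "definable 0 (\<lambda>S (u :: 'p letter list) R e. accepting k S u R)"
  unfolding accepting_def equations_def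
  by (intro definable_intros definable_ball definable_eqs[unfolded numeral_2_eq_2 numeral_3_eq_3 One_nat_def];
      (simp add: labels_def)?)

lemma definable_chain:
  "i < d \<Longrightarrow> definable d (\<lambda>S u R e. chain m S R (e i))"
proof (induction m arbitrary: d i)
  case 0
  then show ?case
    unfolding chain.simps by (intro definable_all definable_le) auto
next
  case (Suc m)
  then show ?case
    unfolding chain.simps by (intro definable_ex definable_conj definable_table) (auto simp: labels_def)
qed

lemma definable_stopping: "definable 0 (\<lambda>S (u :: 'p letter list) R e. stopping m S u R)"
  unfolding stopping_def arithmetic_def
  by (intro definable_intros definable_chain; (simp add: labels_def)?)

end

section \<open>Recognising the size at which to stop\<close>

lemma arithmeticD:
  assumes "arithmetic S R" "x < S" "y < S"
  shows "w < S \<Longrightarrow> R Plus x y w \<longleftrightarrow> y = 0 \<and> w = x \<or> (\<exists>y'<S. \<exists>w'<S. y = Suc y' \<and> w = Suc w' \<and> R Plus x y' w')"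
    "R Exp2 x y x \<longleftrightarrow> x = 0 \<and> (\<exists>w<S. w = 0 \<and> y = Suc w) \<or>
       (\<exists>x'<S. \<exists>y'<S. x = Suc x' \<and> R Exp2 x' y' x' \<and> R Plus y' y' y)"
  by (rule assms(1)[unfolded arithmetic_def, rule_format, OF assms(2,3), THEN conjunct1, rule_format], assumption,
      rule assms(1)[unfolded arithmetic_def, rule_format, OF assms(2,3), THEN conjunct2])

lemma arithmetic_Plus:
  assumes "arithmetic S R" "x < S"
  shows "y < S \<Longrightarrow> w < S \<Longrightarrow> R Plus x y w \<longleftrightarrow> x + y = w"
proof (induction y arbitrary: w)
  case 0
  then show ?case
    using arithmeticD(1)[OF assms, of 0 w] by auto
next
  case (Suc y)
  have "R Plus x (Suc y) w \<longleftrightarrow> (\<exists>w'<S. w = Suc w' \<and> R Plus x y w')"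
    using arithmeticD(1)[OF assms Suc.prems] Suc_lessD[OF Suc.prems(1)] by auto
  also have "\<dots> \<longleftrightarrow> (\<exists>w'<S. w = Suc w' \<and> x + y = w')"
    using Suc.IH[OF Suc_lessD[OF Suc.prems(1)]] by auto
  finally show ?case
    using Suc.prems by auto
qed

lemma arithmetic_Exp2:
  assumes "arithmetic S R"
  shows "x < S \<Longrightarrow> y < S \<Longrightarrow> R Exp2 x y x \<longleftrightarrow> y = 2 ^ x"
proof (induction x arbitrary: y)
  case 0
  then show ?case
    using arithmeticD(2)[OF assms 0] by auto
next
  case (Suc x)
  have "R Exp2 (Suc x) y (Suc x) \<longleftrightarrow> (\<exists>y'<S. R Exp2 x y' x \<and> R Plus y' y' y)"
    using arithmeticD(2)[OF assms Suc.prems] Suc_lessD[OF Suc.prems(1)] by auto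
  also have "\<dots> \<longleftrightarrow> (\<exists>y'<S. y' = 2 ^ x \<and> y' + y' = y)"
    using Suc.IH[OF Suc_lessD[OF Suc.prems(1)]] arithmetic_Plus[OF assms _ _ Suc.prems(2)] by auto
  finally show ?case
    using Suc.prems by auto
qed

definition intended_arithmetic :: "'p label table" where
  "intended_arithmetic l x y w \<longleftrightarrow> l = Plus \<and> x + y = w \<or> l = Exp2 \<and> y = 2 ^ x"

lemma arithmetic_intended: "arithmetic S intended_arithmetic"
  unfolding arithmetic_def intended_arithmetic_def
proof (intro allI impI conjI, goal_cases)
  case (1 x y w)
  then show ?case by (cases y) auto
next
  case (2 x y)
  then show ?case by (cases x) auto
qed

text \<open>\<open>chain\<close> peels off the innermost exponential,
  \<open>iterated_exp_Suc\<close> the outermost.\<close>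

lemma iterated_exp_shift: "iterated_exp m (2 ^ x) = iterated_exp (Suc m) x"
  by (induction m) simp_all

lemma chain_iff:
  assumes "arithmetic S R"
  shows "b < S \<Longrightarrow> chain m S R b \<longleftrightarrow> S = Suc (iterated_exp m b)"
proof (induction m arbitrary: b)
  case 0
  have "S \<le> Suc b" if "\<forall>x<S. x \<le> b"
    using that[rule_format, of "S - 1"] 0 by linarith
  then show ?case
    using 0 by fastforce
next
  case (Suc m)
  have "chain (Suc m) S R b \<longleftrightarrow> (\<exists>y<S. y = 2 ^ b \<and> S = Suc (iterated_exp m y))"
    using Suc arithmetic_Exp2[OF assms Suc.prems] by auto
  \<comment> \<open>The intermediate value \<open>2 ^ b\<close> is an index because iterated
    exponentiation does not decrease it.\<close>
  also have "\<dots> \<longleftrightarrow> S = Suc (iterated_exp m (2 ^ b))"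
    using le_iterated_exp[of "2 ^ b" m] by auto
  finally show ?case
    unfolding iterated_exp_shift .
qed

lemma letter_at_None: "letter_at u n = None \<longleftrightarrow> length u \<le> n"
  by (auto simp: letter_at_def)

text \<open>Every input, well formed or not, has exactly one such size; this makes the trial of
  sizes terminate.\<close>

lemma stopping_iff:
  fixes u :: "'p letter list"
  shows "(\<exists>R. stopping m S u R) \<longleftrightarrow> S = Suc (iterated_exp m (4 * length u))"
proof
  assume "\<exists>R. stopping m S u R"
  then obtain R :: "'p label table" and n a b where R: "arithmetic S R" and n: "n < S" "letter_at u n = None"
      "n = 0 \<or> (\<exists>n'<S. n = Suc n' \<and> letter_at u n' \<noteq> None)"
    and ab: "a < S" "b < S" "R Plus n n a" "R Plus a a b" "chain m S R b"
    unfolding stopping_def singleton_iff by metis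
  have "n = length u"
    using n(2,3) by (auto simp: letter_at_None)
  moreover have "n + n = a" "a + a = b"
    using arithmetic_Plus[OF R] n ab by auto
  moreover have "S = Suc (iterated_exp m b)"
    using chain_iff[OF R] ab by simp
  moreover from calculation have "b = 4 * length u"
    by linarith
  ultimately show "S = Suc (iterated_exp m (4 * length u))"
    by simp
next
  assume S: "S = Suc (iterated_exp m (4 * length u))"
  let ?n = "length u" and ?R = "intended_arithmetic :: 'p label table"
  have le: "4 * ?n < S"
    using le_iterated_exp[of "4 * ?n" m] S by simp
  have "?R Plus ?n ?n (?n + ?n)" "?R Plus (?n + ?n) (?n + ?n) (4 * ?n)"
    by (simp_all add: intended_arithmetic_def)
  moreover have "chain m S ?R (4 * ?n)"
    by (rule chain_iff[OF arithmetic_intended le, THEN iffD2, OF S])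
  moreover have "?n = 0 \<or> (\<exists>n'<S. ?n = Suc n' \<and> \<not> letter_at u n' \<in> {None})"
    using le by (cases ?n) (auto simp: letter_at_None)
  ultimately have "stopping m S u ?R"
    unfolding stopping_def using le arithmetic_intended
    by (intro conjI exI[of _ ?n] exI[of _ "?n + ?n"] exI[of _ "4 * ?n"]) (simp_all add: letter_at_None)
  then show "\<exists>R. stopping m S u R"
    by (rule exI[of "stopping m S u"])
qed

section \<open>Reading trees off the input\<close>

primrec occurs :: "'a list \<Rightarrow> 'a list \<Rightarrow> nat \<Rightarrow> nat \<Rightarrow> bool" where
  "occurs [] u p q \<longleftrightarrow> p = q"
| "occurs (a # x) u p q \<longleftrightarrow> letter_at u p = Some a \<and> occurs x u (Suc p) q"

lemma occurs_append: "occurs (x @ y) u p q \<longleftrightarrow> (\<exists>r. occurs x u p r \<and> occurs y u r q)"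
  by (induction x arbitrary: p) auto

lemma occurs_drop: "occurs x u p q \<Longrightarrow> q = p + length x \<and> (\<exists>v. drop p u = x @ v)"
proof (induction x arbitrary: p)
  case (Cons a x)
  then have "letter_at u p = Some a"
    by simp
  then have "drop p u = a # drop (Suc p) u"
    by (auto simp: letter_at_def Cons_nth_drop_Suc split: if_splits)
  then show ?case
    using Cons.IH[of "Suc p"] Cons.prems by auto
qed simp

lemma drop_occurs: "drop p u = x @ v \<Longrightarrow> occurs x u p (p + length x)"
proof (induction x arbitrary: p)
  case (Cons a x)
  have "p < length u"
    using Cons.prems by (cases "p < length u") simp_all
  then have "letter_at u p = Some a" "drop (Suc p) u = x @ v"
    using Cons.prems by (simp_all add: letter_at_def flip: Cons_nth_drop_Suc)
  then show ?case
    using Cons.IH[of "Suc p"] by simp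
qed simp

lemma occurs_bounds:
  assumes "occurs x u p q" "x \<noteq> []"
  shows "p < q" "q \<le> length u"
proof -
  obtain v where v: "q = p + length x" "drop p u = x @ v"
    using occurs_drop[OF assms(1)] by blast
  show "p < q" using v(1) assms(2) by simp
  have "length u - p = length x + length v"
    using arg_cong[OF v(2), of length] by simp
  then show "q \<le> length u" using v(1) assms(2) by (cases x) auto
qed

abbreviation encode_list :: "'p tree list \<Rightarrow> 'p letter list" where
  "encode_list ts \<equiv> concat (map encode ts) @ [LClose]"

lemma encode_form_neq_Nil: "encode_form \<gamma> \<noteq> []"
  by (cases \<gamma>) simp_all

lemma encode_neq_Nil: "encode t \<noteq> []"
  using length_encode_pos[of t] by auto

text \<open>Unique readability, from prefix-freeness: the start position determines the formula and
  its end. Truth values can therefore be tabulated by start positions alone.\<close>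

lemma occurs_form_unique:
  assumes "occurs (encode_form \<gamma>) u p q" "occurs (encode_form \<delta>) u p r"
  shows "\<gamma> = \<delta> \<and> q = r"
  using occurs_drop[OF assms(1)] occurs_drop[OF assms(2)] encode_form_prefix_free by metis

lemma occurs_tree_unique:
  assumes "occurs (encode t) u p q" "occurs (encode t') u p r"
  shows "t = t' \<and> q = r"
  using occurs_drop[OF assms(1)] occurs_drop[OF assms(2)] encode_prefix_free by metis

lemma occurs_list_unique:
  assumes "occurs (encode_list ts) u p q" "occurs (encode_list ts') u p r"
  shows "ts = ts' \<and> q = r"
proof -
  obtain v v' where "encode_list ts @ v = encode_list ts' @ v'" "q = p + length (encode_list ts)"
      "r = p + length (encode_list ts')"
    using occurs_drop[OF assms(1)] occurs_drop[OF assms(2)] by metis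
  then show ?thesis
    using encode_list_prefix_free[OF encode_prefix_free, of ts v ts' v'] by simp
qed

lemma ADT_iff:
  "OR ts \<in> ADT \<longleftrightarrow> ts \<noteq> [] \<and> set ts \<subseteq> ADT" "SAND ts \<in> ADT \<longleftrightarrow> ts \<noteq> [] \<and> set ts \<subseteq> ADT"
  "AND ts \<in> ADT \<longleftrightarrow> ts \<noteq> [] \<and> set ts \<subseteq> ADT" "C t t' \<in> ADT \<longleftrightarrow> t \<in> ADT \<and> t' \<in> ADT"
  "Eps \<in> ADT" "Leaf \<gamma> \<in> ADT"
  by (auto elim: ADT.cases intro: ADT.intros)

lemma ADT_upto_iff [simp]:
  "OR ts \<in> ADT_upto c \<longleftrightarrow> ts \<noteq> [] \<and> set ts \<subseteq> ADT_upto c"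
  "SAND ts \<in> ADT_upto c \<longleftrightarrow> ts \<noteq> [] \<and> set ts \<subseteq> ADT_upto c"
  "AND ts \<in> ADT_upto c \<longleftrightarrow> ts \<noteq> [] \<and> set ts \<subseteq> ADT_upto c"
  "C t t' \<in> ADT_upto c \<longleftrightarrow> t \<in> ADT_upto c \<and> 0 < c \<and> t' \<in> ADT_upto (c - 1)"
  "Eps \<in> ADT_upto c" "Leaf \<gamma> \<in> ADT_upto c"
  by (auto simp: ADT_upto_def ADT_iff)

lemma ADT_upto_mono: "c \<le> c' \<Longrightarrow> ADT_upto c \<subseteq> ADT_upto c'"
  by (auto simp: ADT_upto_def)

definition form_at :: "'p letter list \<Rightarrow> nat \<Rightarrow> nat \<Rightarrow> bool" where
  "form_at u p q \<longleftrightarrow> (\<exists>\<gamma>. occurs (encode_form \<gamma>) u p q)"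

definition tree_at :: "nat \<Rightarrow> 'p letter list \<Rightarrow> nat \<Rightarrow> nat \<Rightarrow> bool" where
  "tree_at c u p q \<longleftrightarrow> (\<exists>t \<in> ADT_upto c. occurs (encode t) u p q)"

definition trees_at :: "nat \<Rightarrow> 'p letter list \<Rightarrow> nat \<Rightarrow> nat \<Rightarrow> bool" where
  "trees_at c u p q \<longleftrightarrow> (\<exists>ts. set ts \<subseteq> ADT_upto c \<and> occurs (encode_list ts) u p q)"

text \<open>At most one list can be read at \<open>p\<close>, so the existential speaks about that
  list and also asserts that it is there.\<close>

definition list_val :: "nat \<Rightarrow> 'p letter list \<Rightarrow> nat \<Rightarrow> ('p tree list \<Rightarrow> bool) \<Rightarrow> bool" where
  "list_val k u p P \<longleftrightarrow> (\<exists>ts q. set ts \<subseteq> ADT_upto k \<and> occurs (encode_list ts) u p q \<and> P ts)"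

definition tree_val :: "nat \<Rightarrow> 'p letter list \<Rightarrow> nat \<Rightarrow> 'p set list \<Rightarrow> bool" where
  "tree_val k u p x \<longleftrightarrow> (\<exists>t \<in> ADT_upto k. \<exists>q. occurs (encode t) u p q \<and> x \<in> sem t)"

definition form_val :: "'p letter list \<Rightarrow> nat \<Rightarrow> 'p set \<Rightarrow> bool" where
  "form_val u p v \<longleftrightarrow> (\<exists>\<gamma> q. occurs (encode_form \<gamma>) u p q \<and> v \<Turnstile> \<gamma>)"

abbreviation factor :: "(nat \<Rightarrow> 'v) \<Rightarrow> nat \<Rightarrow> nat \<Rightarrow> 'v list" where
  "factor W i j \<equiv> map W [i..<j]"

fun intended :: "nat \<Rightarrow> 'p letter list \<Rightarrow> (nat \<Rightarrow> 'p set) \<Rightarrow> 'p label table" where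
  "intended k u W (Prop a) j _ _ \<longleftrightarrow> a \<in> W j"
| "intended k u W Form p q _ \<longleftrightarrow> form_at u p q"
| "intended k u W (Tree c) p q _ \<longleftrightarrow> tree_at c u p q"
| "intended k u W (Trees c) p q _ \<longleftrightarrow> trees_at c u p q"
| "intended k u W FVal p j _ \<longleftrightarrow> form_val u p (W j)"
| "intended k u W Val p i j \<longleftrightarrow> i \<le> j \<and> tree_val k u p (factor W i j)"
| "intended k u W ValOr p i j \<longleftrightarrow> i \<le> j \<and> list_val k u p (\<lambda>ts. factor W i j \<in> sem (OR ts))"
| "intended k u W ValSand p i j \<longleftrightarrow> i \<le> j \<and> list_val k u p (\<lambda>ts. factor W i j \<in> sem (SAND ts))"
| "intended k u W ValAnd p i j \<longleftrightarrow> i \<le> j \<and> list_val k u p (\<lambda>ts. \<forall>t \<in> set ts. factor W i j \<in> sem t \<cdot> UNIV)"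
| "intended k u W Plus _ _ _ \<longleftrightarrow> False"
| "intended k u W Exp2 _ _ _ \<longleftrightarrow> False"

lemma form_val_iff: "occurs (encode_form \<gamma>) u p q \<Longrightarrow> form_val u p v \<longleftrightarrow> v \<Turnstile> \<gamma>"
  unfolding form_val_def using occurs_form_unique by blast

lemma tree_val_iff:
  "occurs (encode t) u p q \<Longrightarrow> t \<in> ADT_upto k \<Longrightarrow> tree_val k u p x \<longleftrightarrow> x \<in> sem t"
  unfolding tree_val_def using occurs_tree_unique by blast

lemma list_val_iff:
  "occurs (encode_list ts) u p q \<Longrightarrow> set ts \<subseteq> ADT_upto k \<Longrightarrow> list_val k u p P \<longleftrightarrow> P ts"
  unfolding list_val_def using occurs_list_unique by blast

lemma form_at_bounds: "form_at u p q \<Longrightarrow> p < q \<and> q \<le> length u"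
  unfolding form_at_def using occurs_bounds encode_form_neq_Nil by blast

lemma tree_at_bounds: "tree_at c u p q \<Longrightarrow> p < q \<and> q \<le> length u"
  unfolding tree_at_def using occurs_bounds encode_neq_Nil by blast

lemma trees_at_bounds: "trees_at c u p q \<Longrightarrow> p < q \<and> q \<le> length u"
  unfolding trees_at_def using occurs_bounds by blast

lemma letter_at_less: "letter_at u p = Some a \<Longrightarrow> p < length u"
  by (simp add: letter_at_def split: if_splits)

lemma ex_form:
  "(\<exists>\<gamma>. P \<gamma>) \<longleftrightarrow> (\<exists>a. P (Atom a)) \<or> (\<exists>\<gamma>. P (Neg \<gamma>)) \<or> (\<exists>\<gamma> \<delta>. P (Conj \<gamma> \<delta>)) \<or> (\<exists>\<gamma> \<delta>. P (Disj \<gamma> \<delta>))"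
  by (metis form.exhaust)

lemma form_at_iff:
  "form_at u p q \<longleftrightarrow> (\<exists>a. letter_at u p = Some (LAtom a)) \<and> q = Suc p \<or>
     letter_at u p = Some LNeg \<and> form_at u (Suc p) q \<or>
     letter_at u p \<in> {Some LConj, Some LDisj} \<and> (\<exists>r. form_at u (Suc p) r \<and> form_at u r q)"
  unfolding form_at_def by (subst ex_form) (auto simp: occurs_append)

lemma ex_list: "(\<exists>ts. P ts) \<longleftrightarrow> P [] \<or> (\<exists>t ts. P (t # ts))"
  by (metis list.exhaust)

lemma trees_at_iff:
  "trees_at c u p q \<longleftrightarrow> letter_at u p = Some LClose \<and> q = Suc p \<or>
     (\<exists>r. tree_at c u p r \<and> trees_at c u r q)"
  unfolding trees_at_def tree_at_def by (subst ex_list) (auto simp: occurs_append)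

lemma ex_tree:
  "(\<exists>t. P t) \<longleftrightarrow> P Eps \<or> (\<exists>\<gamma>. P (Leaf \<gamma>)) \<or> (\<exists>ts. P (OR ts)) \<or> (\<exists>ts. P (SAND ts)) \<or>
     (\<exists>ts. P (AND ts)) \<or> (\<exists>t t'. P (C t t'))"
  by (metis tree.exhaust)

lemma encode_first: "occurs (encode t) u p q \<Longrightarrow> letter_at u p \<noteq> Some LClose"
  using occurs_drop[of "encode t" u p q] encode_neq_LClose(1)[of t]
  by (auto simp: letter_at_def encode_neq_LClose Cons_nth_drop_Suc[symmetric])

lemma occurs_encode_list_nonempty:
  assumes "occurs (encode_list ts) u p q"
  shows "letter_at u p = Some LClose \<longleftrightarrow> ts = []"
  using assms encode_first by (cases ts) (auto simp: occurs_append)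

lemma tree_at_iff:
  "tree_at c u p q \<longleftrightarrow> form_at u p q \<or> letter_at u p = Some LEps \<and> q = Suc p \<or>
     letter_at u p \<in> {Some LOr, Some LSand, Some LAnd} \<and> letter_at u (Suc p) \<noteq> Some LClose \<and>
       trees_at c u (Suc p) q \<or>
     letter_at u p = Some LC \<and> 0 < c \<and> (\<exists>r. tree_at c u (Suc p) r \<and> tree_at (c - 1) u r q)"
proof -
  have list: "(\<exists>ts. ts \<noteq> [] \<and> set ts \<subseteq> ADT_upto c \<and> occurs (encode_list ts) u (Suc p) q) \<longleftrightarrow>
      letter_at u (Suc p) \<noteq> Some LClose \<and> trees_at c u (Suc p) q"
    unfolding trees_at_def using occurs_encode_list_nonempty by blast
  have "tree_at c u p q \<longleftrightarrow> (\<exists>t. t \<in> ADT_upto c \<and> occurs (encode t) u p q)"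
    unfolding tree_at_def by blast
  also have "\<dots> \<longleftrightarrow> letter_at u p = Some LEps \<and> q = Suc p \<or> form_at u p q \<or>
      letter_at u p \<in> {Some LOr, Some LSand, Some LAnd} \<and>
        (\<exists>ts. ts \<noteq> [] \<and> set ts \<subseteq> ADT_upto c \<and> occurs (encode_list ts) u (Suc p) q) \<or>
      letter_at u p = Some LC \<and> 0 < c \<and> (\<exists>r. tree_at c u (Suc p) r \<and> tree_at (c - 1) u r q)"
    unfolding tree_at_def form_at_def by (subst ex_tree) (auto simp: occurs_append)
  finally show ?thesis
    unfolding list by blast
qed

text \<open>Both parts of a split factor are factors again, so two indices suffice to name every
  word met during evaluation.\<close>

lemma factor_conc:
  assumes "i \<le> j"
  shows "factor W i j \<in> A \<cdot> B \<longleftrightarrow> (\<exists>m. i \<le> m \<and> m \<le> j \<and> factor W i m \<in> A \<and> factor W m j \<in> B)"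
proof
  assume "factor W i j \<in> A \<cdot> B"
  then obtain x y where xy: "factor W i j = x @ y" "x \<in> A" "y \<in> B"
    by (auto simp: conc_def)
  let ?m = "i + length x"
  have len: "length x + length y = j - i"
    using arg_cong[OF xy(1), of length] by simp
  then have m: "i \<le> ?m" "?m \<le> j"
    using assms by linarith+
  have "factor W i j = factor W i ?m @ factor W ?m j"
    using m upt_add_eq_append[of i ?m "j - ?m"] by (simp flip: map_append)
  then have "factor W i ?m @ factor W ?m j = x @ y"
    using xy(1) by simp
  then have "factor W i ?m = x" "factor W ?m j = y"
    by (simp_all add: append_eq_append_conv)
  with m xy(2,3) show "\<exists>m. i \<le> m \<and> m \<le> j \<and> factor W i m \<in> A \<and> factor W m j \<in> B"
    by (intro exI[of _ ?m]) simp
next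
  assume "\<exists>m. i \<le> m \<and> m \<le> j \<and> factor W i m \<in> A \<and> factor W m j \<in> B"
  then obtain m where m: "i \<le> m" "m \<le> j" "factor W i m \<in> A" "factor W m j \<in> B"
    by blast
  have "factor W i j = factor W i m @ factor W m j"
    using m upt_add_eq_append[of i m "j - m"] by (simp flip: map_append)
  with m show "factor W i j \<in> A \<cdot> B"
    unfolding conc_def by blast
qed

lemma factor_conc_UNIV:
  "i \<le> j \<Longrightarrow> factor W i j \<in> A \<cdot> UNIV \<longleftrightarrow> (\<exists>m. i \<le> m \<and> m \<le> j \<and> factor W i m \<in> A)"
  by (simp add: factor_conc)

section \<open>The intended tables solve the equations\<close>

context
  fixes S k :: nat and u :: "'p letter list" and W :: "nat \<Rightarrow> 'p set"
  assumes S: "length u < S"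
begin

lemma form_at_less: "form_at u p q \<Longrightarrow> p < q \<and> q < S"
  using form_at_bounds S by fastforce

lemma tree_at_less: "tree_at c u p q \<Longrightarrow> p < q \<and> q < S"
  using tree_at_bounds S by fastforce

lemma trees_at_less: "trees_at c u p q \<Longrightarrow> p < q \<and> q < S"
  using trees_at_bounds S by fastforce

lemma letter_Suc_less: "letter_at u p = Some a \<Longrightarrow> Suc p < S"
  using letter_at_less S by fastforce

lemma ex_Suc: "(\<exists>p'<S. p' = Suc p \<and> P p') \<longleftrightarrow> Suc p < S \<and> P (Suc p)"
  by auto

lemma form_eq_intended: "form_eq S u (intended k u W) p q"
  unfolding form_eq_def ex_Suc intended.simps
  by (subst form_at_iff) (auto dest: letter_Suc_less form_at_less)

lemma tree_eq_intended: "tree_eq c S u (intended k u W) p q"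
  unfolding tree_eq_def ex_Suc intended.simps
  by (subst tree_at_iff) (auto dest: letter_Suc_less tree_at_less)

lemma trees_eq_intended: "trees_eq c S u (intended k u W) p q"
  unfolding trees_eq_def intended.simps
  by (subst trees_at_iff) (auto dest: tree_at_less)

lemma fval_eq_intended: "fval_eq S u (intended k u W) p j"
proof -
  let ?v = "form_val u" and ?x = "W j"
  let ?r = "(\<exists>a. letter_at u p = Some (LAtom a) \<and> a \<in> ?x) \<or> Suc p < S \<and>
    (letter_at u p = Some LNeg \<and> (\<exists>q<S. form_at u (Suc p) q) \<and> \<not> ?v (Suc p) ?x \<or>
     (\<exists>r<S. Suc p < r \<and> form_at u (Suc p) r \<and> (\<exists>q<S. form_at u r q) \<and>
       (letter_at u p = Some LConj \<and> ?v (Suc p) ?x \<and> ?v r ?x \<or>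
        letter_at u p = Some LDisj \<and> (?v (Suc p) ?x \<or> ?v r ?x))))"
  have "?v p ?x \<longleftrightarrow> ?r"
  proof
    assume "?v p ?x"
    then obtain \<gamma> q where \<gamma>: "occurs (encode_form \<gamma>) u p q" "?x \<Turnstile> \<gamma>"
      unfolding form_val_def by blast
    have less: "Suc p < S"
      using form_at_bounds[of u p q] \<gamma>(1) S unfolding form_at_def by fastforce
    have at: "form_at u p' q'" "p' < q'" "q' < S" if "occurs (encode_form \<delta>) u p' q'" for \<delta> p' q'
      using that form_at_less unfolding form_at_def by blast+
    show ?r
    proof (cases \<gamma>)
      case (Neg \<delta>)
      then have "letter_at u p = Some LNeg" "occurs (encode_form \<delta>) u (Suc p) q" "\<not> ?x \<Turnstile> \<delta>"
        using \<gamma> by auto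
      then show ?thesis
        using less at form_val_iff by metis
    next
      case (Conj \<delta> \<delta>')
      then obtain r where "letter_at u p = Some LConj" "occurs (encode_form \<delta>) u (Suc p) r"
          "occurs (encode_form \<delta>') u r q" "?x \<Turnstile> \<delta>" "?x \<Turnstile> \<delta>'"
        using \<gamma> by (auto simp: occurs_append)
      then show ?thesis
        using less at form_val_iff by metis
    next
      case (Disj \<delta> \<delta>')
      then obtain r where "letter_at u p = Some LDisj" "occurs (encode_form \<delta>) u (Suc p) r"
          "occurs (encode_form \<delta>') u r q" "?x \<Turnstile> \<delta> \<or> ?x \<Turnstile> \<delta>'"
        using \<gamma> by (auto simp: occurs_append)
      then show ?thesis
        using less at form_val_iff by metis
    qed (use \<gamma> in auto)
  next
    assume ?r
    then consider a where "letter_at u p = Some (LAtom a)" "a \<in> ?x"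
      | q where "letter_at u p = Some LNeg" "form_at u (Suc p) q" "\<not> ?v (Suc p) ?x"
      | r q where "letter_at u p = Some LConj" "form_at u (Suc p) r" "form_at u r q" "?v (Suc p) ?x" "?v r ?x"
      | r q where "letter_at u p = Some LDisj" "form_at u (Suc p) r" "form_at u r q" "?v (Suc p) ?x \<or> ?v r ?x"
      by blast
    then show "?v p ?x"
    proof cases
      case 1
      then have "occurs (encode_form (Atom a)) u p (Suc p)" "?x \<Turnstile> Atom a"
        by simp_all
      then show ?thesis unfolding form_val_def by blast
    next
      case 2
      then obtain \<delta> where "occurs (encode_form \<delta>) u (Suc p) q" "\<not> ?x \<Turnstile> \<delta>"
        unfolding form_at_def using form_val_iff by metis
      then have "occurs (encode_form (Neg \<delta>)) u p q" "?x \<Turnstile> Neg \<delta>"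
        using 2(1) by simp_all
      then show ?thesis unfolding form_val_def by blast
    next
      case 3
      then obtain \<delta> \<delta>' where "occurs (encode_form \<delta>) u (Suc p) r" "occurs (encode_form \<delta>') u r q" "?x \<Turnstile> \<delta>" "?x \<Turnstile> \<delta>'"
        unfolding form_at_def using form_val_iff by metis
      then have "occurs (encode_form (Conj \<delta> \<delta>')) u p q" "?x \<Turnstile> Conj \<delta> \<delta>'"
        using 3(1) by (auto simp: occurs_append)
      then show ?thesis unfolding form_val_def by blast
    next
      case 4
      then obtain \<delta> \<delta>' where "occurs (encode_form \<delta>) u (Suc p) r" "occurs (encode_form \<delta>') u r q" "?x \<Turnstile> \<delta> \<or> ?x \<Turnstile> \<delta>'"
        unfolding form_at_def using form_val_iff by metis
      then have "occurs (encode_form (Disj \<delta> \<delta>')) u p q" "?x \<Turnstile> Disj \<delta> \<delta>'"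
        using 4(1) by (auto simp: occurs_append)
      then show ?thesis unfolding form_val_def by blast
    qed
  qed
  then show ?thesis
    unfolding fval_eq_def ex_Suc intended.simps by simp
qed

lemma val_eq_intended:
  assumes "j < S"
  shows "val_eq k S u (intended k u W) p i j"
proof -
  let ?f = "factor W i j"
  let ?b = "\<lambda>q. form_at u p q \<and> (\<exists>j'<S. j = Suc j' \<and> i \<le> j' \<and> form_val u p (W j')) \<or>
      letter_at u p = Some LEps \<and> i = j \<or>
      Suc p < S \<and>
        (letter_at u p = Some LOr \<and> list_val k u (Suc p) (\<lambda>ts. ?f \<in> sem (OR ts)) \<or>
         letter_at u p = Some LSand \<and> list_val k u (Suc p) (\<lambda>ts. ?f \<in> sem (SAND ts)) \<or>
         letter_at u p = Some LAnd \<and> list_val k u (Suc p) (\<lambda>ts. ?f \<in> sem (OR ts)) \<and>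
           list_val k u (Suc p) (\<lambda>ts. \<forall>t \<in> set ts. ?f \<in> sem t \<cdot> UNIV) \<or>
         letter_at u p = Some LC \<and> tree_val k u (Suc p) ?f \<and>
           (\<exists>r<S. Suc p < r \<and> tree_at k u (Suc p) r \<and> \<not> tree_val k u r ?f))"
  \<comment> \<open>For a tree known to occur at \<open>p\<close>, the right-hand side of the
    equation computes its semantics.\<close>
  have body: "?b q \<longleftrightarrow> ?f \<in> sem t" if t: "t \<in> ADT_upto k" "occurs (encode t) u p q" and ij: "i \<le> j" for t q
  proof -
    have less: "Suc p < S"
      using tree_at_less[of k p q] t unfolding tree_at_def by force
    \<comment> \<open>By prefix-freeness a formula can be read here only if the tree is a leaf,
      which rules out the first alternative for all other trees.\<close>
    have form: "form_at u p q \<longleftrightarrow> (\<exists>\<gamma>. t = Leaf \<gamma>)"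
      using occurs_tree_unique[OF t(2)] t(2) unfolding form_at_def by (metis encode.simps(2))
    show ?thesis
    proof (cases t)
      case Eps
      then show ?thesis
        using t(2) form ij by auto
    next
      case (Leaf \<gamma>)
      then have occ: "occurs (encode_form \<gamma>) u p q"
        using t(2) by simp
      have "letter_at u p \<notin> {Some LEps, Some LOr, Some LSand, Some LAnd, Some LC}"
        using occ by (cases \<gamma>) auto
      then have "?b q \<longleftrightarrow> (\<exists>j'<S. j = Suc j' \<and> i \<le> j' \<and> W j' \<Turnstile> \<gamma>)"
        using form Leaf form_val_iff[OF occ] by auto
      also have "\<dots> \<longleftrightarrow> ?f \<in> sem t"
        using Leaf assms ij by (cases j) (auto simp: last_map le_Suc_eq)
      finally show ?thesis .
    next
      case (OR ts)
      then have "letter_at u p = Some LOr" "occurs (encode_list ts) u (Suc p) q" "set ts \<subseteq> ADT_upto k"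
        using t by auto
      then show ?thesis
        using less form OR by (simp add: list_val_iff)
    next
      case (SAND ts)
      then have "letter_at u p = Some LSand" "occurs (encode_list ts) u (Suc p) q" "set ts \<subseteq> ADT_upto k"
        using t by auto
      then show ?thesis
        using less form SAND by (simp add: list_val_iff)
    next
      case (AND ts)
      then have "letter_at u p = Some LAnd" "occurs (encode_list ts) u (Suc p) q" "set ts \<subseteq> ADT_upto k"
        using t by auto
      then show ?thesis
        using less form unfolding AND sem_AND by (simp add: list_val_iff)
    next
      case (C t1 t2)
      then obtain r where r: "letter_at u p = Some LC" "occurs (encode t1) u (Suc p) r" "occurs (encode t2) u r q"
          "t1 \<in> ADT_upto k" "t2 \<in> ADT_upto k"
        using t ADT_upto_mono[of "k - 1" k] by (auto simp: occurs_append)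
      have "tree_at k u (Suc p) r' \<longleftrightarrow> r' = r" for r'
        unfolding tree_at_def using r(2,4) occurs_tree_unique by blast
      moreover have "Suc p < r" "r < S"
        using tree_at_less[of k "Suc p" r] r unfolding tree_at_def by blast+
      ultimately show ?thesis
        using less form r C by (auto simp: tree_val_iff[OF r(2,4)] tree_val_iff[OF r(3,5)])
    qed
  qed
  have "i \<le> j \<and> tree_val k u p ?f \<longleftrightarrow> i \<le> j \<and> (\<exists>q<S. tree_at k u p q \<and> ?b q)"
  proof (intro conj_cong refl iffI)
    assume ij: "i \<le> j" and "tree_val k u p ?f"
    then obtain t q where t: "t \<in> ADT_upto k" "occurs (encode t) u p q" "?f \<in> sem t"
      unfolding tree_val_def by blast
    then have "tree_at k u p q"
      unfolding tree_at_def by blast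
    then show "\<exists>q<S. tree_at k u p q \<and> ?b q"
      using body[OF t(1,2) ij] t(3) tree_at_less by blast
  next
    assume ij: "i \<le> j" and "\<exists>q<S. tree_at k u p q \<and> ?b q"
    then obtain t q where t: "t \<in> ADT_upto k" "occurs (encode t) u p q" "?b q"
      unfolding tree_at_def by blast
    then show "tree_val k u p ?f"
      using body[OF t(1,2) ij] unfolding tree_val_def by blast
  qed
  then show ?thesis
    unfolding val_eq_def ex_Suc intended.simps by (auto simp del: sem.simps)
qed

lemma list_val_Cons:
  "list_val k u p P \<longleftrightarrow> letter_at u p = Some LClose \<and> P [] \<or>
    (\<exists>t \<in> ADT_upto k. \<exists>r<S. p < r \<and> occurs (encode t) u p r \<and> list_val k u r (\<lambda>ts. P (t # ts)))"
proof -
  have "p < r \<and> r < S" if "t \<in> ADT_upto k" "occurs (encode t) u p r" for t r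
    using tree_at_less[of k p r] that unfolding tree_at_def by blast
  then show ?thesis
    unfolding list_val_def by (subst ex_list) (auto simp: occurs_append; blast)
qed

lemma or_eq_intended: "or_eq k S (intended k u W) p i j"
proof -
  let ?f = "factor W i j"
  have or: "list_val k u r (\<lambda>ts. ?f \<in> sem (OR (t # ts))) \<longleftrightarrow>
      (\<exists>q<S. trees_at k u r q) \<and> (?f \<in> sem t \<or> list_val k u r (\<lambda>ts. ?f \<in> sem (OR ts)))" for t r
    using trees_at_less unfolding list_val_def trees_at_def by (auto; blast)
  have "list_val k u p (\<lambda>ts. ?f \<in> sem (OR ts)) \<longleftrightarrow>
      (\<exists>r<S. p < r \<and> tree_at k u p r \<and> (\<exists>q<S. trees_at k u r q) \<and>
        (tree_val k u p ?f \<or> list_val k u r (\<lambda>ts. ?f \<in> sem (OR ts))))"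
    unfolding list_val_Cons[of p] or tree_at_def using tree_val_iff by (auto; blast)
  then show ?thesis
    unfolding or_eq_def intended.simps by auto
qed

lemma sand_eq_intended:
  assumes "j < S"
  shows "sand_eq k S u (intended k u W) p i j"
proof -
  have sand: "list_val k u r (\<lambda>ts. factor W i j \<in> sem (SAND (t # ts))) \<longleftrightarrow>
      (\<exists>m<S. i \<le> m \<and> factor W i m \<in> sem t \<and> m \<le> j \<and> list_val k u r (\<lambda>ts. factor W m j \<in> sem (SAND ts)))"
    if "i \<le> j" for t r
    using assms unfolding list_val_def by (simp add: factor_conc[OF that]) (meson le_less_trans)
  have "i \<le> j \<and> list_val k u p (\<lambda>ts. factor W i j \<in> sem (SAND ts)) \<longleftrightarrow> i \<le> j \<and>
      (letter_at u p = Some LClose \<and> i = j \<or>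
      (\<exists>r<S. p < r \<and> tree_at k u p r \<and> (\<exists>m<S. (i \<le> m \<and> tree_val k u p (factor W i m)) \<and>
        m \<le> j \<and> list_val k u r (\<lambda>ts. factor W m j \<in> sem (SAND ts)))))"
    unfolding list_val_Cons[of p] tree_at_def using tree_val_iff
    by (simp add: sand del: sem.simps cong: conj_cong) (auto; blast)
  then show ?thesis
    unfolding sand_eq_def intended.simps by auto
qed

lemma and_eq_intended:
  assumes "j < S"
  shows "and_eq k S u (intended k u W) p i j"
proof -
  let ?l = "\<lambda>r. list_val k u r (\<lambda>ts. \<forall>t \<in> set ts. factor W i j \<in> sem t \<cdot> UNIV)"
  have conj: "list_val k u r (\<lambda>ts. \<forall>t \<in> set (t' # ts). factor W i j \<in> sem t \<cdot> UNIV) \<longleftrightarrow>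
      (\<exists>m<S. i \<le> m \<and> m \<le> j \<and> factor W i m \<in> sem t') \<and> ?l r"
    if "i \<le> j" for t' r
    using assms unfolding list_val_def by (simp add: factor_conc_UNIV[OF that]) (meson le_less_trans)
  have "i \<le> j \<and> ?l p \<longleftrightarrow> i \<le> j \<and>
      (letter_at u p = Some LClose \<or>
      (\<exists>r<S. p < r \<and> tree_at k u p r \<and> ?l r \<and> (\<exists>m<S. m \<le> j \<and> i \<le> m \<and> tree_val k u p (factor W i m))))"
    unfolding list_val_Cons[of p] tree_at_def using tree_val_iff
    by (simp add: conj del: sem.simps list.set cong: conj_cong) (auto; blast)
  then show ?thesis
    unfolding and_eq_def intended.simps by auto
qed

lemma equations_intended: "equations k S u (intended k u W)"
  unfolding equations_def
  by (simp add: form_eq_intended tree_eq_intended trees_eq_intended fval_eq_intended val_eq_intended or_eq_intended sand_eq_intended and_eq_intended)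

end

section \<open>Uniqueness of the tables and correctness\<close>

lemma equations_unique:
  assumes R: "equations k S u R" and R': "equations k S u R'" and Prop: "\<And>a j. R (Prop a) j j j = R' (Prop a) j j j"
  shows "p < S \<Longrightarrow> i < S \<Longrightarrow> R Form p i p = R' Form p i p \<and>
    (\<forall>c\<le>k. R (Tree c) p i p = R' (Tree c) p i p \<and> R (Trees c) p i p = R' (Trees c) p i p) \<and>
    R FVal p i p = R' FVal p i p \<and>
    (\<forall>j<S. R Val p i j = R' Val p i j \<and> R ValOr p i j = R' ValOr p i j \<and>
      R ValSand p i j = R' ValSand p i j \<and> R ValAnd p i j = R' ValAnd p i j)"
\<comment> \<open>Induction from right to left over the input. Within one position the labels come
  in order of dependence: \<open>Tree\<close> uses \<open>Form\<close>, \<open>Trees\<close> uses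
  \<open>Tree\<close>, and the lists use \<open>Val\<close>.\<close>
proof (induction "S - p" arbitrary: p i rule: less_induct)
  case less
  have IH: "R Form p' i p' = R' Form p' i p'" "c \<le> k \<Longrightarrow> R (Tree c) p' i p' = R' (Tree c) p' i p'"
      "c \<le> k \<Longrightarrow> R (Trees c) p' i p' = R' (Trees c) p' i p'" "R FVal p' i p' = R' FVal p' i p'"
      "j < S \<Longrightarrow> R Val p' i j = R' Val p' i j" "j < S \<Longrightarrow> R ValOr p' i j = R' ValOr p' i j"
      "j < S \<Longrightarrow> R ValSand p' i j = R' ValSand p' i j" "j < S \<Longrightarrow> R ValAnd p' i j = R' ValAnd p' i j"
    if "p < p'" "p' < S" "i < S" for p' i j c
    using less.hyps[of p' i] that less.prems by auto
  have eqs: "form_eq S u R p i" "form_eq S u R' p i" "fval_eq S u R p i" "fval_eq S u R' p i"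
      "c \<le> k \<Longrightarrow> tree_eq c S u R p i" "c \<le> k \<Longrightarrow> tree_eq c S u R' p i"
      "c \<le> k \<Longrightarrow> trees_eq c S u R p i" "c \<le> k \<Longrightarrow> trees_eq c S u R' p i"
      "j < S \<Longrightarrow> val_eq k S u R p i j" "j < S \<Longrightarrow> val_eq k S u R' p i j"
      "j < S \<Longrightarrow> or_eq k S R p i j" "j < S \<Longrightarrow> or_eq k S R' p i j"
      "j < S \<Longrightarrow> sand_eq k S u R p i j" "j < S \<Longrightarrow> sand_eq k S u R' p i j"
      "j < S \<Longrightarrow> and_eq k S u R p i j" "j < S \<Longrightarrow> and_eq k S u R' p i j"
    if "i < S" for i j c
    using R R' less.prems that unfolding equations_def by auto
  \<comment> \<open>The congruence rule supplies guards such as \<open>p' < r\<close>, without which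
    the induction hypothesis could not rewrite.\<close>
  have Form: "R Form p i p = R' Form p i p" if "i < S" for i
    unfolding eqs(1)[OF that, unfolded form_eq_def] eqs(2)[OF that, unfolded form_eq_def]
    using that by (simp add: IH cong: conj_cong)
  have Tree: "R (Tree c) p i p = R' (Tree c) p i p" if "i < S" "c \<le> k" for i c
    unfolding eqs(5)[OF that, unfolded tree_eq_def] eqs(6)[OF that, unfolded tree_eq_def]
    using that by (simp add: IH Form cong: conj_cong)
  have Trees: "R (Trees c) p i p = R' (Trees c) p i p" if "i < S" "c \<le> k" for i c
    unfolding eqs(7)[OF that, unfolded trees_eq_def] eqs(8)[OF that, unfolded trees_eq_def]
    using that by (simp add: IH Tree cong: conj_cong)
  have FVal: "R FVal p i p = R' FVal p i p" if "i < S" for i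
    unfolding eqs(3)[OF that, unfolded fval_eq_def] eqs(4)[OF that, unfolded fval_eq_def]
    using that by (simp add: IH Prop cong: conj_cong)
  have Val: "R Val p i j = R' Val p i j" if "i < S" "j < S" for i j
    unfolding eqs(9)[OF that, unfolded val_eq_def] eqs(10)[OF that, unfolded val_eq_def]
    using that by (simp add: IH Tree Form FVal cong: conj_cong)
  have ValOr: "R ValOr p i j = R' ValOr p i j" if "i < S" "j < S" for i j
    unfolding eqs(11)[OF that, unfolded or_eq_def] eqs(12)[OF that, unfolded or_eq_def]
    using that by (simp add: IH Tree Val cong: conj_cong)
  have ValSand: "R ValSand p i j = R' ValSand p i j" if "i < S" "j < S" for i j
    unfolding eqs(13)[OF that, unfolded sand_eq_def] eqs(14)[OF that, unfolded sand_eq_def]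
    using that by (simp add: IH Tree Val cong: conj_cong)
  have ValAnd: "R ValAnd p i j = R' ValAnd p i j" if "i < S" "j < S" for i j
    unfolding eqs(15)[OF that, unfolded and_eq_def] eqs(16)[OF that, unfolded and_eq_def]
    using that by (simp add: IH Tree Val cong: conj_cong)
  show ?case
    using less.prems Form Tree Trees FVal Val ValOr ValSand ValAnd by simp
qed

lemma accepting_sound:
  assumes "accepting k S u R"
  shows "\<exists>t \<in> ADT_upto k. u = encode t \<and> sem t \<noteq> {}"
proof -
  obtain n j where n: "n < S" "j < S" "letter_at u n = None" "R (Tree k) 0 n 0" "R Val 0 0 j"
    and eqs: "equations k S u R"
    using assms unfolding accepting_def by auto
  \<comment> \<open>The word is read off the guessed entries of \<open>Prop\<close>; all other
    relevant entries are then forced to be the intended ones.\<close>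
  let ?W = "\<lambda>j. {a. R (Prop a) j j j}"
  have S: "length u < S"
    using n(1,3) by (simp add: letter_at_None)
  have "R (Tree k) 0 n 0 = intended k u ?W (Tree k) 0 n 0" "R Val 0 0 j = intended k u ?W Val 0 0 j"
    using equations_unique[OF eqs equations_intended[OF S, of k ?W], of 0] n S by auto
  then have "tree_at k u 0 n" and val: "tree_val k u 0 (factor ?W 0 j)"
    using n(4,5) by simp_all
  then obtain t where t: "t \<in> ADT_upto k" "occurs (encode t) u 0 n"
    unfolding tree_at_def by blast
  then obtain v where v: "n = length (encode t)" "u = encode t @ v"
    using occurs_drop by fastforce
  \<comment> \<open>\<open>n\<close> is the length of \<open>encode t\<close> and lies beyond the
    input, so nothing follows the tree.\<close>
  then have "u = encode t"
    using n(3) by (simp add: letter_at_None)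
  moreover have "factor ?W 0 j \<in> sem t"
    using val tree_val_iff[OF t(2,1)] by simp
  ultimately show ?thesis
    using t(1) by blast
qed

lemma accepting_complete:
  assumes "t \<in> ADT_upto k" "x \<in> sem t" "length x < S" "length (encode t) < S"
  shows "\<exists>R. accepting k S (encode t) R"
proof -
  \<comment> \<open>Beyond the end of \<open>x\<close> the value of \<open>x ! j\<close> is
    arbitrary; the factor that matters stops at \<open>length x\<close>.\<close>
  let ?u = "encode t" and ?W = "\<lambda>j. x ! j"
  let ?n = "length ?u"
  have "occurs ?u ?u 0 (0 + ?n)"
    by (rule drop_occurs[where v = "[]"]) simp
  then have occ: "occurs (encode t) ?u 0 ?n"
    by simp
  have "factor ?W 0 (length x) = x"
    by (simp add: map_nth)
  then have "tree_at k ?u 0 ?n" "tree_val k ?u 0 (factor ?W 0 (length x))"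
    using occ assms(1,2) unfolding tree_at_def tree_val_def by auto
  moreover have "letter_at ?u ?n = None"
    by (simp add: letter_at_None)
  ultimately have "accepting k S ?u (intended k ?u ?W)"
    unfolding accepting_def using equations_intended[OF assms(4)] assms(3,4)
    by (intro conjI exI[of _ ?n] exI[of _ "0 :: nat"] exI[of _ "length x"]) simp_all
  then show ?thesis
    by (rule exI[of "accepting k S ?u"])
qed

text \<open>Multiplying adds arguments: the three factors take \<open>n + 1\<close> each, the
  summand 1 one unit more, and \<open>K\<close> lies below the exponential of \<open>K + 1\<close>,
  in all 3(n + 1) + 1 + (K + 1).\<close>

lemma space_bound:
  "K * (Suc (iterated_exp (Suc m) n) * Suc (iterated_exp (Suc m) n) * Suc (iterated_exp (Suc m) n) + 1)
    \<le> iterated_exp (Suc m) (K + 3 * n + 5)"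
proof -
  let ?e = "iterated_exp (Suc m)"
  have 1: "Suc (?e n) \<le> ?e (n + 1)"
    using iterated_exp_plus1[of m n] by simp
  have "Suc (?e n) * Suc (?e n) \<le> ?e (n + 1) * ?e (n + 1)"
    by (rule mult_le_mono[OF 1 1])
  also have "\<dots> \<le> ?e ((n + 1) + (n + 1))"
    by (rule iterated_exp_mult) simp_all
  finally have "Suc (?e n) * Suc (?e n) * Suc (?e n) \<le> ?e ((n + 1) + (n + 1)) * ?e (n + 1)"
    by (rule mult_le_mono[OF _ 1])
  also have "\<dots> \<le> ?e ((n + 1) + (n + 1) + (n + 1))"
    by (rule iterated_exp_mult) simp_all
  finally have "Suc (?e n) * Suc (?e n) * Suc (?e n) + 1 \<le> ?e ((n + 1) + (n + 1) + (n + 1)) + 1"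
    by simp
  also have "\<dots> \<le> ?e ((n + 1) + (n + 1) + (n + 1) + 1)"
    by (rule iterated_exp_plus1)
  finally have "K * (Suc (?e n) * Suc (?e n) * Suc (?e n) + 1) \<le> ?e (Suc K) * ?e ((n + 1) + (n + 1) + (n + 1) + 1)"
    using le_iterated_exp[of "Suc K" "Suc m"] by (intro mult_le_mono) simp_all
  also have "\<dots> \<le> ?e (Suc K + ((n + 1) + (n + 1) + (n + 1) + 1))"
    by (rule iterated_exp_mult) simp_all
  also have "Suc K + ((n + 1) + (n + 1) + (n + 1) + 1) = K + 3 * n + 5"
    by simp
  finally show ?thesis .
qed

theorem proposition6:
  fixes k :: nat
  assumes "k \<ge> 1"
  shows "{encode \<theta> |\<theta> :: 'p::finite tree. \<theta> \<in> ADT_upto k \<and> sem \<theta> \<noteq> {}} \<in> EXPSPACE (k + 1)"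
proof -
  let ?L = "{encode \<theta> |\<theta> :: 'p tree. \<theta> \<in> ADT_upto k \<and> sem \<theta> \<noteq> {}}"
  let ?P = "Pow (labels k :: 'p label set)"
  have "finite ?P"
    by (simp add: labels_def)
  \<comment> \<open>Numbering the sets of labels fixes the tape alphabet, which depends on
    \<open>k\<close> and the propositions only.\<close>
  then obtain dec where dec: "bij_betw dec {0..<card ?P} ?P"
    using ex_bij_betw_nat_finite by blast
  interpret tree_labelling k dec "card ?P"
  proof
    show "\<exists>a<card ?P. dec a = X" if "X \<subseteq> labels k" for X
    proof -
      have "X \<in> dec ` {0..<card ?P}"
        using dec that by (simp add: bij_betw_def)
      then show ?thesis by auto
    qed
  qed
  obtain K :: nat where K: "\<And>L s. (\<And>u. \<exists>S. 1 \<le> S \<and>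
      (\<forall>i. 1 \<le> i \<longrightarrow> i < S \<longrightarrow> (\<nexists>R. accepting k i u R) \<and> (\<nexists>R. stopping (k + 1) i u R)) \<and>
      ((\<exists>R. accepting k S u R) \<or> (\<exists>R. stopping (k + 1) S u R)) \<and> (u \<in> L \<longleftrightarrow> (\<exists>R. accepting k S u R)) \<and>
      K * (S * S * S + 1) \<le> s (length u)) \<Longrightarrow> \<exists>M :: 'p letter tm. turing_machine M \<and> decides_in_space M L s"
  proof (rule decides_in_space_definable[OF definable_accepting definable_stopping[of "k + 1"]], goal_cases)
    case (1 K)
    show ?case
      by (rule 1(1)) (rule 1(2))
  qed
  have "\<exists>M. turing_machine M \<and> decides_in_space M ?L (\<lambda>n. iterated_exp (k + 1) (K + 3 * (4 * n) + 5))"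
  proof (rule K)
    fix u :: "'p letter list"
    let ?e = "iterated_exp (k + 1) (4 * length u)"
    let ?A = "\<lambda>S. \<exists>R. accepting k S u R" and ?T = "\<lambda>S. \<exists>R. stopping (k + 1) S u R"
    have A: "?A S \<Longrightarrow> u \<in> ?L" for S
      using accepting_sound by blast
    \<comment> \<open>The input and a word shorter than \<open>?e\<close>, with the positions at
      their ends, fit into \<open>Suc ?e\<close> indices.\<close>
    have A': "?A (Suc ?e)" if u: "u \<in> ?L"
    proof -
      obtain t :: "'p tree" where t: "u = encode t" "t \<in> ADT_upto k" "sem t \<noteq> {}"
        using u by blast
      obtain x where x: "x \<in> sem t" "length x < ?e"
        using short_witness[OF t(2,3)] t(1) by auto
      have "length u \<le> ?e"
        using le_iterated_exp[of "4 * length u" "k + 1"] by simp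
      then show ?thesis
        unfolding t(1) using x t(1) by (intro accepting_complete[OF t(2) x(1)]) simp_all
    qed
    have T: "?T S \<longleftrightarrow> S = Suc ?e" for S
      by (rule stopping_iff)
    define S where "S = (LEAST S. 1 \<le> S \<and> (?A S \<or> ?T S))"
    have S: "1 \<le> S \<and> (?A S \<or> ?T S)"
      unfolding S_def by (rule LeastI[of _ "Suc ?e"]) (use T[of "Suc ?e"] in simp)
    have least: "S \<le> i" if "1 \<le> i" "?A i \<or> ?T i" for i
      unfolding S_def by (rule Least_le) (use that in blast)
    have le: "S \<le> Suc ?e"
      using least[of "Suc ?e"] T[of "Suc ?e"] by simp
    \<comment> \<open>Stopping cannot preempt acceptance: at the stopping size \<open>Suc ?e\<close>
      a word of the language has its accepting table, and acceptance is tested before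
      stopping.\<close>
    have "?A S" if u: "u \<in> ?L"
    proof (rule ccontr)
      assume no: "\<not> ?A S"
      then have eq: "S = Suc ?e"
        using S T[of S] by iprover
      show False
        using no A'[OF u] unfolding eq by (rule notE)
    qed
    then have "u \<in> ?L \<longleftrightarrow> ?A S"
      using A[of S] by iprover
    moreover have "K * (S * S * S + 1) \<le> iterated_exp (k + 1) (K + 3 * (4 * length u) + 5)"
    proof -
      have "K * (S * S * S + 1) \<le> K * (Suc ?e * Suc ?e * Suc ?e + 1)"
        using le by (intro mult_le_mono add_le_mono) simp_all
      also have "\<dots> \<le> iterated_exp (k + 1) (K + 3 * (4 * length u) + 5)"
        using space_bound[of K k "4 * length u"] by simp
      finally show ?thesis .
    qed
    moreover have "\<not> ?A i \<and> \<not> ?T i" if "1 \<le> i" "i < S" for i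
      using least[OF that(1)] that(2) by (meson not_le)
    ultimately show "\<exists>S. 1 \<le> S \<and> (\<forall>i. 1 \<le> i \<longrightarrow> i < S \<longrightarrow> \<not> ?A i \<and> \<not> ?T i) \<and> (?A S \<or> ?T S) \<and>
        (u \<in> ?L \<longleftrightarrow> ?A S) \<and> K * (S * S * S + 1) \<le> iterated_exp (k + 1) (K + 3 * (4 * length u) + 5)"
      using S by (intro exI[of _ S]) simp
  qed
  then obtain M where M: "turing_machine M"
      "decides_in_space M ?L (\<lambda>n. iterated_exp (k + 1) (K + 3 * (4 * n) + 5))"
    by blast
  \<comment> \<open>12 = 3 * 4, from the cube of the size and the 4 in the argument of
    \<open>?e\<close>.\<close>
  have poly: "poly [:K + 5, 12:] n = K + 3 * (4 * n) + 5" for n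
    by simp
  show ?thesis
    unfolding EXPSPACE_def using M by (intro CollectI exI[of _ M] exI[of _ "[:K + 5, 12:]"]) (simp only: poly simp_thms)
qed

end
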